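(* Let $r\in\mathbb{Z}_{>0}$. Let $t_1,\ldots,t_6,p,q\in\mathbb{C}^*$ and $n_1,\ldots,n_6\in\mathbb{Z}$ be such that $|t_a|,|p|,|q|<1$ and $$\prod_{a=1}^6t_a=pq,\qquad \sum_{a=1}^6n_a+3\epsilon=0,\qquad \epsilon\in\{0,1\}.$$ Then $$\kappa^{(r)}\sum_{m=0}^{r-1}\int_{\mathbb{T}}\frac{\prod_{a=1}^6\Gamma^{(r)}(t_az,n_a+m+\epsilon)\,\Gamma^{(r)}(t_az^{-1},n_a-m)}{\Gamma^{(r)}(z^{2},2m+\epsilon)\,\Gamma^{(r)}(z^{-2},-2m-\epsilon)}\frac{dz}{z}=\prod_{1\le a<b\le6}\Gamma^{(r)}(t_at_b,n_a+n_b+\epsilon),$$ where $\kappa^{(r)}=\dfrac{(p^r;p^r)_\infty(q^r;q^r)_\infty}{4\pi\mathrm{i}}$ and $\mathbb{T}$ is the positively oriented unit circle.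
   Context: Notation: $(z;p)_\infty=\prod_{j\ge0}(1-zp^j)$ for $|p|<1$. The elliptic gamma function is $\Gamma(z;p,q)=\prod_{j,k=0}^\infty\frac{1-z^{-1}p^{j+1}q^{k+1}}{1-zp^jq^k}$ for $|p|,|q|<1$, $z\in\mathbb{C}^*$. For $r\in\mathbb{Z}_{>0}$, $m\in\mathbb{Z}$, nonzero $p,q$ with $|p|,|q|<1$, the rarefied elliptic gamma function is the meromorphic function of $z\in\mathbb{C}^*$ $$\Gamma^{(r)}(z,m)=\Gamma^{(r)}(z,m;p,q)=(-z)^{\frac{m(m-1)}{2}}p^{\frac{m(m-1)(m-2)}{6}}q^{-\frac{m(m^2-1)}{6}}\;\Gamma(zp^m;p^r,pq)\,\Gamma(zq^{r-m};q^r,pq)$$ (the elementary prefactor equals $\left(-\frac{z}{\sqrt{pq}}\right)^{m(m-1)/2}\left(\frac pq\right)^{m(m-1)(2m-1)/12}$; all exponents written above are integers). Products and quotients of these functions are understood as meromorphic functions. *)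

theory Defs
  imports "HOL-Complex_Analysis.Complex_Analysis"
begin

definition qpoch_inf :: "complex \<Rightarrow> complex \<Rightarrow> complex" where
  "qpoch_inf z p = (\<Prod>j. 1 - z * p ^ j)"

(* The double product converges absolutely for norm p < 1, norm q < 1 and z outside the
   poles, so it is independent of the order; at a pole the value is 0, since x / 0 = 0. *)
definition ell_gamma :: "complex \<Rightarrow> complex \<Rightarrow> complex \<Rightarrow> complex" where
  "ell_gamma z p q =
     (\<Prod>j. \<Prod>k. (1 - inverse z * p ^ (j + 1) * q ^ (k + 1)) / (1 - z * p ^ j * q ^ k))"

(* The three integer divisions are exact.  For m outside {0..r} a pole of one elliptic gamma
   factor may be cancelled by a zero of the other, so the pointwise value of this expression
   can be wrong at isolated points. *)
definition rgamma_expr ::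
  "nat \<Rightarrow> complex \<Rightarrow> complex \<Rightarrow> complex \<Rightarrow> int \<Rightarrow> complex" where
  "rgamma_expr r p q z m =
     (- z) powi (m * (m - 1) div 2)
     * p powi (m * (m - 1) * (m - 2) div 6)
     * q powi (- (m * (m ^ 2 - 1) div 6))
     * ell_gamma (z * p powi m) (p ^ r) (p * q)
     * ell_gamma (z * q powi (int r - m)) (q ^ r) (p * q)"

(* The rarefied elliptic gamma function as a meromorphic function of z: removable
   singularities are filled in by the limit, and the value at a genuine pole is 0. *)
definition rgamma ::
  "nat \<Rightarrow> complex \<Rightarrow> complex \<Rightarrow> complex \<Rightarrow> int \<Rightarrow> complex" where
  "rgamma r p q z m = remove_sings (\<lambda>w. rgamma_expr r p q w m) z"

definition kappa :: "nat \<Rightarrow> complex \<Rightarrow> complex \<Rightarrow> complex" where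
  "kappa r p q =
     qpoch_inf (p ^ r) (p ^ r) * qpoch_inf (q ^ r) (q ^ r) / (4 * of_real pi * \<i>)"

(* On the unit circle, with 0 < norm (t a) < 1, the numerator has no poles, and the factors of
   the denominator have no zeros there as meromorphic functions, only possibly poles.  At such
   a pole rgamma is 0 and division by it gives 0, which is the value of the meromorphic
   quotient.  So the pointwise quotient agrees with the meromorphic one on the whole circle. *)
definition beta_integrand ::
  "nat \<Rightarrow> complex \<Rightarrow> complex \<Rightarrow> (nat \<Rightarrow> complex) \<Rightarrow> (nat \<Rightarrow> int) \<Rightarrow> int \<Rightarrow> int \<Rightarrow> complex \<Rightarrow> complex"
  where
  "beta_integrand r p q t n \<epsilon> m z =
     (\<Prod>a=1..6. rgamma r p q (t a * z) (n a + m + \<epsilon>)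
              * rgamma r p q (t a * inverse z) (n a - m))
     / (rgamma r p q (z ^ 2) (2 * m + \<epsilon>)
        * rgamma r p q (inverse z ^ 2) (- 2 * m - \<epsilon>))"

end

theory Submission
  imports Defs
begin

text \<open>Let $\Phi(t, n)$ be the quotient of the sum of integrals by the product on the right-hand
  side. By an addition formula for theta functions, the difference of the integrands with $t_i$
  and with $t_j$ multiplied by $q$ (both suitably weighted) has the form
  $G_m(z) - G_{m-1}(z/q)$, with $G$ periodic in $m$ modulo $r$, and is annihilated by summation
  over $m$ and a shift of the contour. Hence $\Phi$ is invariant under
  $(t_i, n_i; t_j, n_j) \mapsto (q t_i, n_i + 1; q^{-1} t_j, n_j - 1)$. If $|t_i t_j| < |q|$, then $\Phi$
  is holomorphic in $t_i$ (with $t_i t_j$ fixed) on an annulus wider than a period, so it is constant by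
  the maximum principle. Its value is found by moving the parameters to $t_i t_l \to 1$, where
  the contour is pinched and only residues contribute. Analytic continuation removes the condition
  $|t_i t_j| < |q|$ when $|p| \le |q|$, and the symmetry $p \leftrightarrow q$,
  $n_a \mapsto - n_a - \epsilon$ covers the other case.\<close>

section \<open>Infinite q-products\<close>

text \<open>No shift by p is used, so no independence of p and q is required. A shift by q moves a
  parameter and its integer together; the finitely many functions obtained for the integers modulo r
  are permuted by it, and an annulus wider than the period forces them all to be one and the same
  constant. The price is a pair with |t_i t_j| < |q|, which need not exist. If |p| <= |q|, however,
  five of the parameters have a product of modulus less than |q|, and analytic continuation lowers
  five to two. As the constant is the same for all integers, a single pinching limit suffices, with
  n_i = - \<epsilon> and n_l = 0. The denominator of the integrand is replaced by a product of two
  theta functions, so that only the poles belonging to the parameters occur. The elementary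
  prefactor of the gamma function makes the integrand periodic in m modulo r. All multipliers are
  exponentials of polynomials; once logarithms with a prescribed sum are fixed, every such claim is
  a polynomial identity that follows from the two balancing conditions.\<close>

definition qprod :: "(complex \<Rightarrow> complex) \<Rightarrow> complex \<Rightarrow> complex \<Rightarrow> complex" where
  "qprod h p z = (\<Prod>j. h (z * p ^ j))"

context
  fixes h :: "complex \<Rightarrow> complex" and p :: complex
  assumes h: "h holomorphic_on UNIV" and h0: "h 0 = 1" and p: "norm p < 1"
begin

text \<open>As \<open>h - 1\<close> vanishes at 0, it is the product of the variable and an entire
  function \<open>k\<close>, which is bounded on discs. Hence the factors approach 1 geometrically
  and uniformly on discs.\<close>

lemma qprod_factor_bound:
  obtains C where "C \<ge> 0" "\<And>z j. norm z \<le> R \<Longrightarrow> norm (h (z * p ^ j) - 1) \<le> C * norm p ^ j"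
proof -
  define k where "k = (\<lambda>z. if z = 0 then deriv h 0 else (h z - h 0) / (z - 0))"
  have "k holomorphic_on UNIV"
    unfolding k_def by (rule pole_lemma_open) (use h in auto)
  hence "continuous_on (cball 0 R) k"
    using holomorphic_on_imp_continuous_on continuous_on_subset by blast
  hence "bounded (k ` cball 0 R)"
    by (intro compact_imp_bounded compact_continuous_image) auto
  then obtain C where C: "\<And>z. norm z \<le> R \<Longrightarrow> norm (k z) \<le> C"
    unfolding bounded_iff by (metis imageI mem_cball_0)
  have eq: "h z - 1 = z * k z" for z
    by (auto simp: k_def h0)
  show ?thesis
  proof (rule that[of "max C 0 * max R 0"])
    fix z :: complex and j :: nat
    assume z: "norm z \<le> R"
    have pj: "norm p ^ j \<le> 1"
      using p by (intro power_le_one) auto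
    have "norm (z * p ^ j) \<le> norm z * 1"
      unfolding norm_mult norm_power by (intro mult_left_mono pj) auto
    with z have "norm (z * p ^ j) \<le> R" by simp
    from C[OF this] have "norm (k (z * p ^ j)) \<le> max C 0" by simp
    moreover have "norm (z * p ^ j) \<le> max R 0 * norm p ^ j"
      unfolding norm_mult norm_power using z by (intro mult_right_mono) auto
    ultimately have "norm (z * p ^ j) * norm (k (z * p ^ j)) \<le> (max R 0 * norm p ^ j) * max C 0"
      by (intro mult_mono) auto
    thus "norm (h (z * p ^ j) - 1) \<le> max C 0 * max R 0 * norm p ^ j"
      by (subst eq) (simp add: norm_mult mult_ac)
  qed auto
qed

lemma qprod_convergent: "convergent_prod (\<lambda>j. h (z * p ^ j))"
proof -
  obtain C where C: "C \<ge> 0" "\<And>w j. norm w \<le> norm z \<Longrightarrow> norm (h (w * p ^ j) - 1) \<le> C * norm p ^ j"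
    using qprod_factor_bound[of "norm z"] by metis
  have "summable (\<lambda>j. norm (h (z * p ^ j) - 1))"
  proof (rule summable_comparison_test')
    show "summable (\<lambda>j. C * norm p ^ j)"
      using p by (intro summable_mult summable_geometric) auto
  qed (use C in auto)
  hence "abs_convergent_prod (\<lambda>j. h (z * p ^ j))"
    by (rule summable_imp_abs_convergent_prod)
  thus ?thesis by (rule abs_convergent_prod_imp_convergent_prod)
qed

lemma qprod_holomorphic: "qprod h p holomorphic_on A"
proof -
  have lim: "(\<lambda>n. \<Prod>j<n. h (z * p ^ j)) \<longlonglongrightarrow> qprod h p z" for z
    using convergent_prod_LIMSEQ[OF qprod_convergent[of z]]
    unfolding qprod_def LIMSEQ_lessThan_iff_atMost .
  have hc: "continuous_on A h" for A
    using h holomorphic_on_imp_continuous_on continuous_on_subset by blast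
  have unif: "uniform_limit (cball 0 R) (\<lambda>n z. \<Prod>j<n. h (z * p ^ j)) (qprod h p) sequentially" for R
  proof -
    obtain C where C: "C \<ge> 0" "\<And>w j. norm w \<le> R \<Longrightarrow> norm (h (w * p ^ j) - 1) \<le> C * norm p ^ j"
      using qprod_factor_bound[of R] by metis
    have "uniformly_convergent_on (cball 0 R) (\<lambda>n z. \<Prod>j<n. h (z * p ^ j))"
    proof (rule uniformly_convergent_on_prod')
      show "continuous_on (cball 0 R) (\<lambda>z. h (z * p ^ j))" for j
        by (rule continuous_on_compose2[OF hc[of UNIV]]) (auto intro!: continuous_intros)
      show "uniformly_convergent_on (cball 0 R) (\<lambda>N x. \<Sum>n<N. norm (h (x * p ^ n) - 1))"
      proof (rule Weierstrass_m_test')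
        show "summable (\<lambda>j. C * norm p ^ j)"
          using p by (intro summable_mult summable_geometric) auto
      qed (use C in auto)
    qed auto
    then obtain l where l: "uniform_limit (cball 0 R) (\<lambda>n z. \<Prod>j<n. h (z * p ^ j)) l sequentially"
      unfolding uniformly_convergent_on_def by blast
    have "l z = qprod h p z" if "z \<in> cball 0 R" for z
      using LIMSEQ_unique[OF tendsto_uniform_limitI[OF l that] lim] .
    thus ?thesis using l by (metis (no_types, lifting) uniform_limit_cong')
  qed
  have "qprod h p holomorphic_on UNIV"
  proof (rule holomorphic_uniform_sequence[where f = "\<lambda>n z. \<Prod>j<n. h (z * p ^ j)"])
    show "(\<lambda>z. \<Prod>j<n. h (z * p ^ j)) holomorphic_on UNIV" for n
    proof (intro holomorphic_intros)
      fix j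
      have "(h \<circ> (\<lambda>z. z * p ^ j)) holomorphic_on UNIV"
        by (rule holomorphic_on_compose_gen[of _ _ _ UNIV]) (auto intro!: holomorphic_intros h)
      thus "(\<lambda>z. h (z * p ^ j)) holomorphic_on UNIV" by (simp add: o_def)
    qed
    show "\<exists>d>0. cball x d \<subseteq> UNIV \<and> uniform_limit (cball x d)
        (\<lambda>n z. \<Prod>j<n. h (z * p ^ j)) (qprod h p) sequentially" for x
    proof (intro exI[of _ 1] conjI)
      have "cball x 1 \<subseteq> cball 0 (norm x + 1)"
        by (auto simp: dist_norm) (smt (verit) norm_triangle_ineq4 norm_minus_commute norm_triangle_sub)
      from uniform_limit_on_subset[OF unif this]
      show "uniform_limit (cball x 1) (\<lambda>n z. \<Prod>j<n. h (z * p ^ j)) (qprod h p) sequentially" .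
    qed auto
  qed auto
  thus ?thesis using holomorphic_on_subset by blast
qed

lemma qprod_0: "qprod h p 0 = 1"
  by (simp add: qprod_def h0)

lemma qprod_rec: "qprod h p z = h z * qprod h p (z * p)"
proof -
  have "(\<lambda>j. h (z * p ^ Suc j)) has_prod qprod h p (z * p)"
    using convergent_prod_has_prod[OF qprod_convergent[of "z * p"]]
    by (simp add: qprod_def mult_ac)
  hence "(\<lambda>j. h (z * p ^ j)) has_prod (qprod h p (z * p) * h (z * p ^ 0))"
    by (rule has_prod_Suc_imp)
  from has_prod_unique[OF this] show ?thesis by (simp add: qprod_def mult.commute)
qed

lemma qprod_eq_0_iff: "qprod h p z = 0 \<longleftrightarrow> (\<exists>j. h (z * p ^ j) = 0)"
  using has_prod_eq_0_iff[OF convergent_prod_has_prod[OF qprod_convergent[of z]]]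
  by (auto simp: qprod_def)

end

section \<open>The q-Pochhammer symbol and its double version\<close>

lemma qpoch_inf_eq_qprod: "qpoch_inf z p = qprod (\<lambda>z. 1 - z) p z"
  by (simp add: qpoch_inf_def qprod_def)

context
  fixes p :: complex
  assumes p: "norm p < 1"
begin

lemma qpoch_inf_holomorphic: "(\<lambda>z. qpoch_inf z p) holomorphic_on A"
  unfolding qpoch_inf_eq_qprod
  by (rule qprod_holomorphic) (use p in \<open>auto intro!: holomorphic_intros\<close>)

lemma qpoch_inf_0: "qpoch_inf 0 p = 1"
  by (simp add: qpoch_inf_def)

lemma qpoch_inf_rec: "qpoch_inf z p = (1 - z) * qpoch_inf (z * p) p"
  unfolding qpoch_inf_eq_qprod
  by (rule qprod_rec) (use p in \<open>auto intro!: holomorphic_intros\<close>)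

lemma qpoch_inf_eq_0_iff: "qpoch_inf z p = 0 \<longleftrightarrow> (\<exists>j. z * p ^ j = 1)"
  unfolding qpoch_inf_eq_qprod
  by (subst qprod_eq_0_iff) (use p in \<open>auto intro!: holomorphic_intros\<close>)

lemma qpoch_inf_convergent: "convergent_prod (\<lambda>j. 1 - z * p ^ j)"
  by (rule qprod_convergent) (use p in \<open>auto intro!: holomorphic_intros\<close>)

lemma qpoch_inf_nonzero: "norm z < 1 \<Longrightarrow> qpoch_inf z p \<noteq> 0"
proof
  assume z: "norm z < 1" and "qpoch_inf z p = 0"
  then obtain j where "z * p ^ j = 1" by (auto simp: qpoch_inf_eq_0_iff)
  hence "norm z * norm p ^ j = 1" by (metis norm_mult norm_one norm_power)
  moreover have "norm z * norm p ^ j \<le> norm z * 1"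
    using p by (intro mult_left_mono power_le_one) auto
  ultimately show False using z by simp
qed

end

text \<open>The double product of 1 - z p^j q^k, written as an iterated product so that the facts
  about \<open>qprod\<close> apply with the inner product as \<open>h\<close>.\<close>

definition dpoch :: "complex \<Rightarrow> complex \<Rightarrow> complex \<Rightarrow> complex" where
  "dpoch p q z = qprod (\<lambda>w. qpoch_inf w q) p z"

context
  fixes p q :: complex
  assumes p: "norm p < 1" and q: "norm q < 1"
begin

lemma dpoch_holomorphic: "dpoch p q holomorphic_on A"
  unfolding dpoch_def
  by (rule qprod_holomorphic) (use p q in \<open>auto simp: qpoch_inf_0 intro!: qpoch_inf_holomorphic\<close>)

lemma dpoch_0: "dpoch p q 0 = 1"
  unfolding dpoch_def
  by (rule qprod_0) (use p q in \<open>auto simp: qpoch_inf_0 intro!: qpoch_inf_holomorphic\<close>)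

lemma dpoch_rec1: "dpoch p q z = qpoch_inf z q * dpoch p q (z * p)"
  unfolding dpoch_def
  by (rule qprod_rec) (use p q in \<open>auto simp: qpoch_inf_0 intro!: qpoch_inf_holomorphic\<close>)

lemma dpoch_convergent: "convergent_prod (\<lambda>j. qpoch_inf (z * p ^ j) q)"
  using qprod_convergent[of "\<lambda>w. qpoch_inf w q" p z] p q
  by (auto simp: qpoch_inf_0 intro!: qpoch_inf_holomorphic)

text \<open>The iterated definition is not visibly symmetric in p and q; this recursion in q comes
  from splitting the factor k = 0 off every inner product.\<close>

lemma dpoch_rec2: "dpoch p q z = qpoch_inf z p * dpoch p q (z * q)"
proof -
  have "dpoch p q z = (\<Prod>j. (1 - z * p ^ j) * qpoch_inf (z * q * p ^ j) q)"
    unfolding dpoch_def qprod_def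
    by (subst qpoch_inf_rec[OF q]) (simp add: mult_ac)
  also have "\<dots> = qpoch_inf z p * dpoch p q (z * q)"
    unfolding dpoch_def qprod_def qpoch_inf_def[of z p]
    by (rule prodinf_mult[symmetric]) (auto intro: qpoch_inf_convergent p dpoch_convergent)
  finally show ?thesis .
qed

lemma dpoch_eq_0_iff: "dpoch p q z = 0 \<longleftrightarrow> (\<exists>j k. z * p ^ j * q ^ k = 1)"
  unfolding dpoch_def
  by (subst qprod_eq_0_iff)
     (use p q in \<open>auto simp: qpoch_inf_0 qpoch_inf_eq_0_iff intro!: qpoch_inf_holomorphic\<close>)

lemma dpoch_nonzero:
  assumes "norm z < 1"
  shows "dpoch p q z \<noteq> 0"
proof
  assume "dpoch p q z = 0"
  then obtain j k where "z * p ^ j * q ^ k = 1" by (auto simp: dpoch_eq_0_iff)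
  hence "norm (z * p ^ j * q ^ k) = 1" by simp
  hence "norm z * (norm p ^ j * norm q ^ k) = 1" by (simp add: norm_mult norm_power mult_ac)
  moreover have "norm p ^ j * norm q ^ k \<le> 1"
    using p q by (intro mult_le_one power_le_one) auto
  hence "norm z * (norm p ^ j * norm q ^ k) \<le> norm z * 1"
    by (intro mult_left_mono) auto
  ultimately show False using assms by simp
qed

text \<open>The numerator factors are 1 - (p q / z) p^j q^k, so the numerator is the same double
  product at the reflected argument.\<close>

lemma ell_gamma_eq:
  assumes z: "z \<noteq> 0" and nz: "dpoch p q z \<noteq> 0"
  shows "ell_gamma z p q = dpoch p q (p * q / z) / dpoch p q z"
proof -
  have inner: "(\<Prod>k. (1 - inverse z * p ^ (j + 1) * q ^ (k + 1)) / (1 - z * p ^ j * q ^ k))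
      = qpoch_inf (p * q / z * p ^ j) q / qpoch_inf (z * p ^ j) q" for j
  proof -
    have "qpoch_inf (p * q / z * p ^ j) q / qpoch_inf (z * p ^ j) q =
      (\<Prod>k. (1 - (p * q / z * p ^ j) * q ^ k) / (1 - (z * p ^ j) * q ^ k))"
      unfolding qpoch_inf_def by (rule prodinf_divide) (rule qpoch_inf_convergent[OF q])+
    thus ?thesis using z by (simp add: field_simps)
  qed
  show ?thesis
    unfolding ell_gamma_def inner unfolding dpoch_def qprod_def
    by (rule prodinf_divide[symmetric]) (rule dpoch_convergent)+
qed

end

section \<open>Theta functions\<close>

text \<open>The multiplicative theta function of nome p; its zeros in the punctured plane are the
  integer powers of p, all simple.\<close>

definition th :: "complex \<Rightarrow> complex \<Rightarrow> complex" where
  "th p z = qpoch_inf z p * qpoch_inf (p / z) p"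

context
  fixes p :: complex
  assumes p: "norm p < 1" and p0: "p \<noteq> 0"
begin

lemma th_holomorphic: "0 \<notin> A \<Longrightarrow> th p holomorphic_on A"
  unfolding th_def
proof (intro holomorphic_intros qpoch_inf_holomorphic p)
  assume "0 \<notin> A"
  have "((\<lambda>z. qpoch_inf z p) \<circ> (\<lambda>z. p / z)) holomorphic_on A"
    by (rule holomorphic_on_compose_gen[of _ _ _ UNIV])
       (use \<open>0 \<notin> A\<close> in \<open>auto intro!: holomorphic_intros qpoch_inf_holomorphic p\<close>)
  thus "(\<lambda>z. qpoch_inf (p / z) p) holomorphic_on A" by (simp add: o_def)
qed

lemma th_shift:
  assumes "z \<noteq> 0"
  shows "th p (p * z) = - th p z / z"
proof -
  have "th p (p * z) = qpoch_inf (z * p) p * ((1 - 1 / z) * qpoch_inf (p / z) p)"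
    unfolding th_def using p0 assms qpoch_inf_rec[OF p, of "1 / z"] by (simp add: mult_ac)
  also have "\<dots> = - ((1 - z) * qpoch_inf (z * p) p * qpoch_inf (p / z) p) / z"
    using assms by (simp add: field_simps)
  also have "(1 - z) * qpoch_inf (z * p) p = qpoch_inf z p"
    by (rule qpoch_inf_rec[OF p, symmetric])
  finally show ?thesis by (simp add: th_def)
qed

lemma th_inverse:
  assumes "z \<noteq> 0"
  shows "th p (1 / z) = - th p z / z"
  using th_shift[OF assms] p0 assms by (simp add: th_def mult.commute)

lemma th_shift_powi:
  assumes z: "z \<noteq> 0"
  shows "th p (p powi k * z) = (- z) powi (- k) * p powi (- (k * (k - 1) div 2)) * th p z"
proof -
  define T where "T = (\<lambda>k::int. (- z) powi (- k) * p powi (- (k * (k - 1) div 2)))"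
  have T_Suc: "T (k + 1) = - T k / (p powi k * z)" for k
  proof -
    have "(k + 1) * (k + 1 - 1) div 2 = k * (k - 1) div 2 + k"
    proof -
      have "(k + 1) * (k + 1 - 1) = k * (k - 1) + k * 2" by (simp add: algebra_simps)
      thus ?thesis by simp
    qed
    hence e: "- ((k + 1) * (k + 1 - 1) div 2) = - (k * (k - 1) div 2) - k" by simp
    have "(- z) powi (- (k + 1)) = (- z) powi (- k) / (- z)"
      using power_int_diff[of "- z" "- k" 1] z by simp
    moreover have "p powi (- (k * (k - 1) div 2) - k) = p powi (- (k * (k - 1) div 2)) / p powi k"
      using power_int_diff[of p] p0 by simp
    ultimately show ?thesis unfolding T_def e by simp
  qed
  have step: "th p (p powi (k + 1) * z) = - th p (p powi k * z) / (p powi k * z)" for k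
    using th_shift[of "p powi k * z"] p0 z by (simp add: power_int_add mult_ac)
  have "th p (p powi k * z) = T k * th p z"
  proof (induction k rule: int_induct[where k = 0])
    case base
    show ?case by (simp add: T_def)
  next
    case (step1 i)
    thus ?case unfolding step T_Suc by simp
  next
    case (step2 i)
    have "th p (p powi i * z) = - th p (p powi (i - 1) * z) / (p powi (i - 1) * z)"
      using step[of "i - 1"] by simp
    moreover have "T i = - T (i - 1) / (p powi (i - 1) * z)"
      using T_Suc[of "i - 1"] by simp
    ultimately have "- th p (p powi (i - 1) * z) / (p powi (i - 1) * z)
       = - T (i - 1) / (p powi (i - 1) * z) * th p z" using step2 by metis
    moreover have "p powi (i - 1) * z \<noteq> 0" using p0 z by simp
    moreover have "- X / d = - Y / d * t \<Longrightarrow> d \<noteq> 0 \<Longrightarrow> X = Y * t" for X Y d t :: complex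
      by (simp add: field_simps)
    ultimately show ?case by blast
  qed
  thus ?thesis by (simp add: T_def)
qed

lemma th_eq_0_iff: "z \<noteq> 0 \<Longrightarrow> th p z = 0 \<longleftrightarrow> (\<exists>k. z = p powi k)"
proof safe
  assume z: "z \<noteq> 0" and "th p z = 0"
  then consider j where "z * p ^ j = 1" | j where "p / z * p ^ j = 1"
    unfolding th_def by (auto simp: qpoch_inf_eq_0_iff p)
  thus "\<exists>k. z = p powi k"
  proof cases
    case 1
    hence "z = p powi (- int j)"
      using p0 by (simp add: power_int_minus field_simps)
    thus ?thesis by blast
  next
    case 2
    hence "z = p ^ Suc j" using z by (simp add: field_simps)
    hence "z = p powi (int (Suc j))" by (simp only: power_int_of_nat)
    thus ?thesis by blast
  qed
next
  fix k assume "p powi k \<noteq> 0"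
  have "th p 1 = 0" by (simp add: th_def qpoch_inf_eq_0_iff p) (metis power_0)
  thus "th p (p powi k) = 0" using th_shift_powi[of 1 k] by simp
qed

text \<open>Quasi-periodicity moves the zero to 1. There the factor 1 - w splits off the product,
  and the cofactor \<open>G\<close> does not vanish.\<close>

lemma th_deriv_nonzero:
  assumes z: "z \<noteq> 0" and "th p z = 0"
  shows "deriv (th p) z \<noteq> 0"
proof -
  obtain k where k: "z = p powi k" using assms th_eq_0_iff by blast
  define c where "c = (\<lambda>w. (- w) powi (- k) * p powi (- (k * (k - 1) div 2)))"
  define g where "g = (\<lambda>w. qpoch_inf (p * w) p * qpoch_inf (p / w) p)"
  have g_holo: "g holomorphic_on - {0}"
  proof -
    have "((\<lambda>z. qpoch_inf z p) \<circ> (\<lambda>z. p / z)) holomorphic_on -{0}"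
         "((\<lambda>z. qpoch_inf z p) \<circ> (\<lambda>z. p * z)) holomorphic_on -{0}"
      by (rule holomorphic_on_compose_gen[of _ _ _ UNIV];
          auto intro!: holomorphic_intros qpoch_inf_holomorphic p)+
    thus ?thesis unfolding g_def o_def by (intro holomorphic_intros)
  qed
  define G where "G = (\<lambda>w. c w * g w)"
  have G: "G holomorphic_on - {0}"
    unfolding G_def c_def by (intro holomorphic_intros g_holo) auto
  have "th p (p powi k * w) = (1 - w) * G w" if "w \<noteq> 0" for w
    using th_shift_powi[OF that, of k] qpoch_inf_rec[OF p, of w]
    by (simp add: th_def G_def g_def c_def mult_ac)
  hence eq: "eventually (\<lambda>w. th p (p powi k * w) = (1 - w) * G w) (nhds 1)"
    using eventually_nhds_in_open[of "-{0}" "1::complex", OF open_Compl]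
    by (auto elim: eventually_mono)
  have "(G has_field_derivative deriv G 1) (at 1)"
    by (rule holomorphic_derivI[OF G]) auto
  hence "((\<lambda>w. (1 - w) * G w) has_field_derivative - G 1) (at 1)"
    by (auto intro!: derivative_eq_intros)
  hence d1: "((\<lambda>w. th p (p powi k * w)) has_field_derivative - G 1) (at 1)"
    using DERIV_cong_ev[OF refl eq refl] by simp
  have "(th p has_field_derivative deriv (th p) z) (at (p powi k * 1))"
    using holomorphic_derivI[OF th_holomorphic[of "-{0}"], of z] z k by auto
  hence "((\<lambda>w. th p (p powi k * w)) has_field_derivative deriv (th p) z * p powi k) (at 1)"
    by (rule DERIV_chain2) (auto intro!: derivative_eq_intros)
  with d1 have "deriv (th p) z * p powi k = - G 1" by (rule DERIV_unique[symmetric])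
  moreover have "G 1 \<noteq> 0"
    using p0 p by (simp add: G_def c_def g_def qpoch_inf_nonzero)
  ultimately show ?thesis by auto
qed

lemma th_1: "th p 1 = 0"
  by (simp add: th_def qpoch_inf_eq_0_iff p) (metis power_0)

end

section \<open>Quasi-periodic functions on the punctured plane\<close>

lemma annulus_representative:
  fixes P z :: complex
  assumes "P \<noteq> 0" "norm P < 1" "z \<noteq> 0"
  obtains k :: int where "norm P \<le> norm (P powi k * z)" "norm (P powi k * z) \<le> 1"
proof -
  define L where "L = ln (norm P)"
  define y where "y = ln (norm z)"
  have L: "L < 0" using assms by (simp add: L_def)
  \<comment> \<open>As L < 0, this is the least k with k L + y <= 0; that k - 1 is too small gives
    the other bound.\<close>
  define k where "k = \<lceil>- y / L\<rceil>"
  have "norm (P powi k * z) = exp (of_int k * L + y)"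
    using assms by (simp add: norm_mult norm_power_int L_def y_def exp_add flip: exp_power_int)
  moreover have "norm P = exp L" using assms by (simp add: L_def)
  moreover have "of_int k \<ge> - y / L" unfolding k_def by linarith
  hence "of_int k * L + y \<le> 0" using L by (simp add: field_simps)
  moreover have "of_int k - 1 \<le> - y / L" unfolding k_def by linarith
  hence "L \<le> of_int k * L + y" using L by (simp add: field_simps)
  ultimately show ?thesis by (intro that[of k]) auto
qed

text \<open>The quotient f / D is invariant under multiplication by P, and its singularities are
  removable because the zeros of D are simple and are zeros of f. So it is bounded by its maximum
  over a fundamental annulus; composed with exp it is a bounded entire function.\<close>

lemma quasiperiodic_quotient_const:
  fixes f D \<phi> :: "complex \<Rightarrow> complex" and P :: complex
  assumes P: "P \<noteq> 0" "norm P < 1"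
    and f: "f holomorphic_on -{0}" and D: "D holomorphic_on -{0}"
    and fP: "\<And>z. z \<noteq> 0 \<Longrightarrow> f (P * z) = \<phi> z * f z"
    and DP: "\<And>z. z \<noteq> 0 \<Longrightarrow> D (P * z) = \<phi> z * D z"
    and \<phi>: "\<And>z. z \<noteq> 0 \<Longrightarrow> \<phi> z \<noteq> 0"
    and zeros: "\<And>z. z \<noteq> 0 \<Longrightarrow> D z = 0 \<Longrightarrow> f z = 0 \<and> deriv D z \<noteq> 0"
  shows "\<exists>c. \<forall>z. z \<noteq> 0 \<longrightarrow> f z = c * D z"
proof -
  define q where "q = (\<lambda>z. f z / D z)"
  define g where "g = remove_sings q"
  have op: "open (-{0::complex})" by auto
  have fd: "(f has_field_derivative deriv f z) (at z)"
    and Dd: "(D has_field_derivative deriv D z) (at z)" if "z \<noteq> 0" for z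
    using holomorphic_derivI[OF f op] holomorphic_derivI[OF D op] that by auto
  have fan: "f analytic_on -{0}" "D analytic_on -{0}"
    using f D op by (simp_all add: analytic_on_open)
  have ev_nz: "eventually (\<lambda>w. D w \<noteq> 0 \<and> w \<noteq> 0) (at z)" if z: "z \<noteq> 0" for z
  proof -
    have "eventually (\<lambda>w. D w \<noteq> 0) (at z)"
    proof (cases "D z = 0")
      case True
      with zeros[OF z] have "deriv D z \<noteq> 0" by auto
      moreover have "((\<lambda>y. (D y - D z) / (y - z)) \<longlongrightarrow> deriv D z) (at z)"
        using Dd[OF z] by (simp add: has_field_derivative_iff)
      ultimately have "eventually (\<lambda>w. (D w - D z) / (w - z) \<noteq> 0) (at z)"
        by (metis tendsto_imp_eventually_ne)
      thus ?thesis by eventually_elim (use True in auto)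
    next
      case False
      have "(D \<longlongrightarrow> D z) (at z)"
        using DERIV_isCont[OF Dd[OF z]] by (simp add: isCont_def)
      thus ?thesis using False by (metis tendsto_imp_eventually_ne)
    qed
    moreover have "eventually (\<lambda>w. w \<noteq> 0) (at z)"
      using z tendsto_imp_eventually_ne[OF tendsto_ident_at] by blast
    ultimately show ?thesis by eventually_elim auto
  qed
  have q_an: "q analytic_on {z}" if "z \<noteq> 0" "D z \<noteq> 0" for z
    unfolding q_def using that by (intro analytic_intros analytic_on_subset[OF fan(1)] analytic_on_subset[OF fan(2)]) auto
  have q_lim: "\<exists>c. (q \<longlongrightarrow> c) (at z)" if z: "z \<noteq> 0" for z
  proof (cases "D z = 0")
    case True
    from lhopital_complex_simple[OF fd[OF z] Dd[OF z] _ True _ refl] zeros[OF z True]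
    show ?thesis unfolding q_def by blast
  next
    case False
    thus ?thesis using analytic_at_imp_isCont[OF q_an[OF z False]] by (auto simp: isCont_def)
  qed
  have q_isol: "isolated_singularity_at q z" if z: "z \<noteq> 0" for z
  proof -
    from ev_nz[OF z] obtain r where r: "r > 0" "\<And>w. w \<in> ball z r - {z} \<Longrightarrow> D w \<noteq> 0 \<and> w \<noteq> 0"
      unfolding eventually_at by (auto simp: dist_commute)
    have "q analytic_on ball z r - {z}"
      by (subst analytic_on_analytic_at) (use r q_an in blast)
    with r show ?thesis unfolding isolated_singularity_at_def by blast
  qed
  have g_an: "g analytic_on {z}" if z: "z \<noteq> 0" for z
    using q_lim[OF z] remove_sings_analytic_at[OF q_isol[OF z]] unfolding g_def by blast
  have g_holo: "g holomorphic_on -{0}"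
    by (rule analytic_imp_holomorphic, subst analytic_on_analytic_at) (use g_an in auto)
  have g_eq: "g z = f z / D z" if "z \<noteq> 0" "D z \<noteq> 0" for z
    unfolding g_def using remove_sings_at_analytic[OF q_an[OF that]] by (simp add: q_def)
  have per: "D (P powi k * z) \<noteq> 0 \<and> f (P powi k * z) / D (P powi k * z) = f z / D z"
    if z: "z \<noteq> 0" "D z \<noteq> 0" for z and k :: int
  proof (induction k rule: int_induct[where k = 0])
    case base
    show ?case using that by simp
  next
    case (step1 i)
    have nz: "P powi i * z \<noteq> 0" using P z by simp
    have e: "P powi (i + 1) * z = P * (P powi i * z)" using P by (simp add: power_int_add)
    show ?case unfolding e using step1 \<phi>[OF nz] fP[OF nz] DP[OF nz] by simp
  next
    case (step2 i)
    have nz: "P powi (i - 1) * z \<noteq> 0" using P z by simp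
    have e: "P powi i * z = P * (P powi (i - 1) * z)" using P by (simp add: power_int_diff)
    show ?case using step2(2) \<phi>[OF nz] fP[OF nz] DP[OF nz] unfolding e by auto
  qed
  define K :: "complex set" where "K = {z. norm P \<le> norm z \<and> norm z \<le> 1}"
  have "compact K"
  proof -
    have K: "K = cball 0 1 - ball 0 (norm P)" by (auto simp: K_def)
    show ?thesis unfolding K by (rule compact_diff) auto
  qed
  moreover have "continuous_on K g"
    using P by (intro continuous_on_subset[OF holomorphic_on_imp_continuous_on[OF g_holo]]) (auto simp: K_def)
  ultimately have "bounded (g ` K)" by (intro compact_imp_bounded compact_continuous_image)
  then obtain M where M: "\<And>z. z \<in> K \<Longrightarrow> norm (g z) \<le> M"
    unfolding bounded_iff by (metis imageI)
  have M1: "norm (g z) \<le> M" if z: "z \<noteq> 0" "D z \<noteq> 0" for z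
  proof -
    obtain k where k: "norm P \<le> norm (P powi k * z)" "norm (P powi k * z) \<le> 1"
      using annulus_representative[OF P z(1)] .
    have "g z = g (P powi k * z)"
      using per[OF z, of k] g_eq[OF z] g_eq[of "P powi k * z"] P z by auto
    with M[of "P powi k * z"] k show ?thesis by (simp add: K_def)
  qed
  have M2: "norm (g z) \<le> M" if z: "z \<noteq> 0" for z
  proof (rule tendsto_upperbound)
    show "((\<lambda>w. norm (g w)) \<longlongrightarrow> norm (g z)) (at z)"
      using analytic_at_imp_isCont[OF g_an[OF z]] by (intro tendsto_norm) (simp add: isCont_def)
    show "\<forall>\<^sub>F w in at z. norm (g w) \<le> M"
      using ev_nz[OF z] by eventually_elim (use M1 in auto)
  qed auto
  have "(g \<circ> exp) holomorphic_on UNIV"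
    by (rule holomorphic_on_compose_gen[OF _ g_holo]) (auto intro!: holomorphic_intros)
  moreover have "bounded (range (g \<circ> exp))"
    unfolding bounded_iff using M2 by (intro exI[of _ M]) auto
  ultimately have "(g \<circ> exp) constant_on UNIV" by (rule Liouville_theorem)
  then obtain c where c: "\<And>u. g (exp u) = c" by (auto simp: constant_on_def)
  have "f z = c * D z" if z: "z \<noteq> 0" for z
  proof (cases "D z = 0")
    case True
    thus ?thesis using zeros[OF z True] by simp
  next
    case False
    have "g z = c" using c[of "Ln z"] z by simp
    with g_eq[OF z False] False show ?thesis by (simp add: field_simps)
  qed
  thus ?thesis by blast
qed

text \<open>Differentiable with at most a simple zero. The property passes to products without
  common zeros, so the simplicity of the zeros of a product of theta functions can be checked factor
  by factor.\<close>

definition simple_at :: "(complex \<Rightarrow> complex) \<Rightarrow> complex \<Rightarrow> bool" where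
  "simple_at f z \<longleftrightarrow> (\<exists>d. (f has_field_derivative d) (at z) \<and> (f z = 0 \<longrightarrow> d \<noteq> 0))"

lemma simple_at_mult:
  assumes "simple_at f z" "simple_at g z" "f z \<noteq> 0 \<or> g z \<noteq> 0"
  shows "simple_at (\<lambda>w. f w * g w) z"
proof -
  obtain d e where "(f has_field_derivative d) (at z)" "f z = 0 \<longrightarrow> d \<noteq> 0"
    "(g has_field_derivative e) (at z)" "g z = 0 \<longrightarrow> e \<noteq> 0"
    using assms by (auto simp: simple_at_def)
  thus ?thesis unfolding simple_at_def
    by (intro exI[of _ "d * g z + e * f z"]) (use assms(3) in \<open>auto intro!: DERIV_mult\<close>)
qed

lemma simple_at_compose:
  assumes "simple_at f (g z)" "(g has_field_derivative e) (at z)" "e \<noteq> 0"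
  shows "simple_at (\<lambda>w. f (g w)) z"
proof -
  obtain d where "(f has_field_derivative d) (at (g z))" "f (g z) = 0 \<longrightarrow> d \<noteq> 0"
    using assms by (auto simp: simple_at_def)
  thus ?thesis unfolding simple_at_def using assms(2,3)
    by (intro exI[of _ "d * e"] conjI DERIV_chain2[of f]) auto
qed

context
  fixes P :: complex
  assumes p: "norm P < 1" and p0: "P \<noteq> 0"
begin

lemma th_has_deriv: "z \<noteq> 0 \<Longrightarrow> (th P has_field_derivative deriv (th P) z) (at z)"
  using holomorphic_derivI[OF th_holomorphic[OF p p0, of "-{0}"]] by auto

lemma simple_at_th: "z \<noteq> 0 \<Longrightarrow> simple_at (th P) z"
  unfolding simple_at_def using th_has_deriv th_deriv_nonzero[OF p p0] by blast

lemma tendsto_th: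
  assumes "(f \<longlongrightarrow> z) F" "z \<noteq> 0"
  shows "((\<lambda>x. th P (f x)) \<longlongrightarrow> th P z) F"
  using isCont_tendsto_compose[OF DERIV_isCont[OF th_has_deriv[OF assms(2)]] assms(1)] .

lemma eventually_th_nonzero:
  assumes "z \<noteq> 0"
  shows "eventually (\<lambda>w. th P w \<noteq> 0) (at z)"
proof (cases "th P z = 0")
  case True
  have "((\<lambda>y. (th P y - th P z) / (y - z)) \<longlongrightarrow> deriv (th P) z) (at z)"
    using th_has_deriv[OF assms] by (simp add: has_field_derivative_iff)
  hence "eventually (\<lambda>w. (th P w - th P z) / (w - z) \<noteq> 0) (at z)"
    using th_deriv_nonzero[OF p p0 assms True] by (metis tendsto_imp_eventually_ne)
  thus ?thesis by eventually_elim (use True in auto)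
next
  case False
  thus ?thesis using tendsto_imp_eventually_ne[OF tendsto_th[OF tendsto_ident_at assms]] by blast
qed

lemma th_holomorphic_compose:
  assumes "f holomorphic_on A" "\<And>z. z \<in> A \<Longrightarrow> f z \<noteq> 0"
  shows "(\<lambda>z. th P (f z)) holomorphic_on A"
proof -
  have "(th P \<circ> f) holomorphic_on A"
    by (rule holomorphic_on_compose_gen[of _ _ _ "-{0}"])
       (use assms in \<open>auto intro!: th_holomorphic p p0\<close>)
  thus ?thesis by (simp add: o_def)
qed

end

section \<open>An addition formula for theta functions\<close>

text \<open>Invariant under z -> 1/z, and multiplied under z -> P z by a factor that does not depend
  on v; this allows linear combinations with different v.\<close>

definition th_pair :: "complex \<Rightarrow> complex \<Rightarrow> complex \<Rightarrow> complex" where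
  "th_pair P v z = th P (v * z) * th P (v / z)"

text \<open>The antisymmetrization under z -> 1/z of a product of six theta functions. If the V have
  product 1, the powers of z give both terms the same multiplier 1 / (P^3 z^6) under z -> P
  z.\<close>

definition th_alt :: "complex \<Rightarrow> 'a set \<Rightarrow> ('a \<Rightarrow> complex) \<Rightarrow> complex \<Rightarrow> complex" where
  "th_alt P I V z = inverse (z ^ 3) * (\<Prod>a\<in>I. th P (V a * z)) - z ^ 3 * (\<Prod>a\<in>I. th P (V a / z))"

text \<open>The difference of the two sides of the addition formula. In $z$ it is a theta
  function of degree 6 that changes sign under $z \mapsto 1/z$, so it vanishes at the zeros of
  $\theta(z^2; P)$, and it also vanishes at $V_i^{\pm 1}$ and $V_j^{\pm 1}$: too many zeros for its
  degree.\<close>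

definition th_defect :: "complex \<Rightarrow> 'a set \<Rightarrow> 'a \<Rightarrow> 'a \<Rightarrow> ('a \<Rightarrow> complex) \<Rightarrow> complex \<Rightarrow> complex" where
  "th_defect P I i j V z = th P (V j / V i) * th_alt P I V z - th P (z ^ 2) / z *
     ((\<Prod>a\<in>I - {i, j}. th P (V i * V a)) / (V i) ^ 2 * th_pair P (V j) z
      - (\<Prod>a\<in>I - {i, j}. th P (V j * V a)) / (V i * V j) * th_pair P (V i) z)"

context
  fixes P :: complex and I :: "'a set" and i j :: 'a
  assumes p: "norm P < 1" and p0: "P \<noteq> 0"
    and I: "finite I" "card I = 6" and ij: "i \<in> I" "j \<in> I" "i \<noteq> j"
begin

lemma prod_split2:
  fixes g :: "'a \<Rightarrow> complex"
  shows "(\<Prod>a\<in>I. g a) = g i * g j * (\<Prod>a\<in>I - {i, j}. g a)"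
proof -
  have "(\<Prod>a\<in>I. g a) = g i * (\<Prod>a\<in>I - {i}. g a)" using I ij by (simp add: prod.remove)
  also have "(\<Prod>a\<in>I - {i}. g a) = g j * (\<Prod>a\<in>I - {i} - {j}. g a)"
    using I ij by (subst prod.remove[of _ j]) auto
  also have "I - {i} - {j} = I - {i, j}" by auto
  finally show ?thesis by (simp add: mult_ac)
qed

lemma th_pair_shift:
  assumes "v \<noteq> 0" "z \<noteq> 0"
  shows "th_pair P v (P * z) = th_pair P v z / (P * z ^ 2)"
proof -
  have 1: "th P (v * (P * z)) = - th P (v * z) / (v * z)"
    using th_shift[OF p p0, of "v * z"] assms by (simp add: mult_ac)
   have "th P (v / z) = - th P (v / (P * z)) / (v / (P * z))"
    using th_shift[OF p p0, of "v / (P * z)"] assms p0 by simp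
  hence 2: "th P (v / (P * z)) = - (v / (P * z)) * th P (v / z)"
    using assms p0 by (simp add: field_simps)
  show ?thesis unfolding th_pair_def 1 2 using assms p0
    by (simp add: field_simps power2_eq_square)
qed

lemma th_square_shift:
  assumes "z \<noteq> 0"
  shows "th P ((P * z) ^ 2) / (P * z) = (th P (z ^ 2) / z) / (P ^ 2 * z ^ 4)"
proof -
  have "th P ((P * z) ^ 2) = th P (P * (P * z ^ 2))" by (simp add: power2_eq_square mult_ac)
  also have "\<dots> = - (- th P (z ^ 2) / z ^ 2) / (P * z ^ 2)"
    using th_shift[OF p p0, of "P * z ^ 2"] th_shift[OF p p0, of "z ^ 2"] assms p0 by simp
  finally show ?thesis using assms p0 by (simp add: field_simps power2_eq_square power4_eq_xxxx)
qed

context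
  fixes V :: "'a \<Rightarrow> complex"
  assumes V: "\<And>a. a \<in> I \<Longrightarrow> V a \<noteq> 0" and V1: "(\<Prod>a\<in>I. V a) = 1"
begin

lemma th_alt_shift:
  assumes z: "z \<noteq> 0"
  shows "th_alt P I V (P * z) = th_alt P I V z / (P ^ 3 * z ^ 6)"
proof -
  have card: "(\<Prod>a\<in>I. - (V a * w)) = w ^ 6" for w
  proof -
    have "(\<Prod>a\<in>I. - (V a * w)) = (\<Prod>a\<in>I. V a * (- w))" by simp
    also have "\<dots> = (- w) ^ 6" using I V1 by (simp only: prod.distrib) simp
    finally show ?thesis by simp
  qed
  have "(\<Prod>a\<in>I. th P (V a * (P * z))) = (\<Prod>a\<in>I. th P (V a * z) / (- (V a * z)))"
  proof (rule prod.cong)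
    fix a assume "a \<in> I"
    thus "th P (V a * (P * z)) = th P (V a * z) / (- (V a * z))"
      using th_shift[OF p p0, of "V a * z"] V[of a] z by (simp add: mult_ac)
  qed auto
  also have "\<dots> = (\<Prod>a\<in>I. th P (V a * z)) / z ^ 6"
    by (simp only: prod_dividef card)
  finally have 1: "(\<Prod>a\<in>I. th P (V a * (P * z))) = (\<Prod>a\<in>I. th P (V a * z)) / z ^ 6" .
  have "(\<Prod>a\<in>I. th P (V a / (P * z))) = (\<Prod>a\<in>I. (- (V a * (1 / (P * z)))) * th P (V a / z))"
  proof (rule prod.cong)
    fix a assume a: "a \<in> I"
    have "th P (V a / z) = - th P (V a / (P * z)) / (V a / (P * z))"
      using th_shift[OF p p0, of "V a / (P * z)"] V[OF a] z p0 by simp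
    thus "th P (V a / (P * z)) = (- (V a * (1 / (P * z)))) * th P (V a / z)"
      using z p0 V[OF a] by (simp add: field_simps)
  qed auto
  also have "\<dots> = (\<Prod>a\<in>I. th P (V a / z)) / (P * z) ^ 6"
    by (simp only: prod.distrib card) (simp add: power_one_over)
  finally have 2: "(\<Prod>a\<in>I. th P (V a / (P * z))) = (\<Prod>a\<in>I. th P (V a / z)) / (P * z) ^ 6" .
  show ?thesis unfolding th_alt_def 1 2 using z p0
    by (simp add: field_simps)
qed

lemma th_defect_shift:
  assumes z: "z \<noteq> 0"
  shows "th_defect P I i j V (P * z) = inverse (P ^ 3 * z ^ 6) * th_defect P I i j V z"
proof -
  have *: "x / (P ^ 2 * z ^ 4) * (a * (b / (P * z ^ 2)) - c * (d / (P * z ^ 2)))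
     = inverse (P ^ 3 * z ^ 6) * (x * (a * b - c * d))" for x a b c d
    using z p0 by (simp add: field_simps) (simp add: algebra_simps flip: power_Suc power_add)
  show ?thesis
    unfolding th_defect_def th_alt_shift[OF z] th_square_shift[OF z]
      th_pair_shift[OF V[OF ij(1)] z] th_pair_shift[OF V[OF ij(2)] z] *
    by (simp add: algebra_simps divide_inverse)
qed

lemma th_defect_inverse:
  assumes z: "z \<noteq> 0"
  shows "th_defect P I i j V (1 / z) = - th_defect P I i j V z"
proof -
  have "th_alt P I V (1 / z) = - th_alt P I V z"
    by (simp add: th_alt_def field_simps)
  moreover have "th_pair P v (1 / z) = th_pair P v z" for v
    by (simp add: th_pair_def mult.commute)
  moreover have "th P ((1 / z) ^ 2) / (1 / z) = - (th P (z ^ 2) / z)"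
    using th_inverse[OF p p0, of "z ^ 2"] z by (simp add: power_one_over field_simps power2_eq_square)
  ultimately show ?thesis unfolding th_defect_def by (simp add: algebra_simps)
qed

lemma th_defect_shift_powi:
  assumes z: "z \<noteq> 0"
  shows "th_defect P I i j V (P powi k * z) = inverse (P powi (3 * k ^ 2) * z powi (6 * k)) * th_defect P I i j V z"
proof -
  define c where "c = (\<lambda>k. inverse (P powi (3 * k ^ 2) * z powi (6 * k)))"
  have c_step: "c (k + 1) = inverse (P ^ 3 * (P powi k * z) ^ 6) * c k" for k
  proof -
    have 1: "P powi (3 * (k + 1) ^ 2) = P powi (3 * k ^ 2) * (P powi k) ^ 6 * P ^ 3"
    proof -
      have "3 * (k + 1) ^ 2 = 3 * k ^ 2 + k * 6 + 3" by (simp add: power2_eq_square algebra_simps)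
      thus ?thesis using p0
        by (simp only: power_int_add power_int_mult) (simp add: power_int_add power_int_mult)
    qed
    have 2: "z powi (6 * (k + 1)) = z powi (6 * k) * z ^ 6"
      using z by (simp add: power_int_add distrib_left)
    show ?thesis unfolding c_def 1 2 by (simp add: power_mult_distrib mult_ac)
  qed
  have step: "th_defect P I i j V (P powi (k + 1) * z) =
      inverse (P ^ 3 * (P powi k * z) ^ 6) * th_defect P I i j V (P powi k * z)" for k
    using th_defect_shift[of "P powi k * z"] z p0 by (simp add: power_int_add mult_ac)
  have "th_defect P I i j V (P powi k * z) = c k * th_defect P I i j V z"
  proof (induction k rule: int_induct[where k = 0])
    case base
    show ?case by (simp add: c_def)
  next
    case (step1 k)
    thus ?case unfolding step c_step by simp
  next
    case (step2 k)
    have e1: "th_defect P I i j V (P powi k * z) =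
        inverse (P ^ 3 * (P powi (k - 1) * z) ^ 6) * th_defect P I i j V (P powi (k - 1) * z)"
      using step[of "k - 1"] by (simp only: diff_add_cancel)
    have e2: "c k = inverse (P ^ 3 * (P powi (k - 1) * z) ^ 6) * c (k - 1)"
      using c_step[of "k - 1"] by (simp only: diff_add_cancel)
    have "inverse (P ^ 3 * (P powi (k - 1) * z) ^ 6) * th_defect P I i j V (P powi (k - 1) * z)
       = inverse (P ^ 3 * (P powi (k - 1) * z) ^ 6) * (c (k - 1) * th_defect P I i j V z)"
      using step2(2) unfolding e1 unfolding e2 by (simp only: mult.assoc)
    moreover have "inverse (P ^ 3 * (P powi (k - 1) * z) ^ 6) \<noteq> 0" using p0 z by simp
    ultimately show ?case using mult_left_cancel by blast
  qed
  thus ?thesis by (simp add: c_def)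
qed

text \<open>At z = V j the second product of six and the pair of V j contain theta(1) = 0. The two
  remaining terms cancel because theta(V i / V j) and theta(V j / V i) differ by an elementary
  factor. The coefficients in \<open>th_defect\<close> are the ones that produce this cancellation
  here and at V i.\<close>

lemma th_defect_at_j: "th_defect P I i j V (V j) = 0"
proof -
  have "th_alt P I V (V j) = inverse (V j ^ 3) * (\<Prod>a\<in>I. th P (V a * V j))"
  proof -
    have "(\<Prod>a\<in>I. th P (V a / V j)) = 0"
      using I ij V[OF ij(2)] th_1[OF p p0] by (intro prod_zero) (auto intro!: bexI[of _ j])
    thus ?thesis by (simp add: th_alt_def)
  qed
  also have "(\<Prod>a\<in>I. th P (V a * V j)) =
      th P (V i * V j) * th P (V j ^ 2) * (\<Prod>a\<in>I - {i, j}. th P (V j * V a))"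
    by (subst prod_split2) (simp add: power2_eq_square mult.commute)
  finally have 1: "th_alt P I V (V j) = inverse (V j ^ 3) *
      (th P (V i * V j) * th P (V j ^ 2) * (\<Prod>a\<in>I - {i, j}. th P (V j * V a)))" .
  have 2: "th_pair P (V j) (V j) = 0"
    using V[OF ij(2)] th_1[OF p p0] by (simp add: th_pair_def)
  have 3: "th P (V i / V j) = - th P (V j / V i) * (V i / V j)"
    using th_inverse[OF p p0, of "V j / V i"] V[OF ij(2)] V[OF ij(1)] by simp
  show ?thesis
    unfolding th_defect_def 1 2 th_pair_def 3 using V[OF ij(2)] V[OF ij(1)]
    by (simp add: field_simps power2_eq_square power3_eq_cube th_1[OF p p0])
qed

lemma th_defect_at_i: "th_defect P I i j V (V i) = 0"
proof -
  have "th_alt P I V (V i) = inverse (V i ^ 3) * (\<Prod>a\<in>I. th P (V a * V i))"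
  proof -
    have "(\<Prod>a\<in>I. th P (V a / V i)) = 0"
      using I ij V[OF ij(1)] th_1[OF p p0] by (intro prod_zero) (auto intro!: bexI[of _ i])
    thus ?thesis by (simp add: th_alt_def)
  qed
  also have "(\<Prod>a\<in>I. th P (V a * V i)) =
      th P (V i ^ 2) * th P (V j * V i) * (\<Prod>a\<in>I - {i, j}. th P (V i * V a))"
    by (subst prod_split2) (simp add: power2_eq_square mult.commute)
  finally have 1: "th_alt P I V (V i) = inverse (V i ^ 3) *
      (th P (V i ^ 2) * th P (V j * V i) * (\<Prod>a\<in>I - {i, j}. th P (V i * V a)))" .
  have 2: "th_pair P (V i) (V i) = 0"
    using V[OF ij(1)] th_1[OF p p0] by (simp add: th_pair_def)
  show ?thesis
    unfolding th_defect_def 1 2 th_pair_def using V[OF ij(2)] V[OF ij(1)]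
    by (simp add: field_simps power2_eq_square power3_eq_cube th_1[OF p p0])
qed

lemma th_defect_holomorphic: "th_defect P I i j V holomorphic_on -{0}"
  unfolding th_defect_def th_alt_def th_pair_def
  by (intro holomorphic_intros th_holomorphic_compose p p0) (use V ij in auto)

text \<open>Under the genericity conditions \<open>D\<close> has simple zeros, at each of which the
  defect \<open>H\<close> vanishes, and the multipliers of \<open>D\<close> and \<open>H\<close>
  agree. Hence H = c D, and evaluation at V i, a zero of H but not of D, gives c = 0.\<close>

lemma th_defect_eq_0_generic:
  assumes g: "th P (V j ^ 2) \<noteq> 0" "th P (V i ^ 2) \<noteq> 0" "th P (V i * V j) \<noteq> 0" "th P (V j / V i) \<noteq> 0"
    and z: "z \<noteq> 0"
  shows "th_defect P I i j V z = 0"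
proof -
  define H where "H = th_defect P I i j V"
  define D where "D = (\<lambda>z. (th P (z ^ 2) * (1 / z)) * (th P (V j * z) * th P (V j / z)))"
  have Vi: "V i \<noteq> 0" and Vj: "V j \<noteq> 0" using V ij by auto
  have th0: "th P z = 0 \<longleftrightarrow> (\<exists>k. z = P powi k)" if "z \<noteq> 0" for z
    by (rule th_eq_0_iff[OF p p0 that])
  have V2: "V j ^ 2 \<noteq> P powi k" for k using g(1) th0[of "V j ^ 2"] Vj by auto
  have "\<exists>c. \<forall>z. z \<noteq> 0 \<longrightarrow> H z = c * D z"
  proof (rule quasiperiodic_quotient_const[OF p0 p])
    show "H holomorphic_on -{0}" unfolding H_def by (rule th_defect_holomorphic)
    show "D holomorphic_on -{0}" unfolding D_def
      by (intro holomorphic_intros th_holomorphic_compose p p0) (use Vj in auto)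
    fix z :: complex assume z: "z \<noteq> 0"
    show "H (P * z) = inverse (P ^ 3 * z ^ 6) * H z"
      unfolding H_def by (rule th_defect_shift[OF z])
    show "D (P * z) = inverse (P ^ 3 * z ^ 6) * D z"
    proof -
      have D_alt: "D w = th P (w ^ 2) / w * th_pair P (V j) w" for w
        by (simp add: D_def th_pair_def)
      have "x / (P ^ 2 * z ^ 4) * (y / (P * z ^ 2)) = inverse (P ^ 3 * z ^ 6) * (x * y)" for x y
        using z p0 by (simp add: field_simps power2_eq_square power3_eq_cube eval_nat_numeral)
      thus ?thesis unfolding D_alt th_square_shift[OF z] th_pair_shift[OF Vj z] .
    qed
    show "inverse (P ^ 3 * z ^ 6) \<noteq> 0" using z p0 by simp
    assume D0: "D z = 0"
    then consider "th P (z ^ 2) = 0" | "th P (V j * z) = 0" | "th P (V j / z) = 0"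
      using z by (auto simp: D_def)
    hence "H z = 0"
    proof cases
      case 1
      then obtain k where k: "z ^ 2 = P powi k" using th0[of "z ^ 2"] z by auto
      \<comment> \<open>The point 1/z is thus a translate of z by a power of P whose multiplier
        works out to 1. Together with the sign change under z -> 1/z this gives H z = - H z.\<close>
      have "1 / z = P powi (- k) * z"
      proof -
        have "P powi k * (P powi (- k) * z) = z" using p0 by (simp add: power_int_minus)
        moreover have "P powi k * (1 / z) = z" unfolding k[symmetric] using z
          by (simp add: power2_eq_square)
        ultimately show ?thesis using p0
          by (metis mult_left_cancel power_int_eq_0_iff)
      qed
      hence "H (1 / z) = inverse (P powi (3 * (- k) ^ 2) * z powi (6 * (- k))) * H z"
        unfolding H_def using th_defect_shift_powi[OF z, of "-k"] by simp
      also have "z powi (6 * (- k)) = (z ^ 2) powi (- 3 * k)"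
      proof -
        have "z powi (6 * (- k)) = z powi (2 * (- 3 * k))" by simp
        also have "\<dots> = (z powi 2) powi (- 3 * k)" by (rule power_int_mult)
        also have "z powi 2 = z ^ 2" by simp
        finally show ?thesis .
      qed
      also have "\<dots> = P powi (k * (- 3 * k))" unfolding k power_int_mult ..
      also have "P powi (3 * (- k) ^ 2) * P powi (k * (- 3 * k)) = 1"
        using p0 by (simp add: power2_eq_square flip: power_int_add)
      finally have "H z = - H z" using th_defect_inverse[OF z] by (simp add: H_def)
      thus ?thesis by (simp add: eq_neg_iff_add_eq_0)
    next
      case 2
      then obtain k where k: "V j * z = P powi k" using th0[of "V j * z"] z Vj by auto
      have "z = P powi k * (1 / V j)" using k Vj by (simp add: field_simps)
      thus ?thesis using th_defect_shift_powi[of "1 / V j" k] th_defect_inverse[OF Vj] th_defect_at_j Vj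
        by (simp add: H_def)
    next
      case 3
      then obtain k where k: "V j / z = P powi k" using th0[of "V j / z"] z Vj by auto
      have "z = P powi (- k) * V j" using k z p0 by (simp add: field_simps power_int_minus)
      thus ?thesis using th_defect_shift_powi[of "V j" "-k"] th_defect_at_j Vj
        by (simp add: H_def)
    qed
    moreover have "simple_at D z"
      unfolding D_def
    proof (intro simple_at_mult)
      show "simple_at (\<lambda>z. th P (z ^ 2)) z"
        by (rule simple_at_compose[of _ _ _ "2 * z"])
           (use z in \<open>auto intro!: simple_at_th p p0 derivative_eq_intros\<close>)
      show "simple_at (\<lambda>w. 1 / w) z" unfolding simple_at_def using z
        by (intro exI[of _ "- (1 / z ^ 2)"]) (auto intro!: derivative_eq_intros simp: power2_eq_square)
      show "simple_at (\<lambda>w. th P (V j * w)) z"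
        by (rule simple_at_compose[of _ _ _ "V j"])
           (use z Vj in \<open>auto intro!: simple_at_th p p0 derivative_eq_intros\<close>)
      show "simple_at (\<lambda>w. th P (V j / w)) z"
        by (rule simple_at_compose[of _ _ _ "- V j / z ^ 2"])
           (use z Vj in \<open>auto intro!: simple_at_th p p0 derivative_eq_intros simp: power2_eq_square\<close>)
      show "th P (z ^ 2) \<noteq> 0 \<or> 1 / z \<noteq> 0" using z by auto
      show "th P (V j * z) \<noteq> 0 \<or> th P (V j / z) \<noteq> 0"
      proof (rule ccontr)
        assume "\<not> ?thesis"
        then obtain k l where "V j * z = P powi k" "V j / z = P powi l"
          using th0[of "V j * z"] th0[of "V j / z"] z Vj by auto
        hence "(V j * z) * (V j / z) = P powi (k + l)" using p0 by (simp add: power_int_add)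
        thus False using V2[of "k + l"] z by (simp add: power2_eq_square)
      qed
      show "th P (z ^ 2) * (1 / z) \<noteq> 0 \<or> th P (V j * z) * th P (V j / z) \<noteq> 0"
      proof (rule ccontr)
        assume *: "\<not> ?thesis"
        then obtain k where k: "z ^ 2 = P powi k" using th0[of "z ^ 2"] z by auto
        from * consider "th P (V j * z) = 0" | "th P (V j / z) = 0" by auto
        thus False
        proof cases
          case 1
          then obtain l where l: "V j * z = P powi l" using th0[of "V j * z"] z Vj by auto
          have "V j ^ 2 = (V j * z) ^ 2 / z ^ 2" using z by (simp add: field_simps)
          also have "\<dots> = P powi (l + l - k)" unfolding l k unfolding power2_eq_square l using p0
              power_int_diff[of P "l + l" k] power_int_add[of P l l] by metis
          finally show False using V2 by blast
        next
          case 2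
          then obtain l where l: "V j / z = P powi l" using th0[of "V j / z"] z Vj by auto
          have "V j ^ 2 = (V j / z) ^ 2 * z ^ 2" using z by (simp add: field_simps)
          also have "\<dots> = P powi (l + l + k)" unfolding l k unfolding power2_eq_square l using p0
              power_int_add[of P "l + l" k] power_int_add[of P l l] by metis
          finally show False using V2 by blast
        qed
      qed
    qed
    ultimately show "H z = 0 \<and> deriv D z \<noteq> 0"
      using D0 by (auto simp: simple_at_def DERIV_imp_deriv)
  qed
  then obtain c where c: "\<And>z. z \<noteq> 0 \<Longrightarrow> H z = c * D z" by blast
  have "D (V i) \<noteq> 0" using g Vi by (simp add: D_def mult.commute)
  moreover have "H (V i) = 0" unfolding H_def by (rule th_defect_at_i)
  ultimately have "c = 0" using c[OF Vi] by simp
  thus ?thesis using c[OF z] by (simp add: H_def)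
qed

end

text \<open>The exceptional V are limits of generic ones with the same product, and the defect is
  continuous in V.\<close>

theorem th_defect_eq_0:
  assumes V: "\<And>a. a \<in> I \<Longrightarrow> V a \<noteq> 0" and V1: "(\<Prod>a\<in>I. V a) = 1" and z: "z \<noteq> 0"
  shows "th_defect P I i j V z = 0"
proof -
  have "card (I - {i, j}) = 4" using I ij by (simp add: card_Diff_subset)
  hence "I - {i, j} \<noteq> {}" by (metis card.empty zero_neq_numeral)
  then obtain b where b: "b \<in> I" "b \<noteq> i" "b \<noteq> j" by blast
  \<comment> \<open>The exponents 1, 2, -3 sum to 0, so the product is kept. They multiply V j^2, V
    i^2, V i V j and V j / V i by s^4, s^2, s^3 and s, so that each of these leaves the zeros of
    theta as soon as s > 1 is close to 1.\<close>
  define W where "W = (\<lambda>s::real. V(i := V i * of_real s, j := V j * of_real s ^ 2, b := V b * inverse (of_real s ^ 3)))"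
  have Vi: "V i \<noteq> 0" and Vj: "V j \<noteq> 0" using V ij by auto
  have W_lim: "((\<lambda>s. W s a) \<longlongrightarrow> V a) (at_right 1)" for a
  proof -
    have "((\<lambda>s. V i * of_real s) \<longlongrightarrow> V i * of_real 1) (at_right 1)"
      "((\<lambda>s. V j * of_real s ^ 2) \<longlongrightarrow> V j * of_real 1 ^ 2) (at_right 1)"
      "((\<lambda>s. V b * inverse (of_real s ^ 3)) \<longlongrightarrow> V b * inverse (of_real 1 ^ 3)) (at_right 1)"
      by (intro tendsto_intros; simp)+
    thus ?thesis by (cases "a = b"; cases "a = j"; cases "a = i") (simp_all add: W_def)
  qed
  have nz: "eventually (\<lambda>s. th P (x * of_real s ^ n) \<noteq> 0) (at_right (1::real))"
    if "x \<noteq> 0" "n > 0" for x and n :: nat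
  proof -
    have "filterlim (\<lambda>s. x * of_real s ^ n) (at x) (at_right (1::real))"
      unfolding filterlim_at
    proof
      have "((\<lambda>s. x * of_real s ^ n) \<longlongrightarrow> x * of_real 1 ^ n) (at_right (1::real))"
        by (intro tendsto_intros)
      thus "((\<lambda>s. x * of_real s ^ n) \<longlongrightarrow> x) (at_right (1::real))" by simp
      have "eventually (\<lambda>s. s > 1) (at_right (1::real))" by (simp add: eventually_at_right_less)
      thus "\<forall>\<^sub>F s in at_right (1::real). x * of_real s ^ n \<in> UNIV \<and> x * of_real s ^ n \<noteq> x"
      proof eventually_elim
        case (elim s)
        have "s ^ n > 1" using elim that by (simp add: one_less_power)
        hence "complex_of_real s ^ n \<noteq> 1"
          by (metis less_irrefl of_real_1 of_real_eq_iff of_real_power)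
        thus ?case using that by simp
      qed
    qed
    from eventually_compose_filterlim[OF eventually_th_nonzero[OF p p0 that(1)] this]
    show ?thesis .
  qed
  have "eventually (\<lambda>s. s > 1) (at_right (1::real))" by (simp add: eventually_at_right_less)
  with nz[of "V j ^ 2" 4] nz[of "V i ^ 2" 2] nz[of "V i * V j" 3] nz[of "V j / V i" 1] Vi Vj
  have "eventually (\<lambda>s. s > 1 \<and> th P (V j ^ 2 * of_real s ^ 4) \<noteq> 0 \<and> th P (V i ^ 2 * of_real s ^ 2) \<noteq> 0
     \<and> th P (V i * V j * of_real s ^ 3) \<noteq> 0 \<and> th P (V j / V i * of_real s ^ 1) \<noteq> 0) (at_right (1::real))"
    by (intro eventually_conj) auto
  hence "eventually (\<lambda>s. th_defect P I i j (W s) z = 0) (at_right 1)"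
  proof eventually_elim
    case (elim s)
    hence s: "s > 1" "complex_of_real s \<noteq> 0" by auto
    have Wi: "W s i = V i * of_real s" and Wj: "W s j = V j * of_real s ^ 2"
      and Wb: "W s b = V b * inverse (of_real s ^ 3)"
      using b ij by (auto simp: W_def)
    show ?case
    proof (rule th_defect_eq_0_generic[OF _ _ _ _ _ _ z])
      show "W s a \<noteq> 0" if "a \<in> I" for a using that V s b by (auto simp: W_def)
      have "(\<Prod>a\<in>I. W s a) = W s i * W s j * (W s b * (\<Prod>a\<in>I - {i, j} - {b}. W s a))"
        using b I by (subst prod_split2) (simp add: prod.remove[of _ b])
      also have "(\<Prod>a\<in>I - {i, j} - {b}. W s a) = (\<Prod>a\<in>I - {i, j} - {b}. V a)"
        by (intro prod.cong) (auto simp: W_def)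
      also have "W s i * W s j * (W s b * (\<Prod>a\<in>I - {i, j} - {b}. V a))
         = V i * V j * (V b * (\<Prod>a\<in>I - {i, j} - {b}. V a))"
        unfolding Wi Wj Wb using s by (simp add: field_simps power2_eq_square power3_eq_cube)
      also have "\<dots> = (\<Prod>a\<in>I. V a)"
        using b I by (subst prod_split2) (simp add: prod.remove[of _ b])
      finally show "(\<Prod>a\<in>I. W s a) = 1" using V1 by simp
      show "th P (W s j ^ 2) \<noteq> 0" "th P (W s i ^ 2) \<noteq> 0" "th P (W s i * W s j) \<noteq> 0" "th P (W s j / W s i) \<noteq> 0"
        unfolding Wi Wj using elim s
        by (simp_all add: power_mult_distrib mult_ac power2_eq_square power3_eq_cube power4_eq_xxxx)
    qed
  qed
  hence 0: "((\<lambda>s. th_defect P I i j (W s) z) \<longlongrightarrow> 0) (at_right 1)"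
    by (rule tendsto_eventually)
  have "((\<lambda>s. th_defect P I i j (W s) z) \<longlongrightarrow> th_defect P I i j V z) (at_right 1)"
    unfolding th_defect_def th_alt_def th_pair_def
    by (intro tendsto_intros tendsto_th[OF p p0] W_lim) (use V ij z in auto)
  thus ?thesis using 0 by (intro tendsto_unique[OF _ _ 0]) (auto simp: trivial_limit_at_right_real)
qed

end

section \<open>The rarefied elliptic gamma function\<close>

lemma eventually_at_scale:
  fixes c z :: complex
  assumes "c \<noteq> 0" "eventually Q (at (c * z))"
  shows "eventually (\<lambda>w. Q (c * w)) (at z)"
proof -
  have "filterlim (\<lambda>w. c * w) (at (c * z)) (at z)"
    unfolding filterlim_at using assms(1)
    by (auto intro!: tendsto_intros simp: eventually_at_filter)
  from eventually_compose_filterlim[OF assms(2) this] show ?thesis .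
qed

lemma eventually_at_reciprocal:
  fixes c z :: complex
  assumes "c \<noteq> 0" "z \<noteq> 0" "eventually Q (at (c / z))"
  shows "eventually (\<lambda>w. Q (c / w)) (at z)"
proof -
  have "eventually (\<lambda>w. w \<noteq> 0) (at z)"
    using assms(2) tendsto_imp_eventually_ne[OF tendsto_ident_at] by blast
  moreover have "eventually (\<lambda>w. w \<noteq> z) (at z)" by (simp add: eventually_at_filter)
  ultimately have "eventually (\<lambda>w. c / w \<noteq> c / z) (at z)"
    by eventually_elim (use assms in \<open>auto simp: field_simps\<close>)
  hence "filterlim (\<lambda>w. c / w) (at (c / z)) (at z)"
    unfolding filterlim_at using assms by (auto intro!: tendsto_intros)
  from eventually_compose_filterlim[OF assms(3) this] show ?thesis .
qed

lemma eventually_at_eq_imp_eq: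
  fixes f g :: "complex \<Rightarrow> complex"
  assumes "isCont f z" "isCont g z" "eventually (\<lambda>w. f w = g w) (at z)"
  shows "f z = g z"
proof -
  have "(g \<longlongrightarrow> f z) (at z)"
    using assms(1,3) by (metis (mono_tags, lifting) isCont_def tendsto_cong)
  thus ?thesis using assms(2) by (metis LIM_unique isCont_def)
qed

text \<open>If f has no limit at z, then neither has g f, as one can divide by g; both sides are
  then 0, the default value of \<open>remove_sings\<close>. The rule therefore holds at poles
  too.\<close>

lemma remove_sings_mult_nonzero:
  assumes "isCont g z" "g z \<noteq> 0"
  shows "remove_sings (\<lambda>w. g w * f w) z = g z * remove_sings f z"
proof (cases "\<exists>c. f \<midarrow>z\<rightarrow> c")
  case True
  then obtain c where c: "f \<midarrow>z\<rightarrow> c" by blast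
  hence "(\<lambda>w. g w * f w) \<midarrow>z\<rightarrow> g z * c"
    using assms(1) by (intro tendsto_mult) (auto simp: isCont_def)
  thus ?thesis using remove_sings_eqI[OF c] remove_sings_eqI by metis
next
  case False
  have "\<not> (\<exists>c. (\<lambda>w. g w * f w) \<midarrow>z\<rightarrow> c)"
  proof
    assume "\<exists>c. (\<lambda>w. g w * f w) \<midarrow>z\<rightarrow> c"
    then obtain c where "(\<lambda>w. g w * f w) \<midarrow>z\<rightarrow> c" by blast
    hence "(\<lambda>w. (g w * f w) / g w) \<midarrow>z\<rightarrow> c / g z"
      using assms by (intro tendsto_divide) (auto simp: isCont_def)
    moreover have "eventually (\<lambda>w. g w \<noteq> 0) (at z)"
      using assms by (metis isCont_def tendsto_imp_eventually_ne)
    hence "eventually (\<lambda>w. (g w * f w) / g w = f w) (at z)" by eventually_elim auto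
    ultimately have "f \<midarrow>z\<rightarrow> c / g z" using tendsto_cong by fast
    with False show False by blast
  qed
  with False show ?thesis by (simp add: remove_sings_def)
qed

lemma of_int_div_dvd:
  assumes "d dvd k" "d \<noteq> (0::int)"
  shows "(of_int (k div d) :: complex) = of_int k / of_int d"
  using assms by (auto elim!: dvdE)

lemma of_int_binomial2: "(of_int (m * (m - 1) div 2) :: complex) = of_int m * (of_int m - 1) / 2"
  by (subst of_int_div_dvd) auto

lemma six_dvd_int: "(6 :: int) dvd m * (m - 1) * (m - 2)"
proof -
  have "2 dvd m * (m - 1)" by simp
  hence "2 dvd m * (m - 1) * (m - 2)" by (rule dvd_mult2)
  moreover have "3 dvd m * (m - 1) * (m - 2)"
  proof -
    have "3 dvd m \<or> 3 dvd (m - 1) \<or> 3 dvd (m - 2)" by presburger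
    thus ?thesis by (metis dvd_mult dvd_mult2)
  qed
  moreover have "6 dvd x" if "2 dvd x" "3 dvd x" for x :: int using that by presburger
  ultimately show ?thesis by blast
qed

lemma of_int_binomial3:
  "(of_int (m * (m - 1) * (m - 2) div 6) :: complex) = of_int m * (of_int m - 1) * (of_int m - 2) / 6"
  by (subst of_int_div_dvd) (auto simp: six_dvd_int)

lemma of_int_binomial3':
  "(of_int (m * (m ^ 2 - 1) div 6) :: complex) = of_int m * (of_int m ^ 2 - 1) / 6"
proof -
  have "m * (m ^ 2 - 1) = (m + 1) * (m + 1 - 1) * (m + 1 - 2)"
    by (simp add: power2_eq_square algebra_simps)
  hence "6 dvd m * (m ^ 2 - 1)" using six_dvd_int[of "m + 1"] by metis
  thus ?thesis by (subst of_int_div_dvd) auto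
qed

text \<open>The joint denominator of the two elliptic gamma functions. As p^r = p^m p^(r - m), and
  likewise for q, their joint numerator is the same function at p q / z and r - m, which is how
  \<open>rg_quot\<close> expresses it.\<close>

definition rg_den :: "nat \<Rightarrow> complex \<Rightarrow> complex \<Rightarrow> complex \<Rightarrow> int \<Rightarrow> complex" where
  "rg_den r p q z m = dpoch (p ^ r) (p * q) (z * p powi m) * dpoch (q ^ r) (p * q) (z * q powi (int r - m))"

definition rg_pref :: "complex \<Rightarrow> complex \<Rightarrow> complex \<Rightarrow> int \<Rightarrow> complex" where
  "rg_pref p q z m = (- z) powi (m * (m - 1) div 2) * p powi (m * (m - 1) * (m - 2) div 6)
     * q powi (- (m * (m ^ 2 - 1) div 6))"

definition rg_quot :: "nat \<Rightarrow> complex \<Rightarrow> complex \<Rightarrow> complex \<Rightarrow> int \<Rightarrow> complex" where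
  "rg_quot r p q z m = rg_den r p q (p * q / z) (int r - m) / rg_den r p q z m"

text \<open>The multiplier of \<open>rgamma\<close> under (z, m) -> (q z, m + 1). The nome is p^r;
  the shift by p has the analogous multiplier with nome q^r.\<close>

definition rtheta :: "nat \<Rightarrow> complex \<Rightarrow> complex \<Rightarrow> int \<Rightarrow> complex" where
  "rtheta r p z m = (- z) powi m * p powi (m * (m - 1) div 2) * th (p ^ r) (z * p powi m)"

text \<open>Writing $z = -e^u$ turns the prefactor, and the factors picked up under
  $m \mapsto m + r$, into exponentials of polynomials.\<close>

lemma rg_pref_exp:
  "rg_pref (exp a) (exp b) (- exp u) m = exp (u * (of_int m * (of_int m - 1) / 2)
     + a * (of_int m * (of_int m - 1) * (of_int m - 2) / 6) - b * (of_int m * (of_int m ^ 2 - 1) / 6))"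
  unfolding rg_pref_def
  by (simp only: minus_minus exp_power_int of_int_minus of_int_binomial2 of_int_binomial3 of_int_binomial3' flip: exp_add)
     (rule arg_cong[where f = exp], simp add: algebra_simps)

section \<open>Functional equations and poles of the rarefied gamma function\<close>

locale rarefied =
  fixes r :: nat and p q :: complex
  assumes r: "r > 0" and p0: "p \<noteq> 0" and q0: "q \<noteq> 0" and p1: "norm p < 1" and q1: "norm q < 1"
begin

lemma swap: "rarefied r q p"
  using r p0 q0 p1 q1 by unfold_locales

lemma P1: "norm (p ^ r) < 1" and S1: "norm (q ^ r) < 1" and Q1: "norm (p * q) < 1"
  and P0: "p ^ r \<noteq> 0" and S0: "q ^ r \<noteq> 0" and Q0: "p * q \<noteq> 0"
proof -
  show "norm (p ^ r) < 1" "norm (q ^ r) < 1"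
    using r p1 q1 by (simp_all add: norm_power power_less_one_iff)
  have "norm p * norm q < 1 * 1" using p1 q1 by (intro mult_strict_mono') auto
  thus "norm (p * q) < 1" by (simp add: norm_mult)
qed (use p0 q0 in auto)

lemma rg_den_holomorphic: "(\<lambda>z. rg_den r p q z m) holomorphic_on A"
proof -
  have "(dpoch (p ^ r) (p * q) \<circ> (\<lambda>z. z * c)) holomorphic_on A"
       "(dpoch (q ^ r) (p * q) \<circ> (\<lambda>z. z * c)) holomorphic_on A" for c
    by (rule holomorphic_on_compose_gen[of _ _ _ UNIV];
        auto intro!: holomorphic_intros dpoch_holomorphic P1 S1 Q1)+
  thus ?thesis unfolding rg_den_def o_def by (intro holomorphic_intros)
qed

lemma rg_den_0: "rg_den r p q 0 m = 1"
  using P1 S1 Q1 by (simp add: rg_den_def dpoch_0)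

text \<open>An entire function with value 1 at the origin has isolated zeros.\<close>

lemma eventually_rg_den_nonzero: "eventually (\<lambda>w. rg_den r p q w m \<noteq> 0) (at z)"
  using non_zero_neighbour_alt[OF rg_den_holomorphic[of m UNIV], of z 0] rg_den_0
  by (auto elim: eventually_mono)

lemma eventually_rg_num_nonzero:
  "z \<noteq> 0 \<Longrightarrow> eventually (\<lambda>w. rg_den r p q (p * q / w) m \<noteq> 0) (at z)"
  by (rule eventually_at_reciprocal) (use Q0 in \<open>auto intro: eventually_rg_den_nonzero\<close>)

lemma rgamma_expr_eq:
  assumes z: "z \<noteq> 0" and nz: "rg_den r p q z m \<noteq> 0"
  shows "rgamma_expr r p q z m = rg_pref p q z m * rg_quot r p q z m"
proof -
  have "p ^ r = p powi m * p powi (int r - m)" "q ^ r = q powi m * q powi (int r - m)"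
    using p0 q0 by (simp_all flip: power_int_add)
  hence 1: "p ^ r * (p * q) / (z * p powi m) = (p * q / z) * p powi (int r - m)"
    and 2: "q ^ r * (p * q) / (z * q powi (int r - m)) = (p * q / z) * q powi (int r - (int r - m))"
    using p0 q0 z by (simp_all add: field_simps)
  have "ell_gamma (z * p powi m) (p ^ r) (p * q) =
     dpoch (p ^ r) (p * q) (p ^ r * (p * q) / (z * p powi m)) / dpoch (p ^ r) (p * q) (z * p powi m)"
    using nz z p0 by (intro ell_gamma_eq P1 Q1) (auto simp: rg_den_def)
  moreover have "ell_gamma (z * q powi (int r - m)) (q ^ r) (p * q) =
     dpoch (q ^ r) (p * q) (q ^ r * (p * q) / (z * q powi (int r - m))) / dpoch (q ^ r) (p * q) (z * q powi (int r - m))"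
    using nz z q0 by (intro ell_gamma_eq S1 Q1) (auto simp: rg_den_def)
  ultimately show ?thesis unfolding rgamma_expr_def rg_pref_def rg_quot_def 1 2
    by (simp add: rg_den_def)
qed

lemma eventually_nz_at: "z \<noteq> 0 \<Longrightarrow> eventually (\<lambda>w. w \<noteq> 0) (at (z::complex))"
  using tendsto_imp_eventually_ne[OF tendsto_ident_at] by blast

lemma eventually_rgamma_expr_eq:
  assumes "z \<noteq> 0"
  shows "eventually (\<lambda>w. rgamma_expr r p q w m = rg_pref p q w m * rg_quot r p q w m) (at z)"
  using eventually_rg_den_nonzero[of m z] eventually_nz_at[OF assms]
  by eventually_elim (rule rgamma_expr_eq)

lemma rg_pref_quot_analytic:
  assumes z: "z \<noteq> 0" and nz: "rg_den r p q z m \<noteq> 0"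
  shows "(\<lambda>w. rg_pref p q w m * rg_quot r p q w m) analytic_on {z}"
proof -
  have 1: "(\<lambda>z. rg_den r p q z m) analytic_on A" for m A
    by (rule analytic_on_subset[of _ UNIV]) (auto simp: analytic_on_open intro!: rg_den_holomorphic)
  have "((\<lambda>z. rg_den r p q z (int r - m)) \<circ> (\<lambda>w. p * q / w)) analytic_on {z}"
    by (rule analytic_on_compose_gen[of _ _ _ UNIV]) (use z in \<open>auto intro!: 1 analytic_intros\<close>)
  thus ?thesis unfolding rg_pref_def rg_quot_def o_def
    by (intro analytic_intros 1) (use z nz in auto)
qed

lemma rgamma_altdef:
  assumes "z \<noteq> 0"
  shows "rgamma r p q z m = remove_sings (\<lambda>w. rg_pref p q w m * rg_quot r p q w m) z"
  unfolding rgamma_def by (rule remove_sings_cong[OF eventually_rgamma_expr_eq[OF assms] refl])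

lemma rgamma_eq:
  assumes "z \<noteq> 0" "rg_den r p q z m \<noteq> 0"
  shows "rgamma r p q z m = rg_pref p q z m * rg_quot r p q z m"
  unfolding rgamma_altdef[OF assms(1)]
  by (rule remove_sings_at_analytic[OF rg_pref_quot_analytic[OF assms]])

lemma eventually_rgamma_eq:
  assumes "z \<noteq> 0"
  shows "eventually (\<lambda>w. rgamma r p q w m = rg_pref p q w m * rg_quot r p q w m) (at z)"
  using eventually_rg_den_nonzero[of m z] eventually_nz_at[OF assms]
  by eventually_elim (rule rgamma_eq)

lemma rgamma_analytic_at:
  assumes z: "z \<noteq> 0" and nz: "rg_den r p q z m \<noteq> 0"
  shows "(\<lambda>w. rgamma r p q w m) analytic_on {z}"
proof -
  have "eventually (\<lambda>w. rgamma r p q w m = rg_pref p q w m * rg_quot r p q w m) (nhds z)"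
    using eventually_rgamma_eq[OF z, of m] rgamma_eq[OF z nz]
    by (auto simp: eventually_nhds_conv_at)
  from analytic_at_cong[OF this refl] show ?thesis
    using rg_pref_quot_analytic[OF z nz] by blast
qed

text \<open>Under m -> m + r the argument of one double product is multiplied by its nome p^r and
  that of the other divided by its nome q^r; each step changes a double product by a q-Pochhammer
  symbol of base p q.\<close>

lemma rg_den_shift_r:
  "rg_den r p q z m * qpoch_inf (z * q powi (- m)) (p * q) =
   qpoch_inf (z * p powi m) (p * q) * rg_den r p q z (m + int r)"
proof -
  have "dpoch (p ^ r) (p * q) (z * p powi m) =
     qpoch_inf (z * p powi m) (p * q) * dpoch (p ^ r) (p * q) (z * p powi (m + int r))"
    using dpoch_rec1[OF P1 Q1, of "z * p powi m"] p0 by (simp add: power_int_add mult_ac)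
  moreover have "dpoch (q ^ r) (p * q) (z * q powi (- m)) =
     qpoch_inf (z * q powi (- m)) (p * q) * dpoch (q ^ r) (p * q) (z * q powi (int r - m))"
    using dpoch_rec1[OF S1 Q1, of "z * q powi (- m)"] q0
    by (simp add: power_int_diff power_int_minus field_simps)
  ultimately show ?thesis by (simp add: rg_den_def)
qed

text \<open>Together with the numerators, the q-Pochhammer symbols form theta functions of nome p q
  at z p^m and at z q^(-m). These arguments differ by the factor (p q)^m, so the quotient of the
  theta functions is elementary.\<close>

lemma rg_quot_shift_r:
  assumes z: "z \<noteq> 0" and nz: "rg_den r p q z m \<noteq> 0" "rg_den r p q z (m + int r) \<noteq> 0"
    "rg_den r p q (p * q / z) (- m) \<noteq> 0" "rg_den r p q (p * q / z) (int r - m) \<noteq> 0"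
    and t: "th (p * q) (z * q powi (- m)) \<noteq> 0"
  shows "rg_quot r p q z (m + int r) = (- z * q powi (- m)) powi (- m)
     * (p * q) powi (- (m * (m - 1) div 2)) * rg_quot r p q z m"
proof -
  define y where "y = z * q powi (- m)"
  have y: "y \<noteq> 0" using z q0 by (simp add: y_def)
  have zp: "z * p powi m = (p * q) powi m * y"
    using q0 by (simp add: y_def power_int_mult_distrib power_int_minus field_simps)
  have d1: "rg_den r p q z m * qpoch_inf y (p * q) = qpoch_inf (z * p powi m) (p * q) * rg_den r p q z (m + int r)"
    using rg_den_shift_r[of z m] by (simp add: y_def)
  have d2: "rg_den r p q (p * q / z) (- m) * qpoch_inf (p * q / y) (p * q) =
     qpoch_inf (p * q / (z * p powi m)) (p * q) * rg_den r p q (p * q / z) (int r - m)"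
    using rg_den_shift_r[of "p * q / z" "- m"] p0 q0 z
    by (simp add: y_def power_int_minus field_simps)
  have ny: "qpoch_inf y (p * q) \<noteq> 0" "qpoch_inf (p * q / y) (p * q) \<noteq> 0"
    using t by (auto simp: th_def y_def)
  hence nzp: "qpoch_inf (z * p powi m) (p * q) \<noteq> 0" using d1 nz by auto
  have "rg_quot r p q z (m + int r) * th (p * q) y = rg_quot r p q z m * th (p * q) (z * p powi m)"
    using d1 d2 nz ny nzp unfolding rg_quot_def th_def
    by (simp add: field_simps)
  also have "th (p * q) (z * p powi m) = (- y) powi (- m) * (p * q) powi (- (m * (m - 1) div 2)) * th (p * q) y"
    unfolding zp by (rule th_shift_powi[OF Q1 Q0 y])
  finally have "rg_quot r p q z (m + int r) * th (p * q) y =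
     ((- y) powi (- m) * (p * q) powi (- (m * (m - 1) div 2)) * rg_quot r p q z m) * th (p * q) y"
    by (simp add: mult_ac)
  thus ?thesis using t by (simp add: y_def)
qed

lemma eventually_rg_quot_shift_r:
  assumes z: "z \<noteq> 0"
  shows "eventually (\<lambda>w. rg_quot r p q w (m + int r) = (- w * q powi (- m)) powi (- m)
     * (p * q) powi (- (m * (m - 1) div 2)) * rg_quot r p q w m \<and> rg_quot r p q w (m + int r) \<noteq> 0) (at z)"
proof -
  have "z * q powi (- m) \<noteq> 0" using z q0 by simp
  from eventually_th_nonzero[OF Q1 Q0 this]
  have "eventually (\<lambda>w. th (p * q) (q powi (- m) * w) \<noteq> 0) (at z)"
    using q0 by (intro eventually_at_scale) (auto simp: mult.commute)
  with eventually_nz_at[OF z] eventually_rg_den_nonzero[of m z] eventually_rg_den_nonzero[of "m + int r" z]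
     eventually_rg_num_nonzero[OF z, of "- m"] eventually_rg_num_nonzero[OF z, of "int r - m"]
  show ?thesis
  proof eventually_elim
    case (elim w)
    have "rg_quot r p q w (m + int r) \<noteq> 0"
      using elim by (simp add: rg_quot_def)
    with rg_quot_shift_r[of w m] elim show ?case by (simp add: mult.commute)
  qed
qed

text \<open>The exponent of the multiplier of \<open>rgamma\<close> under m -> m + r at z = - exp u.
  It carries the factor r - 1: for r = 1 the gamma function does not depend on m.\<close>

definition psi :: "complex \<Rightarrow> int \<Rightarrow> complex" where
  "psi u m = (of_nat r - 1) * (u * (of_int m + of_nat r / 2)
     + Ln p * (3 * of_int m ^ 2 + 3 * (of_nat r - 1) * of_int m + of_nat r * (of_nat r - 2)) / 6
     - Ln q * (3 * of_int m ^ 2 + 3 * (of_nat r + 1) * of_int m + of_nat r * (of_nat r + 1)) / 6)"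

lemma pq_exp: "p = exp (Ln p)" "q = exp (Ln q)"
  using p0 q0 by auto

lemma correction_exp:
  "(- (- exp u) * q powi (- m)) powi (- m) * (p * q) powi (- (m * (m - 1) div 2)) =
   exp (- of_int m * (u - of_int m * Ln q) - (Ln p + Ln q) * (of_int m * (of_int m - 1) / 2))"
proof -
  have "(- (- exp u) * q powi (- m)) = exp (u - of_int m * Ln q)"
    by (subst pq_exp(2)) (simp add: exp_power_int exp_diff exp_minus field_simps)
  moreover have "p * q = exp (Ln p + Ln q)" using p0 q0 by (simp add: exp_add)
  ultimately show ?thesis
    by (simp only: exp_power_int of_int_minus of_int_binomial2 flip: exp_add)
       (rule arg_cong[where f = exp], simp add: algebra_simps)
qed

lemma rg_pref_exp': "rg_pref p q (- exp u) m = exp (u * (of_int m * (of_int m - 1) / 2)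
     + Ln p * (of_int m * (of_int m - 1) * (of_int m - 2) / 6) - Ln q * (of_int m * (of_int m ^ 2 - 1) / 6))"
  using rg_pref_exp[of "Ln p" "Ln q" u m] p0 q0 by simp

lemma rg_pref_shift_r:
  "rg_pref p q (- exp u) (m + int r) * ((- (- exp u) * q powi (- m)) powi (- m) * (p * q) powi (- (m * (m - 1) div 2)))
     = exp (psi u m) * rg_pref p q (- exp u) m"
  unfolding correction_exp rg_pref_exp' psi_def exp_add[symmetric]
  by (rule arg_cong[where f = exp]) (simp add: field_simps power2_eq_square)

lemma minus_exp_cases:
  assumes "z \<noteq> 0" obtains u :: complex where "z = - exp u"
  using assms exp_Ln[of "- z"] by (metis minus_minus neg_equal_0_iff_equal)

text \<open>The relation holds near z between the explicit expressions. The multiplier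
  \<open>g\<close> is continuous and nonzero, hence commutes with \<open>remove_sings\<close>, and
  the relation holds at every point, poles included.\<close>

lemma rgamma_shift_r: "rgamma r p q (- exp u) (m + int r) = exp (psi u m) * rgamma r p q (- exp u) m"
proof -
  define z where "z = - exp u"
  have z: "z \<noteq> 0" by (simp add: z_def)
  define g where "g = (\<lambda>w. rg_pref p q w (m + int r) / rg_pref p q w m *
      ((- w * q powi (- m)) powi (- m) * (p * q) powi (- (m * (m - 1) div 2))))"
  have pref_nz: "rg_pref p q w k \<noteq> 0" if "w \<noteq> 0" for w k
    using that p0 q0 by (simp add: rg_pref_def)
  have g_eq: "g z = exp (psi u m)"
    using rg_pref_shift_r[of u m] pref_nz[OF z, of m] by (simp add: g_def z_def)
  have "isCont g z"
    unfolding g_def rg_pref_def using z p0 q0 by (intro continuous_intros) auto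
  moreover have "g z \<noteq> 0" by (simp add: g_eq)
  ultimately have "g z * rgamma r p q z m = remove_sings (\<lambda>w. g w * (rg_pref p q w m * rg_quot r p q w m)) z"
    unfolding rgamma_altdef[OF z] by (rule remove_sings_mult_nonzero[symmetric])
  also have "\<dots> = rgamma r p q z (m + int r)"
    unfolding rgamma_altdef[OF z]
  proof (rule remove_sings_cong[OF _ refl])
    show "eventually (\<lambda>w. g w * (rg_pref p q w m * rg_quot r p q w m) =
        rg_pref p q w (m + int r) * rg_quot r p q w (m + int r)) (at z)"
      using eventually_rg_quot_shift_r[OF z, of m] eventually_nz_at[OF z]
      by eventually_elim (simp add: g_def pref_nz mult_ac)
  qed
  finally show ?thesis using g_eq by (simp add: z_def)
qed

lemma rg_pref_reflect:
  assumes z: "z \<noteq> 0"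
  shows "rg_pref p q z m * rg_pref p q (p * q / z) (- m) =
    (- z * q powi (- m)) powi (- m) * (p * q) powi (- (m * (m - 1) div 2))"
proof -
  obtain u where u: "z = - exp u" using minus_exp_cases[OF z] .
  have "p * q / z = - exp (Ln p + Ln q - u)" using p0 q0 by (simp add: u exp_add exp_diff)
  thus ?thesis unfolding u correction_exp
    by (simp only: rg_pref_exp' flip: exp_add)
       (rule arg_cong[where f = exp], simp add: field_simps power2_eq_square)
qed

text \<open>The quotient at p q / w and - m is the reciprocal of the quotient at w and m + r. The
  shift by r brings m + r back to m, and its elementary correction is cancelled by the
  prefactors.\<close>

lemma eventually_rgamma_reflect:
  assumes z: "z \<noteq> 0"
  shows "eventually (\<lambda>w. rgamma r p q w m * rgamma r p q (p * q / w) (- m) = 1) (at z)"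
proof -
  have "eventually (\<lambda>w. rgamma r p q (p * q / w) (- m) =
      rg_pref p q (p * q / w) (- m) * rg_quot r p q (p * q / w) (- m)) (at z)"
    by (rule eventually_at_reciprocal[OF Q0 z]) (rule eventually_rgamma_eq, use z Q0 in auto)
  from eventually_rgamma_eq[OF z, of m] this eventually_rg_quot_shift_r[OF z, of m] eventually_nz_at[OF z]
  show ?thesis
  proof eventually_elim
    case (elim w)
    have inv: "rg_quot r p q (p * q / w) (- m) = 1 / rg_quot r p q w (m + int r)"
      using elim(4) Q0 by (simp add: rg_quot_def add.commute)
    have nz: "rg_quot r p q w (m + int r) \<noteq> 0" using elim(3) by blast
    have "rgamma r p q w m * rgamma r p q (p * q / w) (- m) =
       (rg_pref p q w m * rg_pref p q (p * q / w) (- m)) * rg_quot r p q w m / rg_quot r p q w (m + int r)"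
      unfolding elim(1) elim(2) inv by simp
    also have "\<dots> = 1" using elim(3) nz unfolding rg_pref_reflect[OF elim(4)]
      by (metis divide_self)
    finally show ?case .
  qed
qed

text \<open>Exchanging p and q makes the two double products trade places, and the index - m becomes
  m + r. The shift by r and the prefactors account for the difference.\<close>

lemma eventually_rgamma_swap:
  assumes z: "z \<noteq> 0"
  shows "eventually (\<lambda>w. rgamma r q p w (- m) = rgamma r p q w m) (at z)"
proof -
  interpret sw: rarefied r q p by (rule swap)
  from eventually_rgamma_eq[OF z, of m] sw.eventually_rgamma_eq[OF z, of "- m"]
    eventually_rg_quot_shift_r[OF z, of m] eventually_nz_at[OF z]
  show ?thesis
  proof eventually_elim
    case (elim w)
    have den: "rg_den r q p x (- k) = rg_den r p q x (k + int r)" for x k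
      by (simp add: rg_den_def mult.commute add.commute)
    have "rg_quot r q p w (- m) = rg_quot r p q w (m + int r)"
      using den[of "p * q / w" "- int r - m"] den[of w m]
      by (simp add: rg_quot_def mult.commute add.commute)
    moreover have "rg_pref q p w (- m) * ((- w * q powi (- m)) powi (- m) * (p * q) powi (- (m * (m - 1) div 2)))
       = rg_pref p q w m"
    proof -
      obtain u where u: "w = - exp u" using minus_exp_cases elim by blast
      show ?thesis unfolding u correction_exp
        by (simp only: rg_pref_exp' sw.rg_pref_exp' flip: exp_add)
           (rule arg_cong[where f = exp], simp add: field_simps power2_eq_square)
    qed
    ultimately show ?case using elim by (simp add: mult_ac)
  qed
qed

lemma rgamma_swap:
  assumes z: "z \<noteq> 0"
  shows "rgamma r q p z (- m) = rgamma r p q z m"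
proof -
  interpret sw: rarefied r q p by (rule swap)
  have "eventually (\<lambda>w. rg_pref q p w (- m) * rg_quot r q p w (- m) = rg_pref p q w m * rg_quot r p q w m) (at z)"
    using eventually_rgamma_swap[OF z, of m] sw.eventually_rgamma_eq[OF z, of "- m"] eventually_rgamma_eq[OF z, of m]
    by eventually_elim simp
  thus ?thesis unfolding rgamma_altdef[OF z] sw.rgamma_altdef[OF z]
    by (rule remove_sings_cong) auto
qed

text \<open>The argument z p^m of the first gamma function is multiplied by its nome p q, which
  produces a theta function of nome p^r; the argument z q^(r - m) of the second one does not
  change.\<close>

lemma eventually_rgamma_shift_q:
  assumes z: "z \<noteq> 0"
  shows "eventually (\<lambda>w. rgamma r p q (q * w) (m + 1) = rtheta r p w m * rgamma r p q w m) (at z)"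
proof -
  have "eventually (\<lambda>w. rgamma r p q (q * w) (m + 1) =
      rg_pref p q (q * w) (m + 1) * rg_quot r p q (q * w) (m + 1)) (at z)"
    by (rule eventually_at_scale[OF q0]) (rule eventually_rgamma_eq, use z q0 in auto)
  moreover have "eventually (\<lambda>w. rg_den r p q (q * w) (m + 1) \<noteq> 0) (at z)"
    by (rule eventually_at_scale[OF q0]) (rule eventually_rg_den_nonzero)
  ultimately show ?thesis
    using eventually_rgamma_eq[OF z, of m] eventually_nz_at[OF z] eventually_rg_den_nonzero[of m z]
  proof eventually_elim
    case (elim w)
    have den: "rg_den r p q w m = qpoch_inf (w * p powi m) (p ^ r) * rg_den r p q (q * w) (m + 1)"
    proof -
      have "dpoch (p ^ r) (p * q) (w * p powi m) = qpoch_inf (w * p powi m) (p ^ r) *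
          dpoch (p ^ r) (p * q) (q * w * p powi (m + 1))"
        using dpoch_rec2[OF P1 Q1, of "w * p powi m"] p0 by (simp add: power_int_add mult_ac)
      moreover have e: "w * q powi (int r - m) = q * w * q powi (int r - (m + 1))"
        using q0 by (simp add: power_int_diff power_int_add field_simps)
      ultimately show ?thesis unfolding rg_den_def e by simp
    qed
    have num: "rg_den r p q (p * q / (q * w)) (int r - (m + 1)) =
        qpoch_inf (p ^ r / (w * p powi m)) (p ^ r) * rg_den r p q (p * q / w) (int r - m)"
    proof -
      have e: "p * q / (q * w) * p powi (int r - (m + 1)) = p ^ r / (w * p powi m)"
        using p0 q0 by (simp add: power_int_diff power_int_add field_simps)
      have e': "p ^ r / (w * p powi m) * (p * q) = p * q / w * p powi (int r - m)"
        using p0 q0 by (simp add: power_int_diff field_simps)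
      have e'': "p * q / (q * w) * q powi (int r - (int r - (m + 1))) = p * q / w * q powi (int r - (int r - m))"
        using q0 by (simp add: power_int_add field_simps)
      show ?thesis unfolding rg_den_def e e'' using dpoch_rec2[OF P1 Q1, of "p ^ r / (w * p powi m)"]
        unfolding e' by (simp only: mult.assoc)
    qed
    have nz: "qpoch_inf (w * p powi m) (p ^ r) \<noteq> 0" using den elim by auto
    have quot: "rg_quot r p q (q * w) (m + 1) = th (p ^ r) (w * p powi m) * rg_quot r p q w m"
      using nz elim unfolding rg_quot_def num den th_def by (simp add: field_simps)
    have pref: "rg_pref p q (q * w) (m + 1) = (- w) powi m * p powi (m * (m - 1) div 2) * rg_pref p q w m"
    proof -
      obtain u where u: "w = - exp u" using minus_exp_cases elim by blast
      have "q * w = - exp (Ln q + u)" using q0 by (simp add: u exp_add)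
      moreover have "p powi (m * (m - 1) div 2) = exp (of_int (m * (m - 1) div 2) * Ln p)"
        using p0 by (simp flip: exp_power_int)
      ultimately show ?thesis unfolding u
        by (simp only: rg_pref_exp' minus_minus exp_power_int of_int_binomial2 flip: exp_add)
           (rule arg_cong[where f = exp], simp add: field_simps power2_eq_square)
    qed
    show ?case using elim(1,3) quot pref by (simp add: rtheta_def mult_ac)
  qed
qed

text \<open>For 0 <= m < r a zero of the denominator satisfies z p^a q^b = 1 with a, b >= 0. If a +
  b > 0, then |z| is at least the reciprocal of max(|p|, |q|); the case a = b = 0 means z = 1 and m
  = 0.\<close>

lemma rden_small_nonzero:
  assumes m: "0 \<le> m" "m < int r" and z: "norm z < 1 / max (norm p) (norm q)" "z \<noteq> 1 \<or> m \<noteq> 0"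
  shows "rg_den r p q z m \<noteq> 0"
proof
  define M where "M = max (norm p) (norm q)"
  have "0 < M" unfolding M_def using p0 by (intro less_le_trans[OF _ max.cobounded1]) auto
  hence M: "0 < M" "M < 1" using p1 q1 by (auto simp: M_def)
  have pM: "norm p \<le> M" "norm q \<le> M" by (auto simp: M_def)
  have key: False if "norm z * (norm p ^ a * norm q ^ b) = 1" "a + b > 0" for a b
  proof -
    have "norm p ^ a * norm q ^ b \<le> M ^ a * M ^ b"
      using pM M by (intro mult_mono power_mono) auto
    also have "\<dots> = M ^ (a + b)" by (simp add: power_add)
    also have "\<dots> \<le> M ^ 1" using M that by (intro power_decreasing) auto
    finally have "norm z * (norm p ^ a * norm q ^ b) \<le> norm z * M"
      by (intro mult_left_mono) auto
    also have "\<dots> < 1" using z(1) M unfolding M_def[symmetric] by (simp add: field_simps)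
    finally show False using that by simp
  qed
  assume "rg_den r p q z m = 0"
  then consider "dpoch (p ^ r) (p * q) (z * p powi m) = 0"
    | "dpoch (q ^ r) (p * q) (z * q powi (int r - m)) = 0"
    by (auto simp: rg_den_def)
  thus False
  proof cases
    case 1
    then obtain j k where jk: "z * p powi m * (p ^ r) ^ j * (p * q) ^ k = 1"
      using dpoch_eq_0_iff[OF P1 Q1] by auto
    have "p powi m = p ^ nat m" using m by (simp add: power_int_def)
    hence e: "z * (p ^ (nat m + r * j + k) * q ^ k) = 1"
      using jk by (simp add: power_add power_mult_distrib mult_ac flip: power_mult)
    hence "norm z * (norm p ^ (nat m + r * j + k) * norm q ^ k) = 1"
      by (metis norm_mult norm_one norm_power)
    from key[OF this] have "\<not> nat m + r * j + k + k > 0" by blast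
    hence k0: "nat m + r * j + k = 0" "k = 0" by linarith+
    from e have "z = 1" unfolding k0(1) unfolding k0(2) by simp
    moreover have "m = 0" using k0 m by simp
    ultimately show False using z(2) by simp
  next
    case 2
    then obtain j k where jk: "z * q powi (int r - m) * (q ^ r) ^ j * (p * q) ^ k = 1"
      using dpoch_eq_0_iff[OF S1 Q1] by auto
    have "q powi (int r - m) = q ^ nat (int r - m)" using m by (simp add: power_int_def)
    hence "z * (p ^ k * q ^ (nat (int r - m) + r * j + k)) = 1"
      using jk by (simp add: power_add power_mult_distrib mult_ac flip: power_mult)
    hence "norm z * (norm p ^ k * norm q ^ (nat (int r - m) + r * j + k)) = 1"
      by (metis norm_mult norm_one norm_power)
    from key[OF this] m show False by auto
  qed
qed

lemma rgamma_analytic_shift_r: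
  assumes z: "z \<noteq> 0"
  shows "(\<lambda>w. rgamma r p q w (m + int r)) analytic_on {z} \<longleftrightarrow> (\<lambda>w. rgamma r p q w m) analytic_on {z}"
proof -
  define g where "g = (\<lambda>w. rg_pref p q w (m + int r) / rg_pref p q w m *
      ((- w * q powi (- m)) powi (- m) * (p * q) powi (- (m * (m - 1) div 2))))"
  have pref_nz: "rg_pref p q w k \<noteq> 0" if "w \<noteq> 0" for w k
    using that p0 q0 by (simp add: rg_pref_def)
  have g_nz: "g w \<noteq> 0" if "w \<noteq> 0" for w using that p0 q0 pref_nz by (simp add: g_def)
  have g_an: "g analytic_on {z}"
    unfolding g_def rg_pref_def by (intro analytic_intros) (use z p0 q0 in auto)
  have eq: "rgamma r p q w (m + int r) = g w * rgamma r p q w m" if w: "w \<noteq> 0" for w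
  proof -
    obtain u where u: "w = - exp u" using minus_exp_cases[OF w] .
    have "g w = exp (psi u m)"
      using rg_pref_shift_r[of u m] pref_nz[OF w, of m] by (simp add: g_def u)
    thus ?thesis using rgamma_shift_r[of u m] by (simp add: u)
  qed
  have ev: "eventually (\<lambda>w. w \<noteq> 0) (nhds z)" using z by (simp add: t1_space_nhds)
  show ?thesis
  proof
    assume "(\<lambda>w. rgamma r p q w (m + int r)) analytic_on {z}"
    hence 1: "(\<lambda>w. rgamma r p q w (m + int r) / g w) analytic_on {z}"
      using g_nz z by (intro analytic_intros g_an) auto
    have "eventually (\<lambda>w. rgamma r p q w m = rgamma r p q w (m + int r) / g w) (nhds z)"
      using ev by eventually_elim (use eq g_nz in auto)
    from analytic_at_cong[OF this refl] show "(\<lambda>w. rgamma r p q w m) analytic_on {z}"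
      using 1 by blast
  next
    assume "(\<lambda>w. rgamma r p q w m) analytic_on {z}"
    hence 1: "(\<lambda>w. g w * rgamma r p q w m) analytic_on {z}"
      by (intro analytic_intros g_an)
    have "eventually (\<lambda>w. rgamma r p q w (m + int r) = g w * rgamma r p q w m) (nhds z)"
      using ev by eventually_elim (use eq in auto)
    from analytic_at_cong[OF this refl] show "(\<lambda>w. rgamma r p q w (m + int r)) analytic_on {z}"
      using 1 by blast
  qed
qed

lemma rgamma_analytic_mult_r:
  assumes z: "z \<noteq> 0"
  shows "(\<lambda>w. rgamma r p q w (m + k * int r)) analytic_on {z} \<longleftrightarrow> (\<lambda>w. rgamma r p q w m) analytic_on {z}"
proof (induction k rule: int_induct[where k = 0])
  case base
  show ?case by simp
next
  case (step1 k)
  thus ?case using rgamma_analytic_shift_r[OF z, of "m + k * int r"] by (simp add: algebra_simps)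
next
  case (step2 k)
  thus ?case using rgamma_analytic_shift_r[OF z, of "m + (k - 1) * int r"] by (simp add: algebra_simps)
qed

text \<open>The multiplier of the shift by r has no zeros and no poles in the punctured plane, so m
  may be reduced modulo r into the range where the denominator is controlled. The region reaches
  beyond the unit circle, where the pinching argument needs it.\<close>

lemma rgamma_analytic:
  assumes z: "z \<noteq> 0" "norm z < 1 / max (norm p) (norm q)" "z \<noteq> 1 \<or> \<not> int r dvd m"
  shows "(\<lambda>w. rgamma r p q w m) analytic_on {z}"
proof -
  have "0 \<le> m mod int r" "m mod int r < int r" using r by auto
  moreover have "z \<noteq> 1 \<or> m mod int r \<noteq> 0" using z(3) by (auto simp: dvd_eq_mod_eq_0)
  ultimately have "(\<lambda>w. rgamma r p q w (m mod int r)) analytic_on {z}"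
    using rden_small_nonzero z by (intro rgamma_analytic_at) auto
  thus ?thesis using rgamma_analytic_mult_r[OF z(1), of "m mod int r" "m div int r"] by simp
qed

lemma one_less_radius: "1 < 1 / max (norm p) (norm q)"
proof -
  have "0 < max (norm p) (norm q)" using p0 by (intro less_le_trans[OF _ max.cobounded1]) auto
  moreover have "max (norm p) (norm q) < 1" using p1 q1 by simp
  ultimately show ?thesis by (simp add: field_simps)
qed

lemma rgamma_analytic_disc:
  assumes z: "z \<noteq> 0" "norm z < 1"
  shows "(\<lambda>w. rgamma r p q w m) analytic_on {z}"
  using one_less_radius z by (intro rgamma_analytic) auto

lemma isCont_rgamma: "z \<noteq> 0 \<Longrightarrow> norm z < 1 \<Longrightarrow> isCont (\<lambda>w. rgamma r p q w m) z"
  by (rule analytic_at_imp_isCont[OF rgamma_analytic_disc])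

lemma rgamma_holomorphic: "(\<And>z. z \<in> A \<Longrightarrow> z \<noteq> 0 \<and> norm z < 1) \<Longrightarrow> (\<lambda>w. rgamma r p q w m) holomorphic_on A"
  by (rule analytic_imp_holomorphic, subst analytic_on_analytic_at) (auto intro: rgamma_analytic_disc)

lemma rtheta_analytic: "z \<noteq> 0 \<Longrightarrow> (\<lambda>w. rtheta r p w m) analytic_on {z}"
proof -
  assume z: "z \<noteq> 0"
  have "(\<lambda>w. rtheta r p w m) holomorphic_on -{0}" unfolding rtheta_def
    by (intro holomorphic_intros th_holomorphic_compose P1 P0) (use p0 in auto)
  thus ?thesis using z by (metis ComplI analytic_at open_Compl closed_singleton empty_iff insert_iff)
qed

lemma rgamma_shift_q:
  assumes z: "z \<noteq> 0" "norm z < 1"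
  shows "rgamma r p q (q * z) (m + 1) = rtheta r p z m * rgamma r p q z m"
proof (rule eventually_at_eq_imp_eq[OF _ _ eventually_rgamma_shift_q[OF z(1), of m]])
  have "norm (q * z) < 1 * 1" unfolding norm_mult using z q1 by (intro mult_strict_mono') auto
  thus "isCont (\<lambda>w. rgamma r p q (q * w) (m + 1)) z"
    using z q0 by (intro isCont_o2[OF _ isCont_rgamma] continuous_intros) auto
  show "isCont (\<lambda>w. rtheta r p w m * rgamma r p q w m) z"
    using z by (intro continuous_intros isCont_rgamma analytic_at_imp_isCont[OF rtheta_analytic])
qed

text \<open>The lower bound on |z| puts p q / z into the unit disc, so both factors are continuous
  and the identity near z passes to z.\<close>

lemma rgamma_reflect:
  assumes z: "norm (p * q) < norm z" "norm z < 1"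
  shows "rgamma r p q z m * rgamma r p q (p * q / z) (- m) = 1"
proof -
  have z0: "z \<noteq> 0" using z by auto
  have "norm (p * q / z) < 1" using z z0 by (simp add: norm_divide divide_less_eq)
  hence "isCont (\<lambda>w. rgamma r p q w m * rgamma r p q (p * q / w) (- m)) z"
    using z z0 Q0 by (intro continuous_intros isCont_rgamma isCont_o2[OF _ isCont_rgamma]) auto
  from eventually_at_eq_imp_eq[OF this continuous_const eventually_rgamma_reflect[OF z0]]
  show ?thesis .
qed

lemma rgamma_nonzero: "norm (p * q) < norm z \<Longrightarrow> norm z < 1 \<Longrightarrow> rgamma r p q z m \<noteq> 0"
  using rgamma_reflect[of z m] by auto

text \<open>The reciprocal of the product of the gamma functions at (z, m) and (1/z, - m), in a form
  that is analytic in the whole punctured plane.\<close>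

definition weyl :: "complex \<Rightarrow> int \<Rightarrow> complex" where
  "weyl z m = rtheta r p z m * rtheta r q (q * z) (- m - 1)"

text \<open>By reflection, the gamma function at (1/w, - m) is the reciprocal of the one at (p q w,
  m). The way from w to p q w consists of a shift by q and, after exchanging p and q, a shift by p;
  each contributes one theta function, and the index returns to m.\<close>

lemma eventually_weyl:
  assumes z: "z \<noteq> 0"
  shows "eventually (\<lambda>w. rgamma r p q w m * rgamma r p q (1 / w) (- m) * weyl w m = 1) (at z)"
proof -
  interpret sw: rarefied r q p by (rule swap)
  have 1: "eventually (\<lambda>w. rgamma r p q (p * q * w) m * rgamma r p q (p * q / (p * q * w)) (- m) = 1) (at z)"
    by (rule eventually_at_scale[OF Q0]) (rule eventually_rgamma_reflect, use z Q0 in auto)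
  have 2: "eventually (\<lambda>w. rgamma r q p (p * (q * w)) (- m - 1 + 1) =
      rtheta r q (q * w) (- m - 1) * rgamma r q p (q * w) (- m - 1)) (at z)"
    by (rule eventually_at_scale[OF q0]) (rule sw.eventually_rgamma_shift_q, use z q0 in auto)
  from eventually_rgamma_shift_q[OF z, of m] 1 2 eventually_nz_at[OF z]
  show ?thesis
  proof eventually_elim
    case (elim w)
    have "rgamma r p q (p * q * w) m = rgamma r q p (p * (q * w)) (- m)"
      using rgamma_swap[of "p * (q * w)" m] elim p0 q0 by (simp add: mult_ac)
    also have "\<dots> = rtheta r q (q * w) (- m - 1) * rgamma r q p (q * w) (- (m + 1))"
      using elim(3) by simp
    also have "rgamma r q p (q * w) (- (m + 1)) = rgamma r p q (q * w) (m + 1)"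
      using elim q0 by (intro rgamma_swap) auto
    also have "\<dots> = rtheta r p w m * rgamma r p q w m" by (rule elim(1))
    finally have "rgamma r p q (p * q * w) m = weyl w m * rgamma r p q w m" by (simp add: weyl_def mult_ac)
    moreover have "p * q / (p * q * w) = 1 / w" using Q0 by simp
    ultimately show ?case using elim(2) by (simp add: mult_ac)
  qed
qed

lemma weyl_analytic: "z \<noteq> 0 \<Longrightarrow> (\<lambda>w. weyl w m) analytic_on {z}"
proof -
  assume z: "z \<noteq> 0"
  interpret sw: rarefied r q p by (rule swap)
  have "((\<lambda>w. rtheta r q w (- m - 1)) \<circ> (\<lambda>w. q * w)) analytic_on {z}"
    by (rule analytic_on_compose_gen[of _ _ _ "-{0}"])
       (use z q0 in \<open>auto intro!: analytic_intros sw.rtheta_analytic simp: analytic_on_analytic_at[of _ "-{0}"]\<close>)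
  thus ?thesis unfolding weyl_def o_def by (intro analytic_intros rtheta_analytic z)
qed

end

section \<open>Averages over the unit circle\<close>

definition uexp :: "real \<Rightarrow> complex" where
  "uexp x = exp (2 * of_real pi * \<i> * of_real x)"

text \<open>The integral over the unit circle against dz / (2 pi i z) in the real coordinate of
  \<open>uexp\<close>. In this form contours are moved by differentiating under the integral
  sign.\<close>

definition avg :: "(complex \<Rightarrow> complex) \<Rightarrow> complex" where
  "avg f = integral {0..1} (\<lambda>x. f (uexp x))"

lemma norm_uexp [simp]: "norm (uexp x) = 1"
  unfolding uexp_def by (metis mult.assoc mult.commute norm_exp_i_times of_real_mult of_real_numeral)

lemma uexp_sphere [simp]: "uexp x \<in> sphere 0 1" by simp

lemma uexp_nonzero [simp]: "uexp x \<noteq> 0" by (simp add: uexp_def)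

lemma continuous_uexp: "continuous_on A uexp"
  unfolding uexp_def by (intro continuous_intros)

lemma uexp_has_derivative:
  "(uexp has_vector_derivative (2 * of_real pi * \<i> * uexp x)) (at x within A)"
proof -
  have "((\<lambda>z. exp (2 * of_real pi * \<i> * z)) has_field_derivative
      exp (2 * of_real pi * \<i> * of_real x) * (2 * of_real pi * \<i>)) (at (of_real x))"
    by (auto intro!: derivative_eq_intros)
  from has_vector_derivative_real_field[OF this] show ?thesis
    unfolding uexp_def by (simp add: mult_ac)
qed

lemma uexp_0: "uexp 0 = 1" and uexp_1: "uexp 1 = 1"
  by (simp_all add: uexp_def exp_two_pi_i')

lemma uexp_reflect: "uexp (1 - x) = 1 / uexp x"
proof -
  have "uexp (1 - x) = exp (2 * of_real pi * \<i> - 2 * of_real pi * \<i> * of_real x)"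
    by (simp add: uexp_def algebra_simps)
  also have "\<dots> = 1 / uexp x" unfolding exp_diff by (simp add: uexp_def exp_two_pi_i')
  finally show ?thesis .
qed

lemma avg_integrable:
  fixes f :: "complex \<Rightarrow> complex"
  assumes "continuous_on (sphere 0 1) f"
  shows "(\<lambda>x. f (uexp x)) integrable_on {0..1}"
proof -
  have "continuous_on {0..1} (\<lambda>x. f (uexp x))"
    by (rule continuous_on_compose2[OF assms continuous_uexp]) auto
  thus ?thesis by (rule integrable_continuous_real)
qed

lemma avg_contour_integral:
  assumes f: "continuous_on (sphere 0 1) f"
  shows "(\<lambda>z. f z / z) contour_integrable_on circlepath 0 1"
    and "contour_integral (circlepath 0 1) (\<lambda>z. f z / z) = 2 * of_real pi * \<i> * avg f"
proof -
  show "(\<lambda>z. f z / z) contour_integrable_on circlepath 0 1"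
    by (rule contour_integrable_continuous_circlepath) (use f in \<open>auto intro!: continuous_intros\<close>)
  have "contour_integral (circlepath 0 1) (\<lambda>z. f z / z) =
     integral {0..1} (\<lambda>x. f (uexp x) / uexp x * (2 * of_real pi * \<i> * uexp x))"
    unfolding contour_integral_integral
    by (intro integral_cong) (simp add: vector_derivative_circlepath, simp add: circlepath uexp_def mult_ac)
  also have "\<dots> = integral {0..1} (\<lambda>x. 2 * of_real pi * \<i> * f (uexp x))"
    by (intro integral_cong) simp
  also have "\<dots> = 2 * of_real pi * \<i> * avg f" by (simp add: avg_def)
  finally show "contour_integral (circlepath 0 1) (\<lambda>z. f z / z) = 2 * of_real pi * \<i> * avg f" .
qed

lemma avg_cong: "(\<And>z. norm z = 1 \<Longrightarrow> f z = g z) \<Longrightarrow> avg f = avg g"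
  unfolding avg_def by (intro integral_cong) simp

lemma avg_cmult: "avg (\<lambda>z. c * f z) = c * avg f"
  by (simp add: avg_def)

lemma avg_const: "avg (\<lambda>_. c) = c"
  by (simp add: avg_def)

lemma avg_diff:
  assumes "continuous_on (sphere 0 1) f" "continuous_on (sphere 0 1) g"
  shows "avg (\<lambda>z. f z - g z) = avg f - avg g"
  unfolding avg_def by (rule integral_diff) (use assms in \<open>auto intro: avg_integrable\<close>)

lemma avg_norm_le:
  assumes "continuous_on (sphere 0 1) f" "\<And>z. norm z = 1 \<Longrightarrow> norm (f z) \<le> B"
  shows "norm (avg f) \<le> B"
proof -
  have "norm (integral {0..1::real} (\<lambda>x. f (uexp x))) \<le> B * (1 - 0)"
    by (rule integral_bound)
       (use assms in \<open>auto intro!: continuous_on_compose2[OF assms(1) continuous_uexp]\<close>)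
  thus ?thesis by (simp add: avg_def)
qed

lemma avg_reciprocal:
  assumes "continuous_on (sphere 0 1) f"
  shows "avg (\<lambda>z. f (1 / z)) = avg f"
proof -
  have "((\<lambda>x. f (uexp x)) has_integral avg f) (cbox 0 1)"
    using integrable_integral[OF avg_integrable[OF assms]] by (simp add: avg_def)
  from has_integral_affinity[OF this, of "-1" 1]
  have "((\<lambda>x. f (uexp (1 - x))) has_integral avg f) ((\<lambda>x. 1 - x) ` {0..1})"
    by (simp add: algebra_simps)
  moreover have "(\<lambda>x. 1 - x) ` {0..1::real} = {0..1}"
  proof (intro equalityI subsetI)
    fix x :: real assume "x \<in> {0..1}"
    thus "x \<in> (\<lambda>x. 1 - x) ` {0..1}" by (intro image_eqI[of _ _ "1 - x"]) auto
  qed auto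
  ultimately show ?thesis unfolding avg_def uexp_reflect by (metis integral_unique)
qed

text \<open>Up to 2 pi i, z h'(z) is the derivative of h along the circle, and the circle is
  closed.\<close>

lemma avg_derivative:
  assumes "\<And>z. norm z = 1 \<Longrightarrow> (h has_field_derivative h' z) (at z)"
  shows "avg (\<lambda>z. z * h' z) = 0"
proof -
  have "((\<lambda>x. 2 * of_real pi * \<i> * (uexp x * h' (uexp x))) has_integral h (uexp 1) - h (uexp 0)) {0..1}"
  proof (rule fundamental_theorem_of_calculus)
    fix x :: real
    have "(h has_field_derivative h' (uexp x)) (at (uexp x))" by (rule assms) simp
    from field_vector_diff_chain_within[OF uexp_has_derivative has_field_derivative_at_within[OF this]]
    show "((\<lambda>x. h (uexp x)) has_vector_derivative 2 * of_real pi * \<i> * (uexp x * h' (uexp x))) (at x within {0..1})"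
      by (simp add: o_def mult_ac)
  qed auto
  from integral_unique[OF this]
  have "integral {0..1} (\<lambda>x. 2 * of_real pi * \<i> * (uexp x * h' (uexp x))) = 0"
    by (simp only: uexp_0 uexp_1 diff_self)
  thus ?thesis by (simp add: avg_def)
qed

lemma avg_leibniz:
  assumes A: "open A" "c \<in> A"
    and d: "\<And>c z. c \<in> A \<Longrightarrow> norm z = 1 \<Longrightarrow> ((\<lambda>c. F c z) has_field_derivative F' c z) (at c)"
    and F': "continuous_on (A \<times> sphere 0 1) (\<lambda>(c, z). F' c z)"
    and F: "\<And>c. c \<in> A \<Longrightarrow> continuous_on (sphere 0 1) (F c)"
  shows "((\<lambda>c. avg (F c)) has_field_derivative avg (F' c)) (at c)"
proof -
  obtain e where e: "e > 0" "ball c e \<subseteq> A" using A open_contains_ball by blast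
  have "((\<lambda>c. integral (cbox 0 1) (\<lambda>x. F c (uexp x))) has_field_derivative
      integral (cbox 0 1) (\<lambda>x. F' c (uexp x))) (at c within ball c e)"
  proof (rule leibniz_rule_field_derivative)
    show "((\<lambda>c. F c (uexp x)) has_field_derivative F' b (uexp x)) (at b within ball c e)"
      if "b \<in> ball c e" for b and x :: real
      by (rule has_field_derivative_at_within[OF d]) (use that e in auto)
    show "(\<lambda>x. F b (uexp x)) integrable_on cbox 0 1" if "b \<in> ball c e" for b
      using avg_integrable[OF F[of b]] that e by auto
    have "continuous_on (ball c e \<times> cbox 0 1) (\<lambda>y. (\<lambda>(c, z). F' c z) (fst y, uexp (snd y)))"
      by (rule continuous_on_compose2[OF F'])
         (use e in \<open>auto intro!: continuous_intros continuous_on_compose2[OF continuous_uexp]\<close>)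
    thus "continuous_on (ball c e \<times> cbox 0 1) (\<lambda>(b, x). F' b (uexp x))"
      by (simp add: case_prod_beta)
  qed (use e in auto)
  moreover have "at c within ball c e = at c" using e by (intro at_within_open) auto
  ultimately show ?thesis unfolding avg_def by (simp only: cbox_interval)
qed

lemma avg_holomorphic:
  assumes A: "open A"
    and d: "\<And>c z. c \<in> A \<Longrightarrow> norm z = 1 \<Longrightarrow> ((\<lambda>c. F c z) has_field_derivative F' c z) (at c)"
    and F': "continuous_on (A \<times> sphere 0 1) (\<lambda>(c, z). F' c z)"
    and F: "\<And>c. c \<in> A \<Longrightarrow> continuous_on (sphere 0 1) (F c)"
  shows "(\<lambda>c. avg (F c)) holomorphic_on A"
  unfolding holomorphic_on_open[OF A] using avg_leibniz[OF A _ d F' F] by blast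

text \<open>Deformation of a circle within a rotation-invariant domain: the derivative in c is the
  mean of z g'(c z), which is a derivative along the circle and so has mean 0.\<close>

lemma avg_dilation_const:
  assumes A: "open A" "connected A" and rot: "\<And>c z. c \<in> A \<Longrightarrow> norm z = 1 \<Longrightarrow> c * z \<in> A"
    and g: "g holomorphic_on A" and cd: "c \<in> A" "d \<in> A"
  shows "avg (\<lambda>z. g (c * z)) = avg (\<lambda>z. g (d * z))"
proof -
  have gd: "(g has_field_derivative deriv g z) (at z)" if "z \<in> A" for z
    using holomorphic_derivI[OF g A(1) that] .
  have gc: "continuous_on A g" and g'c: "continuous_on A (deriv g)"
    using g A(1) by (auto intro!: holomorphic_on_imp_continuous_on holomorphic_deriv)
  have der: "((\<lambda>c. avg (\<lambda>z. g (c * z))) has_field_derivative avg (\<lambda>z. z * deriv g (c * z))) (at c)"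
    if "c \<in> A" for c
  proof (rule avg_leibniz[OF A(1) that])
    show "((\<lambda>c. g (c * z)) has_field_derivative z * deriv g (c * z)) (at c)"
      if "c \<in> A" "norm z = 1" for c z
    proof -
      have "((\<lambda>c. c * z) has_field_derivative z) (at c)" by (auto intro!: derivative_eq_intros)
      from DERIV_chain2[OF gd[OF rot[OF that]] this] show ?thesis by (simp add: mult.commute)
    qed
    have "continuous_on (A \<times> sphere 0 1) (\<lambda>y. snd y * deriv g (fst y * snd y))"
      by (intro continuous_intros continuous_on_compose2[OF g'c]) (use rot in auto)
    thus "continuous_on (A \<times> sphere 0 1) (\<lambda>(c, z). z * deriv g (c * z))"
      by (simp add: case_prod_beta)
    show "continuous_on (sphere 0 1) (\<lambda>z. g (c * z))" if "c \<in> A" for c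
      by (intro continuous_on_compose2[OF gc] continuous_intros) (use rot that in auto)
  qed
  have "avg (\<lambda>z. z * deriv g (c * z)) = 0" if c: "c \<in> A" for c
  proof (cases "c = 0")
    case True
    thus ?thesis using avg_derivative[of "\<lambda>z. deriv g 0 * z" "\<lambda>_. deriv g 0"]
      by (auto intro!: derivative_eq_intros)
  next
    case False
    show ?thesis
    proof (rule avg_derivative[of "\<lambda>z. g (c * z) / c" "\<lambda>z. deriv g (c * z)"])
      fix z :: complex assume "norm z = 1"
      thus "((\<lambda>z. g (c * z) / c) has_field_derivative deriv g (c * z)) (at z)"
      proof -
        assume z: "norm z = 1"
        have "((\<lambda>z. c * z) has_field_derivative c) (at z)" by (auto intro!: derivative_eq_intros)
        from DERIV_cdivide[OF DERIV_chain2[OF gd[OF rot[OF c z]] this], of c] show ?thesis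
          using False by simp
      qed
    qed
  qed
  hence der0: "((\<lambda>c. avg (\<lambda>z. g (c * z))) has_field_derivative 0) (at c)" if "c \<in> A" for c
    using der[OF that] that by simp
  obtain k where "\<And>c. c \<in> A \<Longrightarrow> avg (\<lambda>z. g (c * z)) = k"
  proof (rule DERIV_zero_connected_constant[OF A(2,1), of "{}"])
    show "continuous_on A (\<lambda>c. avg (\<lambda>z. g (c * z)))"
      using der0 DERIV_isCont by (auto intro!: continuous_at_imp_continuous_on)
  qed (use der0 in auto)
  thus ?thesis using cd by metis
qed

section \<open>The difference equation\<close>

lemma exp_add_2pi: "exp (x + of_int k * (2 * of_real pi * \<i>)) = exp x"
  using exp_integer_2pi[of "of_int k"] by (simp add: exp_add mult_ac)

text \<open>All logarithms but one are principal values and the last absorbs the rest, so that their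
  sum is exact and not only exact modulo 2 pi i. The minus signs cancel because the index set has
  even size.\<close>

lemma obtain_logs:
  fixes s :: "'a \<Rightarrow> complex"
  assumes I: "finite I" "even (card I)" "I \<noteq> {}" and s: "\<And>a. a \<in> I \<Longrightarrow> s a \<noteq> 0"
    and L: "(\<Prod>a\<in>I. s a) = exp L"
  obtains \<tau> where "\<And>a. a \<in> I \<Longrightarrow> - s a = exp (\<tau> a)" "(\<Sum>a\<in>I. \<tau> a) = L"
proof -
  obtain b where b: "b \<in> I" using I by auto
  define \<tau>0 where "\<tau>0 = (\<lambda>a. Ln (- s a))"
  define \<tau> where "\<tau> = \<tau>0(b := L - (\<Sum>a\<in>I - {b}. \<tau>0 a))"
  have 0: "exp (\<tau>0 a) = - s a" if "a \<in> I" for a using s[OF that] by (simp add: \<tau>0_def)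
  have "(\<Prod>a\<in>I. s a) = (\<Prod>a\<in>I. - s a)"
    using I(2) by (simp add: prod_uminus)
  also have "\<dots> = - s b * (\<Prod>a\<in>I - {b}. - s a)" using I b by (simp add: prod.remove)
  also have "(\<Prod>a\<in>I - {b}. - s a) = exp (\<Sum>a\<in>I - {b}. \<tau>0 a)"
    using I 0 by (subst exp_sum) auto
  finally have "- s b = exp (\<tau> b)" unfolding L by (simp add: \<tau>_def exp_diff field_simps)
  hence 1: "- s a = exp (\<tau> a)" if "a \<in> I" for a
    using 0[OF that] by (cases "a = b") (auto simp: \<tau>_def)
  have "(\<Sum>a\<in>I. \<tau> a) = \<tau> b + (\<Sum>a\<in>I - {b}. \<tau> a)" using I b by (simp add: sum.remove)
  also have "(\<Sum>a\<in>I - {b}. \<tau> a) = (\<Sum>a\<in>I - {b}. \<tau>0 a)"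
    by (intro sum.cong) (auto simp: \<tau>_def)
  finally have "(\<Sum>a\<in>I. \<tau> a) = L" by (simp add: \<tau>_def)
  with 1 show ?thesis using that by blast
qed

context rarefied
begin

lemma rtheta_exp:
  assumes "- w = exp u"
  shows "rtheta r p w k = exp (of_int k * u + Ln p * (of_int k * (of_int k - 1) / 2)) * th (p ^ r) (w * p powi k)"
proof -
  have "p powi (k * (k - 1) div 2) = exp (of_int (k * (k - 1) div 2) * Ln p)"
    using p0 by (simp flip: exp_power_int)
  thus ?thesis unfolding rtheta_def assms exp_power_int of_int_binomial2
    by (simp add: exp_add mult_ac)
qed

lemma rtheta_shift_r:
  assumes u: "- w = exp u"
  shows "rtheta r p w (k + int r) = exp ((of_nat r - 1) * (u + Ln p * (of_int k + of_nat r / 2))) * rtheta r p w k"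
proof -
  have w: "w = - exp u" using u by (metis minus_minus)
  have pk: "p powi k = exp (of_int k * Ln p)"
    using p0 by (simp flip: exp_power_int)
  define y where "y = w * p powi k"
  have y0: "y \<noteq> 0" using p0 w by (simp add: y_def)
  have "w * p powi (k + int r) = p ^ r * y"
    using p0 by (simp add: y_def power_int_add)
  hence "th (p ^ r) (w * p powi (k + int r)) = - th (p ^ r) y / y"
    using th_shift[OF P1 P0 y0] by simp
  also have "\<dots> = exp (- u - of_int k * Ln p) * th (p ^ r) y"
    unfolding y_def w pk by (simp add: exp_diff exp_minus field_simps)
  finally have "th (p ^ r) (w * p powi (k + int r)) = exp (- u - of_int k * Ln p) * th (p ^ r) y" .
  moreover have "of_int (k + int r) * u + Ln p * (of_int (k + int r) * (of_int (k + int r) - 1) / 2) + (- u - of_int k * Ln p)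
    = (of_nat r - 1) * (u + Ln p * (of_int k + of_nat r / 2)) + (of_int k * u + Ln p * (of_int k * (of_int k - 1) / 2))"
    by (simp add: field_simps power2_eq_square)
  ultimately show ?thesis unfolding rtheta_exp[OF u] y_def[symmetric]
    by (simp only: mult.assoc[symmetric] exp_add[symmetric])
qed

text \<open>Expanding the quadratic exponents around n a shows that v and d interact with the
  parameters only through the sums of \<tau> and n, which balancing prescribes.\<close>

lemma prod_exp_quadratic:
  fixes \<tau> :: "'a \<Rightarrow> complex" and n :: "'a \<Rightarrow> int"
  shows "(\<Prod>a\<in>J. exp (of_int (n a + d) * (v + \<tau> a) + Ln p * (of_int (n a + d) * (of_int (n a + d) - 1) / 2) :: complex))
    = exp ((\<Sum>a\<in>J. of_int (n a) * \<tau> a + Ln p * (of_int (n a) * (of_int (n a) - 1) / 2)) + of_int d * (\<Sum>a\<in>J. \<tau> a)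
       + (of_int (\<Sum>a\<in>J. n a) + of_nat (card J) * of_int d) * v
       + Ln p * (of_int d * of_int (\<Sum>a\<in>J. n a) + of_nat (card J) * (of_int d * (of_int d - 1) / 2)))"
proof (cases "finite J")
  case True
  have "of_int (n a + d) * (v + \<tau> a) + Ln p * (of_int (n a + d) * (of_int (n a + d) - 1) / 2)
    = (of_int (n a) * \<tau> a + Ln p * (of_int (n a) * (of_int (n a) - 1) / 2)) + of_int d * \<tau> a
      + (of_int (n a) + of_int d) * v
      + Ln p * (of_int d * of_int (n a) + of_int d * (of_int d - 1) / 2)" for a
    by (simp add: field_simps)
  hence "(\<Sum>a\<in>J. of_int (n a + d) * (v + \<tau> a) + Ln p * (of_int (n a + d) * (of_int (n a + d) - 1) / 2))
     = (\<Sum>a\<in>J. of_int (n a) * \<tau> a + Ln p * (of_int (n a) * (of_int (n a) - 1) / 2)) + (\<Sum>a\<in>J. of_int d * \<tau> a)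
      + (\<Sum>a\<in>J. (of_int (n a) + of_int d) * v)
      + (\<Sum>a\<in>J. Ln p * (of_int d * of_int (n a) + of_int d * (of_int d - 1) / 2))"
    by (simp only: sum.distrib)
  also have "\<dots> = (\<Sum>a\<in>J. of_int (n a) * \<tau> a + Ln p * (of_int (n a) * (of_int (n a) - 1) / 2)) + of_int d * (\<Sum>a\<in>J. \<tau> a)
       + (of_int (\<Sum>a\<in>J. n a) + of_nat (card J) * of_int d) * v
       + Ln p * (of_int d * of_int (\<Sum>a\<in>J. n a) + of_nat (card J) * (of_int d * (of_int d - 1) / 2))"
    by (simp add: sum.distrib flip: sum_distrib_left sum_distrib_right)
  finally show ?thesis using True by (simp only: exp_sum[symmetric])
qed auto

end

locale rarefied_params = rarefied +
  fixes I :: "nat set" and \<epsilon> :: int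
  assumes I: "finite I" "card I = 6" and \<epsilon>: "\<epsilon> \<in> {0, 1}"
begin

text \<open>This is the addition formula of nome p^r at V a = s a p^(n a + \<epsilon>/2) and Z = z
  p^(m + \<epsilon>/2). The prescribed product of the s and sum of the n are what gives the V the
  product 1. The rest is to check that all elementary factors combine into one that does not depend
  on m and z.\<close>

lemma rtheta_addition:
  assumes ij: "i \<in> I" "j \<in> I" "i \<noteq> j"
    and s: "\<And>a. a \<in> I \<Longrightarrow> s a \<noteq> 0" and prod: "(\<Prod>a\<in>I. s a) = p" and n: "(\<Sum>a\<in>I. n a) = - 3 * \<epsilon> - 1"
  obtains C where "\<And>m z. z \<noteq> 0 \<Longrightarrow>
    rtheta r p (z ^ 2) (2 * m + \<epsilon>) *
      ((\<Prod>a\<in>I - {i, j}. rtheta r p (s i * s a) (n i + n a + \<epsilon>)) * (rtheta r p (s j * z) (n j + m + \<epsilon>) * rtheta r p (s j / z) (n j - m))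
     - (\<Prod>a\<in>I - {i, j}. rtheta r p (s j * s a) (n j + n a + \<epsilon>)) * (rtheta r p (s i * z) (n i + m + \<epsilon>) * rtheta r p (s i / z) (n i - m)))
    = C * (inverse z * (\<Prod>a\<in>I. rtheta r p (s a * z) (n a + m + \<epsilon>)) - z ^ 3 * (\<Prod>a\<in>I. rtheta r p (s a / z) (n a - m)))"
proof -
  define lp where "lp = Ln p"
  have lp: "exp lp = p" using p0 by (simp add: lp_def)
  have pk: "p powi k = exp (of_int k * lp)" for k
    by (simp flip: lp exp_power_int)
  obtain \<tau> where \<tau>: "\<And>a. a \<in> I \<Longrightarrow> - s a = exp (\<tau> a)" and \<tau>_sum: "(\<Sum>a\<in>I. \<tau> a) = lp"
    by (rule obtain_logs[of I s lp]) (use I s prod lp in auto)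
  have s_exp: "s a = - exp (\<tau> a)" if "a \<in> I" for a using \<tau>[OF that] by (metis minus_minus)
  define e where "e = (of_int \<epsilon> :: complex)"
  have ee: "e = 0 \<or> e = 1" using \<epsilon> by (auto simp: e_def)
  \<comment> \<open>A square root of p^\<epsilon>. It makes the arguments symmetric:
    \<open>V a * Z\<close> carries the index n a + m + \<epsilon>, \<open>V a / Z\<close> the index
    n a - m, and \<open>Z ^ 2\<close> the index 2 m + \<epsilon>.\<close>
  define \<sigma> where "\<sigma> = exp (e * lp / 2)"
  have \<sigma>2: "\<sigma> * \<sigma> = p powi \<epsilon>" by (simp add: \<sigma>_def pk e_def mult.commute flip: exp_add)
  define V where "V = (\<lambda>a. s a * p powi (n a) * \<sigma>)"
  have V0: "V a \<noteq> 0" if "a \<in> I" for a using s[OF that] p0 by (simp add: V_def \<sigma>_def)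
  have V1: "(\<Prod>a\<in>I. V a) = 1"
  proof -
    have "(\<Prod>a\<in>I. p powi (n a)) = p powi (\<Sum>a\<in>I. n a)"
      unfolding pk using I by (simp add: exp_sum sum_distrib_right)
    moreover have "\<sigma> ^ 6 = p powi (3 * \<epsilon>)"
      by (simp add: \<sigma>_def pk e_def mult_ac flip: exp_of_nat_mult)
    ultimately have "(\<Prod>a\<in>I. V a) = p * p powi (- 3 * \<epsilon> - 1) * p powi (3 * \<epsilon>)"
      unfolding V_def prod.distrib using I by (simp add: prod n)
    also have "\<dots> = p powi (1 + (- 3 * \<epsilon> - 1) + 3 * \<epsilon>)"
      using p0 power_int_add[of p "1 + (- 3 * \<epsilon> - 1)" "3 * \<epsilon>"] power_int_add[of p 1 "- 3 * \<epsilon> - 1"]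
      by (metis power_int_1_right)
    finally show ?thesis by simp
  qed
  define K where "K = I - {i, j}"
  have K: "finite K" "card K = 4" using I ij by (auto simp: K_def card_Diff_subset)
  have sumI: "(\<Sum>a\<in>I. g a) = g i + g j + (\<Sum>a\<in>K. g a)" for g :: "nat \<Rightarrow> 'z::comm_monoid_add"
  proof -
    have "(\<Sum>a\<in>I. g a) = g i + (\<Sum>a\<in>I - {i}. g a)" using I ij by (simp add: sum.remove)
    also have "(\<Sum>a\<in>I - {i}. g a) = g j + (\<Sum>a\<in>I - {i} - {j}. g a)"
      using I ij by (subst sum.remove[of _ j]) auto
    also have "I - {i} - {j} = K" by (auto simp: K_def)
    finally show ?thesis by (simp add: add_ac)
  qed
  define NK where "NK = (\<Sum>a\<in>K. n a)"
  have NK: "NK = - 3 * \<epsilon> - 1 - n i - n j" using n sumI[of n] by (simp add: NK_def)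
  define TK where "TK = (\<Sum>a\<in>K. \<tau> a)"
  have TK: "TK = lp - \<tau> i - \<tau> j" using \<tau>_sum sumI[of \<tau>] unfolding TK_def
    by (metis add_diff_cancel_left' diff_diff_eq)
  define quad where "quad = (\<lambda>a. of_int (n a) * \<tau> a + lp * (of_int (n a) * (of_int (n a) - 1) / 2))"
  define KK where "KK = (\<Sum>a\<in>K. quad a)"
  define ni where "ni = (of_int (n i) :: complex)"
  define nj where "nj = (of_int (n j) :: complex)"
  define sg where "sg = (- 1 :: complex) powi NK"
  define x where "x = (\<lambda>i. \<Prod>a\<in>K. rtheta r p (s i * s a) (n i + n a + \<epsilon>))"
  have x_eq: "x b = sg * exp (KK + (of_int (n b) + e) * TK + (of_int NK + 4 * (of_int (n b) + e)) * \<tau> b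
       + lp * ((of_int (n b) + e) * of_int NK + 4 * ((of_int (n b) + e) * (of_int (n b) + e - 1) / 2)))
       * (\<Prod>a\<in>K. th (p ^ r) (V b * V a))" if b: "b \<in> I" for b
  proof -
    have "x b = (\<Prod>a\<in>K. (-1) powi (n a + (n b + \<epsilon>)) * exp (of_int (n a + (n b + \<epsilon>)) * (\<tau> b + \<tau> a)
        + Ln p * (of_int (n a + (n b + \<epsilon>)) * (of_int (n a + (n b + \<epsilon>)) - 1) / 2)) * th (p ^ r) (V b * V a))"
      unfolding x_def
    proof (rule prod.cong)
      fix a assume "a \<in> K"
      hence a: "a \<in> I" by (simp add: K_def)
      have "s b * s a * p powi (n b + n a + \<epsilon>) = V b * V a"
      proof -
        have "p powi (n b + n a + \<epsilon>) = p powi n b * p powi n a * (\<sigma> * \<sigma>)"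
          unfolding \<sigma>2 using p0 by (simp add: power_int_add)
        thus ?thesis by (simp add: V_def mult_ac)
      qed
      moreover have "(- (s b * s a)) powi k = (- 1) powi k * exp (of_int k * (\<tau> b + \<tau> a))" for k
      proof -
        have "- (s b * s a) = (- 1) * exp (\<tau> b + \<tau> a)"
          by (simp add: s_exp a b exp_add)
        thus ?thesis by (simp only: power_int_mult_distrib exp_power_int)
      qed
      moreover have "p powi (k * (k - 1) div 2) = exp (Ln p * (of_int k * (of_int k - 1) / 2))" for k
        unfolding pk of_int_binomial2 by (simp add: lp_def mult.commute)
      ultimately show "rtheta r p (s b * s a) (n b + n a + \<epsilon>) = (-1) powi (n a + (n b + \<epsilon>)) *
         exp (of_int (n a + (n b + \<epsilon>)) * (\<tau> b + \<tau> a)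
        + Ln p * (of_int (n a + (n b + \<epsilon>)) * (of_int (n a + (n b + \<epsilon>)) - 1) / 2)) * th (p ^ r) (V b * V a)"
        unfolding rtheta_def by (simp add: exp_add mult_ac add_ac)
    qed auto
    also have "\<dots> = (\<Prod>a\<in>K. (-1) powi (n a + (n b + \<epsilon>))) *
      (\<Prod>a\<in>K. exp (of_int (n a + (n b + \<epsilon>)) * (\<tau> b + \<tau> a)
        + Ln p * (of_int (n a + (n b + \<epsilon>)) * (of_int (n a + (n b + \<epsilon>)) - 1) / 2))) * (\<Prod>a\<in>K. th (p ^ r) (V b * V a))"
      by (simp only: prod.distrib)
    also have "(\<Prod>a\<in>K. (-1) powi (n a + (n b + \<epsilon>))) = sg"
    proof -
      have "(\<Prod>a\<in>K. (-1 :: complex) powi (n a)) = sg"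
        unfolding sg_def NK_def using K(1)
        by (induction K rule: finite_induct) (auto simp: power_int_add)
      moreover have "((-1 :: complex) powi (n b + \<epsilon>)) ^ 4 = 1"
        by (cases "even (n b + \<epsilon>)") auto
      ultimately show ?thesis using K by (simp add: power_int_add prod.distrib power_mult_distrib)
    qed
    finally show ?thesis unfolding prod_exp_quadratic using K
      by (simp only: KK_def TK_def NK_def quad_def lp_def e_def of_int_add of_nat_numeral)
  qed
  \<comment> \<open>Found by solving the identity of exponents behind \<open>L1\<close>. That the
    same constant serves in \<open>L2\<close> is where the balancing enters, through
    \<open>TK\<close> and \<open>NK'\<close>.\<close>
  define c0 where "c0 = KK + (ni + e) * TK + (of_int NK + 4 * (ni + e)) * \<tau> i
       + lp * ((ni + e) * of_int NK + 4 * ((ni + e) * (ni + e - 1) / 2))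
       + (2 * nj + e) * \<tau> j + lp * (nj ^ 2 + nj * e - nj)
       + 2 * (\<tau> i + ni * lp + e * lp / 2) - quad i - quad j - KK + 2 * e * lp"
  define C0 where "C0 = sg * (- 1) powi \<epsilon> * exp c0"
  have C0: "C0 \<noteq> 0" by (simp add: C0_def sg_def)
  show ?thesis
  proof (rule that[of "C0 * th (p ^ r) (V j / V i)"])
    fix m :: int and z :: complex
    assume z: "z \<noteq> 0"
    define \<zeta> where "\<zeta> = Ln z"
    have \<zeta>: "exp \<zeta> = z" using z by (simp add: \<zeta>_def)
    define mm where "mm = (of_int m :: complex)"
    define Z where "Z = z * p powi m * \<sigma>"
    have Z_exp: "Z = exp (\<zeta> + (mm + e / 2) * lp)"
      by (simp add: Z_def \<sigma>_def pk mm_def \<zeta> exp_add algebra_simps)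
    hence Z0: "Z \<noteq> 0" by simp
    have VZ: "s a * z * p powi (n a + m + \<epsilon>) = V a * Z" for a
    proof -
      have "p powi (n a + m + \<epsilon>) = p powi n a * p powi m * (\<sigma> * \<sigma>)"
        unfolding \<sigma>2 using p0 by (simp add: power_int_add)
      thus ?thesis by (simp add: V_def Z_def mult_ac)
    qed
    have VZ': "s a / z * p powi (n a - m) = V a / Z" for a
      using p0 by (simp add: V_def Z_def \<sigma>_def power_int_diff)
    have ZZ: "z ^ 2 * p powi (2 * m + \<epsilon>) = Z ^ 2"
    proof -
      have "p powi (2 * m + \<epsilon>) = p powi (m + m + \<epsilon>)" by simp
      also have "\<dots> = p powi m * p powi m * (\<sigma> * \<sigma>)"
        unfolding \<sigma>2 using p0 power_int_add[of p "m + m" \<epsilon>] power_int_add[of p m m] by metis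
      finally show ?thesis by (simp add: Z_def power2_eq_square mult_ac)
    qed
    have rt1: "rtheta r p (s a * z) (n a + m + \<epsilon>) =
       exp (of_int (n a + (m + \<epsilon>)) * (\<zeta> + \<tau> a) + Ln p * (of_int (n a + (m + \<epsilon>)) * (of_int (n a + (m + \<epsilon>)) - 1) / 2))
        * th (p ^ r) (V a * Z)" if "a \<in> I" for a
    proof -
      have "- (s a * z) = exp (\<zeta> + \<tau> a)" by (simp add: s_exp that \<zeta> exp_add)
      from rtheta_exp[OF this, of "n a + m + \<epsilon>"] show ?thesis unfolding VZ by (simp add: add_ac)
    qed
    have rt2: "rtheta r p (s a / z) (n a - m) =
       exp (of_int (n a + (- m)) * (- \<zeta> + \<tau> a) + Ln p * (of_int (n a + (- m)) * (of_int (n a + (- m)) - 1) / 2))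
        * th (p ^ r) (V a / Z)" if "a \<in> I" for a
    proof -
      have "- (s a / z) = exp (- \<zeta> + \<tau> a)" by (simp add: s_exp that \<zeta> exp_diff)
      from rtheta_exp[OF this, of "n a - m"] show ?thesis unfolding VZ' by simp
    qed
    \<comment> \<open>Read off from the first product of six in \<open>U1\<close>. That the second
      product in \<open>U2\<close> yields the same exponent turns their difference into a multiple
      of \<open>th_alt\<close>.\<close>
    define E where "E = - \<zeta> + (quad i + quad j + KK) + (mm + e) * lp + (- 3 * e - 1 + 6 * (mm + e)) * \<zeta>
        + lp * ((mm + e) * (- 3 * e - 1) + 6 * ((mm + e) * (mm + e - 1) / 2)) + 3 * (\<zeta> + (mm + e / 2) * lp)"
    have quadI: "(\<Sum>a\<in>I. quad a) = quad i + quad j + KK" by (simp add: sumI KK_def)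
    have quadI': "(\<Sum>a\<in>I. of_int (n a) * \<tau> a + Ln p * (of_int (n a) * (of_int (n a) - 1) / 2)) = quad i + quad j + KK"
      using quadI by (simp only: quad_def lp_def)
    have nI: "of_int (\<Sum>a\<in>I. n a) = (- 3 * e - 1 :: complex)" by (simp add: n e_def)
    have "inverse z * (\<Prod>a\<in>I. rtheta r p (s a * z) (n a + m + \<epsilon>)) =
      exp (- \<zeta>) * exp ((quad i + quad j + KK) + (mm + e) * lp + (- 3 * e - 1 + 6 * (mm + e)) * \<zeta>
        + lp * ((mm + e) * (- 3 * e - 1) + 6 * ((mm + e) * (mm + e - 1) / 2))) * (\<Prod>a\<in>I. th (p ^ r) (V a * Z))"
    proof -
      have "(\<Prod>a\<in>I. rtheta r p (s a * z) (n a + m + \<epsilon>)) = (\<Prod>a\<in>I.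
         exp (of_int (n a + (m + \<epsilon>)) * (\<zeta> + \<tau> a) + Ln p * (of_int (n a + (m + \<epsilon>)) * (of_int (n a + (m + \<epsilon>)) - 1) / 2))
        * th (p ^ r) (V a * Z))" by (intro prod.cong rt1) auto
      thus ?thesis unfolding prod.distrib prod_exp_quadratic \<tau>_sum nI I(2) quadI'
        by (simp only: \<zeta> exp_minus mm_def e_def lp_def of_int_add of_nat_numeral mult.assoc)
    qed
    also have "\<dots> = exp E * (inverse (Z ^ 3) * (\<Prod>a\<in>I. th (p ^ r) (V a * Z)))"
    proof -
      have "Z ^ 3 = exp (3 * (\<zeta> + (mm + e / 2) * lp))"
        unfolding Z_exp by (simp flip: exp_of_nat_mult)
      hence "inverse (Z ^ 3) = exp (- (3 * (\<zeta> + (mm + e / 2) * lp)))"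
        by (simp only: exp_minus)
      thus ?thesis by (simp only: E_def mult.assoc[symmetric] exp_add[symmetric]) (simp add: algebra_simps)
    qed
    finally have U1: "inverse z * (\<Prod>a\<in>I. rtheta r p (s a * z) (n a + m + \<epsilon>)) =
        exp E * (inverse (Z ^ 3) * (\<Prod>a\<in>I. th (p ^ r) (V a * Z)))" .
    have "z ^ 3 * (\<Prod>a\<in>I. rtheta r p (s a / z) (n a - m)) =
      exp (3 * \<zeta>) * exp ((quad i + quad j + KK) + (- mm) * lp + (- 3 * e - 1 + 6 * (- mm)) * (- \<zeta>)
        + lp * ((- mm) * (- 3 * e - 1) + 6 * ((- mm) * (- mm - 1) / 2))) * (\<Prod>a\<in>I. th (p ^ r) (V a / Z))"
    proof -
      have "(\<Prod>a\<in>I. rtheta r p (s a / z) (n a - m)) = (\<Prod>a\<in>I.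
         exp (of_int (n a + (- m)) * (- \<zeta> + \<tau> a) + Ln p * (of_int (n a + (- m)) * (of_int (n a + (- m)) - 1) / 2))
        * th (p ^ r) (V a / Z))" by (intro prod.cong rt2) auto
      moreover have "exp (3 * \<zeta>) = z ^ 3" using \<zeta> exp_of_nat_mult[of 3 \<zeta>] by simp
      ultimately show ?thesis unfolding prod.distrib prod_exp_quadratic \<tau>_sum nI I(2) quadI'
        by (simp only: mm_def e_def lp_def of_int_add of_int_minus of_nat_numeral mult.assoc)
    qed
    also have "\<dots> = exp E * (Z ^ 3 * (\<Prod>a\<in>I. th (p ^ r) (V a / Z)))"
    proof -
      have Z3: "Z ^ 3 = exp (3 * (\<zeta> + (mm + e / 2) * lp))"
        unfolding Z_exp by (simp flip: exp_of_nat_mult)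
      have "3 * \<zeta> + ((quad i + quad j + KK) + (- mm) * lp + (- 3 * e - 1 + 6 * (- mm)) * (- \<zeta>)
        + lp * ((- mm) * (- 3 * e - 1) + 6 * ((- mm) * (- mm - 1) / 2))) = E + 3 * (\<zeta> + (mm + e / 2) * lp)"
        using ee by (elim disjE) (simp_all add: E_def field_simps)
      thus ?thesis unfolding Z3 by (simp only: mult.assoc[symmetric] exp_add[symmetric])
    qed
    finally have U2: "z ^ 3 * (\<Prod>a\<in>I. rtheta r p (s a / z) (n a - m)) =
        exp E * (Z ^ 3 * (\<Prod>a\<in>I. th (p ^ r) (V a / Z)))" .
    have R: "rtheta r p (z ^ 2) (2 * m + \<epsilon>) = (- 1) powi \<epsilon> *
        exp (2 * (2 * mm + e) * \<zeta> + lp * ((2 * mm + e) * (2 * mm + e - 1) / 2)) * th (p ^ r) (Z ^ 2)"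
    proof -
      have "(- (z ^ 2)) powi (2 * m + \<epsilon>) = ((- 1) * exp (2 * \<zeta>)) powi (2 * m + \<epsilon>)"
        using \<zeta> exp_of_nat_mult[of 2 \<zeta>] by simp
      also have "\<dots> = (- 1) powi \<epsilon> * exp (2 * (2 * mm + e) * \<zeta>)"
      proof -
        have "(- 1 :: complex) powi (2 * m) = 1" using power_int_mult[of "- 1 :: complex" 2 m] by simp
        hence "(- 1 :: complex) powi (2 * m + \<epsilon>) = (- 1) powi \<epsilon>"
          using power_int_add[of "- 1 :: complex" "2 * m" \<epsilon>] by simp
        moreover have "of_int (2 * m + \<epsilon>) * (2 * \<zeta>) = 2 * (2 * mm + e) * \<zeta>"
          by (simp add: mm_def e_def)
        ultimately show ?thesis unfolding power_int_mult_distrib exp_power_int by (simp only:)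
      qed
      moreover have "p powi (k * (k - 1) div 2) = exp (lp * (of_int k * (of_int k - 1) / 2))" for k
        unfolding pk of_int_binomial2 by (simp add: lp_def mult.commute)
      ultimately show ?thesis unfolding rtheta_def ZZ
        by (simp add: exp_add mm_def e_def)
    qed
    have pair: "rtheta r p (s b * z) (n b + m + \<epsilon>) * rtheta r p (s b / z) (n b - m) =
       exp ((2 * of_int (n b) + e) * \<tau> b + (2 * mm + e) * \<zeta>
         + lp * (of_int (n b) ^ 2 + of_int (n b) * e - of_int (n b) + mm ^ 2 + mm * e)) * th_pair (p ^ r) (V b) Z"
      if "b \<in> I" for b
    proof -
      have "(of_int (n b + (m + \<epsilon>)) * (\<zeta> + \<tau> b) + Ln p * (of_int (n b + (m + \<epsilon>)) * (of_int (n b + (m + \<epsilon>)) - 1) / 2))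
        + (of_int (n b + (- m)) * (- \<zeta> + \<tau> b) + Ln p * (of_int (n b + (- m)) * (of_int (n b + (- m)) - 1) / 2))
        = (2 * of_int (n b) + e) * \<tau> b + (2 * mm + e) * \<zeta>
         + lp * (of_int (n b) ^ 2 + of_int (n b) * e - of_int (n b) + mm ^ 2 + mm * e)"
        using ee unfolding of_int_add of_int_minus e_def[symmetric] mm_def[symmetric] lp_def[symmetric]
        by (elim disjE) (simp_all add: field_simps power2_eq_square)
      moreover have "(exp A * t1) * (exp B * t2) = exp (A + B) * (t1 * t2)" for A B t1 t2 :: complex
        by (simp add: exp_add mult_ac)
      ultimately show ?thesis unfolding rt1[OF that] rt2[OF that] th_pair_def by (simp only:)
    qed
    have Vi: "V i = - exp (\<tau> i + ni * lp + e * lp / 2)" and Vj: "V j = - exp (\<tau> j + nj * lp + e * lp / 2)"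
      by (simp_all add: V_def s_exp ij pk \<sigma>_def ni_def nj_def exp_add mult_ac)
    have L1: "rtheta r p (z ^ 2) (2 * m + \<epsilon>) * (x i * (rtheta r p (s j * z) (n j + m + \<epsilon>) * rtheta r p (s j / z) (n j - m)))
      = C0 * exp E * (th (p ^ r) (Z ^ 2) / Z * ((\<Prod>a\<in>K. th (p ^ r) (V i * V a)) / (V i) ^ 2 * th_pair (p ^ r) (V j) Z))"
    proof -
      have inv: "1 / (Z * V i ^ 2) = exp (- (\<zeta> + (mm + e / 2) * lp) - 2 * (\<tau> i + ni * lp + e * lp / 2))"
      proof -
        have "1 / (exp a * (- exp b) ^ 2) = exp (- a - 2 * b)" for a b :: complex
          using exp_of_nat_mult[of 2 b] by (simp add: exp_diff exp_minus divide_inverse)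
        thus ?thesis unfolding Z_exp Vi .
      qed
      have "2 * (2 * mm + e) * \<zeta> + lp * ((2 * mm + e) * (2 * mm + e - 1) / 2)
         + (KK + (ni + e) * TK + (of_int NK + 4 * (ni + e)) * \<tau> i
           + lp * ((ni + e) * of_int NK + 4 * ((ni + e) * (ni + e - 1) / 2)))
         + ((2 * nj + e) * \<tau> j + (2 * mm + e) * \<zeta> + lp * (nj ^ 2 + nj * e - nj + mm ^ 2 + mm * e))
         = c0 + E + (- (\<zeta> + (mm + e / 2) * lp) - 2 * (\<tau> i + ni * lp + e * lp / 2))"
        using ee unfolding c0_def E_def
        by (elim disjE) (simp_all add: field_simps power2_eq_square)
      hence "exp (2 * (2 * mm + e) * \<zeta> + lp * ((2 * mm + e) * (2 * mm + e - 1) / 2)) *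
         exp (KK + (ni + e) * TK + (of_int NK + 4 * (ni + e)) * \<tau> i
           + lp * ((ni + e) * of_int NK + 4 * ((ni + e) * (ni + e - 1) / 2))) *
         exp ((2 * nj + e) * \<tau> j + (2 * mm + e) * \<zeta> + lp * (nj ^ 2 + nj * e - nj + mm ^ 2 + mm * e))
         = exp c0 * exp E * (1 / (Z * V i ^ 2))"
        unfolding inv by (simp only: exp_add[symmetric])
      from arg_cong[OF this, of "\<lambda>y. sg * (- 1) powi \<epsilon> * th (p ^ r) (Z ^ 2) * (\<Prod>a\<in>K. th (p ^ r) (V i * V a)) * th_pair (p ^ r) (V j) Z * y"]
      show ?thesis unfolding R x_eq[OF ij(1)] pair[OF ij(2)] C0_def ni_def[symmetric] nj_def[symmetric]
        by (simp add: mult_ac)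
    qed
    have L2: "rtheta r p (z ^ 2) (2 * m + \<epsilon>) * (x j * (rtheta r p (s i * z) (n i + m + \<epsilon>) * rtheta r p (s i / z) (n i - m)))
      = C0 * exp E * (th (p ^ r) (Z ^ 2) / Z * ((\<Prod>a\<in>K. th (p ^ r) (V j * V a)) / (V i * V j) * th_pair (p ^ r) (V i) Z))"
    proof -
      have inv: "1 / (Z * (V i * V j)) = exp (- (\<zeta> + (mm + e / 2) * lp) - (\<tau> i + ni * lp + e * lp / 2) - (\<tau> j + nj * lp + e * lp / 2))"
      proof -
        have "1 / (exp a * (- exp b * - exp c)) = exp (- a - b - c)" for a b c :: complex
          by (simp add: exp_diff exp_minus divide_inverse)
        thus ?thesis unfolding Z_exp Vi Vj .
      qed
      have NK': "of_int NK = - 3 * e - 1 - ni - nj" by (simp add: NK e_def ni_def nj_def)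
      have "2 * (2 * mm + e) * \<zeta> + lp * ((2 * mm + e) * (2 * mm + e - 1) / 2)
         + (KK + (nj + e) * TK + (of_int NK + 4 * (nj + e)) * \<tau> j
           + lp * ((nj + e) * of_int NK + 4 * ((nj + e) * (nj + e - 1) / 2)))
         + ((2 * ni + e) * \<tau> i + (2 * mm + e) * \<zeta> + lp * (ni ^ 2 + ni * e - ni + mm ^ 2 + mm * e))
         = c0 + E + (- (\<zeta> + (mm + e / 2) * lp) - (\<tau> i + ni * lp + e * lp / 2) - (\<tau> j + nj * lp + e * lp / 2))"
        using ee unfolding c0_def E_def TK NK'
        by (elim disjE) (simp_all add: field_simps power2_eq_square)
      hence "exp (2 * (2 * mm + e) * \<zeta> + lp * ((2 * mm + e) * (2 * mm + e - 1) / 2)) *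
         exp (KK + (nj + e) * TK + (of_int NK + 4 * (nj + e)) * \<tau> j
           + lp * ((nj + e) * of_int NK + 4 * ((nj + e) * (nj + e - 1) / 2))) *
         exp ((2 * ni + e) * \<tau> i + (2 * mm + e) * \<zeta> + lp * (ni ^ 2 + ni * e - ni + mm ^ 2 + mm * e))
         = exp c0 * exp E * (1 / (Z * (V i * V j)))"
        unfolding inv by (simp only: exp_add[symmetric])
      from arg_cong[OF this, of "\<lambda>y. sg * (- 1) powi \<epsilon> * th (p ^ r) (Z ^ 2) * (\<Prod>a\<in>K. th (p ^ r) (V j * V a)) * th_pair (p ^ r) (V i) Z * y"]
      show ?thesis unfolding R x_eq[OF ij(2)] pair[OF ij(1)] C0_def ni_def[symmetric] nj_def[symmetric]
        by (simp add: mult_ac)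
    qed
    have "th_defect (p ^ r) I i j V Z = 0"
      by (rule th_defect_eq_0[OF P1 P0 I ij V0 V1 Z0])
    hence "th (p ^ r) (V j / V i) * th_alt (p ^ r) I V Z = th (p ^ r) (Z ^ 2) / Z * ((\<Prod>a\<in>K. th (p ^ r) (V i * V a)) / (V i) ^ 2 * th_pair (p ^ r) (V j) Z)
       - th (p ^ r) (Z ^ 2) / Z * ((\<Prod>a\<in>K. th (p ^ r) (V j * V a)) / (V i * V j) * th_pair (p ^ r) (V i) Z)"
      unfolding th_defect_def K_def by (simp add: right_diff_distrib)
    from arg_cong[OF this, of "\<lambda>y. C0 * exp E * y"]
    show "rtheta r p (z ^ 2) (2 * m + \<epsilon>) *
      ((\<Prod>a\<in>I - {i, j}. rtheta r p (s i * s a) (n i + n a + \<epsilon>)) * (rtheta r p (s j * z) (n j + m + \<epsilon>) * rtheta r p (s j / z) (n j - m))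
     - (\<Prod>a\<in>I - {i, j}. rtheta r p (s j * s a) (n j + n a + \<epsilon>)) * (rtheta r p (s i * z) (n i + m + \<epsilon>) * rtheta r p (s i / z) (n i - m)))
    = C0 * th (p ^ r) (V j / V i) * (inverse z * (\<Prod>a\<in>I. rtheta r p (s a * z) (n a + m + \<epsilon>)) - z ^ 3 * (\<Prod>a\<in>I. rtheta r p (s a / z) (n a - m)))"
      using L1 L2 unfolding U1 U2 x_def K_def th_alt_def
      by (simp only: right_diff_distrib mult_ac)
  qed
qed

end

definition pair_prod :: "nat set \<Rightarrow> (nat \<Rightarrow> nat \<Rightarrow> complex) \<Rightarrow> complex" where
  "pair_prod A g = (\<Prod>a\<in>A. \<Prod>b\<in>{b\<in>A. a < b}. g a b)"

text \<open>As g is symmetric, the order of the index set does not matter: any element can be split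
  off, not only the least.\<close>

lemma pair_prod_insert:
  assumes A: "finite A" "x \<notin> A" and sym: "\<And>a b. g a b = g b a"
  shows "pair_prod (insert x A) g = (\<Prod>a\<in>A. g x a) * pair_prod A g"
proof -
  have 1: "(\<Prod>b\<in>{b\<in>insert x A. x < b}. g x b) = (\<Prod>a\<in>A. if x < a then g x a else 1)"
  proof -
    have "{b\<in>insert x A. x < b} = {b\<in>A. x < b}" by auto
    thus ?thesis using A by (simp add: prod.If_cases Int_def)
  qed
  have 2: "(\<Prod>b\<in>{b\<in>insert x A. a < b}. g a b) = (if a < x then g a x else 1) * (\<Prod>b\<in>{b\<in>A. a < b}. g a b)"
    if "a \<in> A" for a
  proof (cases "a < x")
    case True
    hence "{b\<in>insert x A. a < b} = insert x {b\<in>A. a < b}" by auto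
    thus ?thesis using A True by simp
  next
    case False
    hence "{b\<in>insert x A. a < b} = {b\<in>A. a < b}" by auto
    thus ?thesis using False by simp
  qed
  have 3: "(\<Prod>a\<in>A. if x < a then g x a else 1) * (\<Prod>a\<in>A. if a < x then g a x else 1) = (\<Prod>a\<in>A. g x a)"
    unfolding prod.distrib[symmetric] by (intro prod.cong) (use A sym in \<open>auto simp: not_less\<close>)
  have "pair_prod (insert x A) g = (\<Prod>b\<in>{b\<in>insert x A. x < b}. g x b) *
      (\<Prod>a\<in>A. (\<Prod>b\<in>{b\<in>insert x A. a < b}. g a b))"
    using A by (simp add: pair_prod_def)
  also have "(\<Prod>a\<in>A. (\<Prod>b\<in>{b\<in>insert x A. a < b}. g a b)) =
     (\<Prod>a\<in>A. if a < x then g a x else 1) * pair_prod A g"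
    unfolding pair_prod_def prod.distrib[symmetric] by (intro prod.cong 2) auto
  finally show ?thesis unfolding 1 using 3 by (simp add: mult.assoc[symmetric])
qed

lemma pair_prod_split2:
  assumes "finite A" "i \<in> A" "j \<in> A" "i \<noteq> j" and sym: "\<And>a b. g a b = g b a"
  shows "pair_prod A g = g i j * (\<Prod>a\<in>A - {i, j}. g i a * g j a) * pair_prod (A - {i, j}) g"
proof -
  define K where "K = A - {i, j}"
  have K: "finite K" "i \<notin> insert j K" "j \<notin> K" using assms by (auto simp: K_def)
  have A: "A = insert i (insert j K)" using assms by (auto simp: K_def)
  have "pair_prod A g = (g i j * (\<Prod>a\<in>K. g i a)) * ((\<Prod>a\<in>K. g j a) * pair_prod K g)"
    unfolding A using K sym by (simp add: pair_prod_insert)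
  thus ?thesis by (simp add: K_def prod.distrib mult_ac)
qed

lemma norm_prod_less_1:
  fixes f :: "'a \<Rightarrow> complex"
  assumes "finite A" "A \<noteq> {}" "\<And>a. a \<in> A \<Longrightarrow> norm (f a) < 1"
  shows "norm (\<Prod>a\<in>A. f a) < 1"
  using assms
proof (induction A rule: finite_ne_induct)
  case (insert x F)
  have "norm (f x) * norm (prod f F) < 1 * 1"
    using insert by (intro mult_strict_mono') auto
  thus ?case using insert by (simp add: norm_mult)
qed auto

context rarefied
begin

text \<open>The dependence on w of the two theta multipliers cancels, because their indices move in
  opposite directions.\<close>

lemma weyl_shift_r:
  assumes w: "w \<noteq> 0"
  shows "weyl w (M + int r) = exp ((of_nat r - 1) * (Ln p + Ln q) * (of_int M + of_nat r / 2)) * weyl w M"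
proof -
  interpret sw: rarefied r q p by (rule swap)
  obtain u where u: "w = - exp u" using minus_exp_cases[OF w] .
  have u1: "- w = exp u" and u2: "- (q * w) = exp (u + Ln q)" using q0 by (simp_all add: u exp_add)
  define k where "k = - (M + int r) - 1"
  have "rtheta r q (q * w) (- M - 1) = rtheta r q (q * w) (k + int r)" by (simp add: k_def)
  also have "\<dots> = exp ((of_nat r - 1) * (u + Ln q + Ln q * (of_int k + of_nat r / 2))) * rtheta r q (q * w) k"
    by (rule sw.rtheta_shift_r[OF u2])
  finally have "rtheta r q (q * w) k = exp (- ((of_nat r - 1) * (u + Ln q + Ln q * (of_int k + of_nat r / 2)))) * rtheta r q (q * w) (- M - 1)"
    by (simp add: exp_minus)
  moreover have "(of_nat r - 1) * (u + Ln p * (of_int M + of_nat r / 2)) + - ((of_nat r - 1) * (u + Ln q + Ln q * (of_int k + of_nat r / 2)))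
     = (of_nat r - 1) * (Ln p + Ln q) * (of_int M + of_nat r / 2)"
    by (simp add: k_def field_simps)
  moreover have "(exp a * t1) * (exp b * t2) = exp (a + b) * (t1 * t2)" for a b t1 t2 :: complex
    by (simp add: exp_add mult_ac)
  ultimately show ?thesis
    unfolding weyl_def rtheta_shift_r[OF u1] k_def[symmetric] by (simp only:)
qed

lemma rgamma_pair_shift:
  "rgamma r p q (- exp v) (k + int r) * rgamma r p q (- exp w) (l - int r) =
   exp (psi v k - psi w (l - int r)) * (rgamma r p q (- exp v) k * rgamma r p q (- exp w) l)"
proof -
  have "rgamma r p q (- exp w) l = exp (psi w (l - int r)) * rgamma r p q (- exp w) (l - int r)"
    using rgamma_shift_r[of w "l - int r"] by simp
  thus ?thesis unfolding rgamma_shift_r by (simp add: exp_diff)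
qed

text \<open>The index moves by 2 since M stands for 2 m + \<epsilon> and m is lowered by 1 when z is
  divided by q.\<close>

lemma rtheta_q_shift2:
  assumes z: "z \<noteq> 0"
  shows "rtheta r q (q * (z / q) ^ 2) (- M + 1) = z ^ 4 / q * rtheta r q (q * z ^ 2) (- M - 1)"
proof -
  interpret sw: rarefied r q p by (rule swap)
  obtain u where u: "q * z ^ 2 = - exp u" using minus_exp_cases[of "q * z ^ 2"] z q0 by auto
  have u1: "- (q * z ^ 2) = exp u" by (simp add: u)
  have lq: "exp (2 * Ln q) = q ^ 2" using q0 exp_of_nat_mult[of 2 "Ln q"] by simp
  have "- (q * (z / q) ^ 2) = - (q * z ^ 2) / q ^ 2" by (simp add: power_divide)
  also have "\<dots> = exp (u - 2 * Ln q)" unfolding u1 exp_diff lq ..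
  finally have u2: "- (q * (z / q) ^ 2) = exp (u - 2 * Ln q)" .
  have z4: "z ^ 4 / q = exp (2 * u - 3 * Ln q)"
  proof -
    have "z ^ 4 / q = (- (q * z ^ 2)) ^ 2 / q ^ 3"
      using q0 by (simp add: field_simps power2_eq_square eval_nat_numeral)
    also have "\<dots> = exp (2 * u - 3 * Ln q)"
      unfolding u1 exp_diff using q0 exp_of_nat_mult[of 3 "Ln q"] exp_of_nat_mult[of 2 u] by simp
    finally show ?thesis .
  qed
  have arg: "q * (z / q) ^ 2 * q powi (- M + 1) = q * z ^ 2 * q powi (- M - 1)"
    using q0 by (simp add: power_int_add power_int_diff power_int_minus power2_eq_square field_simps)
  have e: "of_int (- M + 1) * (u - 2 * Ln q) + Ln q * (of_int (- M + 1) * (of_int (- M + 1) - 1) / 2) =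
      2 * u - 3 * Ln q + (of_int (- M - 1) * u + Ln q * (of_int (- M - 1) * (of_int (- M - 1) - 1) / 2))"
    by (simp add: field_simps)
  show ?thesis
    unfolding sw.rtheta_exp[OF u2] sw.rtheta_exp[OF u1] arg z4 e
    by (simp only: exp_add[of "2 * u - 3 * Ln q"] mult.assoc)
qed

end

section \<open>The integrand, the two sides of the formula, and their periodicity in the
  integers\<close>

context rarefied_params
begin

definition adm :: "(nat \<Rightarrow> complex) \<Rightarrow> (nat \<Rightarrow> int) \<Rightarrow> bool" where
  "adm t n \<longleftrightarrow> (\<forall>a\<in>I. t a \<noteq> 0 \<and> norm (t a) < 1) \<and> (\<Prod>a\<in>I. t a) = p * q \<and> (\<Sum>a\<in>I. n a) + 3 * \<epsilon> = 0"

text \<open>The integrand with its denominator replaced by \<open>weyl\<close>; for parameters in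
  the punctured unit disc this expression is continuous on the circle.\<close>

definition \<Delta> :: "(nat \<Rightarrow> complex) \<Rightarrow> (nat \<Rightarrow> int) \<Rightarrow> int \<Rightarrow> complex \<Rightarrow> complex" where
  "\<Delta> t n m z = (\<Prod>a\<in>I. rgamma r p q (t a * z) (n a + m + \<epsilon>) * rgamma r p q (t a / z) (n a - m))
     * weyl (z ^ 2) (2 * m + \<epsilon>)"

definition J :: "(nat \<Rightarrow> complex) \<Rightarrow> (nat \<Rightarrow> int) \<Rightarrow> complex" where
  "J t n = (\<Sum>m<r. avg (\<Delta> t n (int m)))"

definition R :: "(nat \<Rightarrow> complex) \<Rightarrow> (nat \<Rightarrow> int) \<Rightarrow> complex" where
  "R t n = pair_prod I (\<lambda>a b. rgamma r p q (t a * t b) (n a + n b + \<epsilon>))"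

lemma R_split2:
  assumes "i \<in> I" "j \<in> I" "i \<noteq> j"
  shows "R t n = rgamma r p q (t i * t j) (n i + n j + \<epsilon>)
    * (\<Prod>a\<in>I - {i, j}. rgamma r p q (t i * t a) (n i + n a + \<epsilon>) * rgamma r p q (t j * t a) (n j + n a + \<epsilon>))
    * pair_prod (I - {i, j}) (\<lambda>a b. rgamma r p q (t a * t b) (n a + n b + \<epsilon>))"
  unfolding R_def by (rule pair_prod_split2[OF I(1) assms]) (simp add: mult.commute add_ac)

lemma sum_split2:
  fixes g :: "nat \<Rightarrow> 'z::ab_group_add"
  assumes "i \<in> I" "j \<in> I" "i \<noteq> j"
  shows "(\<Sum>a\<in>I. g a) = g i + g j + (\<Sum>a\<in>I - {i, j}. g a)"
proof -
  have "(\<Sum>a\<in>I. g a) = g i + (\<Sum>a\<in>I - {i}. g a)" using I assms by (simp add: sum.remove)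
  also have "(\<Sum>a\<in>I - {i}. g a) = g j + (\<Sum>a\<in>I - {i} - {j}. g a)"
    using I assms by (subst sum.remove[of _ j]) auto
  also have "I - {i} - {j} = I - {i, j}" by auto
  finally show ?thesis by (simp add: add_ac)
qed

lemmas prod_split2' = prod_split2[OF P1 P0 I]

text \<open>The remaining four parameters have a product of modulus less than 1. The bounds place t
  i t j in the annulus where \<open>rgamma\<close> has neither zeros nor poles.\<close>

lemma adm_pair_norm:
  assumes adm: "adm t n" and ij: "i \<in> I" "j \<in> I" "i \<noteq> j"
  shows "norm (p * q) < norm (t i * t j)" "norm (t i * t j) < 1"
proof -
  have t: "\<And>a. a \<in> I \<Longrightarrow> t a \<noteq> 0" "\<And>a. a \<in> I \<Longrightarrow> norm (t a) < 1" using adm by (auto simp: adm_def)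
  have "card (I - {i, j}) = 4" using I ij by (auto simp: card_Diff_subset)
  hence "I - {i, j} \<noteq> {}" by (metis card.empty zero_neq_numeral)
  hence "norm (\<Prod>a\<in>I - {i, j}. t a) < 1" using I t by (intro norm_prod_less_1) auto
  moreover have "p * q = t i * t j * (\<Prod>a\<in>I - {i, j}. t a)"
    using prod_split2'[OF ij, of t] adm by (simp add: adm_def)
  hence "norm (p * q) = norm (t i * t j) * norm (\<Prod>a\<in>I - {i, j}. t a)" by (simp add: norm_mult)
  moreover have "norm (t i * t j) > 0" using t ij by simp
  ultimately show "norm (p * q) < norm (t i * t j)" by (simp add: mult_less_cancel_left1)
  have "norm (t i) * norm (t j) < 1 * 1" using t ij by (intro mult_strict_mono') auto
  thus "norm (t i * t j) < 1" by (simp add: norm_mult)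
qed

lemma R_nonzero:
  assumes adm: "adm t n"
  shows "R t n \<noteq> 0"
proof -
  have "rgamma r p q (t a * t b) (n a + n b + \<epsilon>) \<noteq> 0" if "a \<in> I" "b \<in> I" "a < b" for a b
    using adm_pair_norm[OF adm that(1,2)] that by (intro rgamma_nonzero) auto
  thus ?thesis unfolding R_def pair_prod_def using I by (auto simp: prod_zero_iff)
qed

lemma continuous_on_rgamma:
  assumes "continuous_on A f" "\<And>z. z \<in> A \<Longrightarrow> f z \<noteq> 0 \<and> norm (f z) < 1"
  shows "continuous_on A (\<lambda>z. rgamma r p q (f z) m)"
proof -
  have "continuous_on {z. z \<noteq> 0 \<and> norm z < 1} (\<lambda>z. rgamma r p q z m)"
    by (intro continuous_at_imp_continuous_on) (auto intro: isCont_rgamma)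
  thus ?thesis by (rule continuous_on_compose2) (use assms in auto)
qed

lemma continuous_on_weyl:
  assumes "continuous_on A f" "\<And>z. z \<in> A \<Longrightarrow> f z \<noteq> 0"
  shows "continuous_on A (\<lambda>z. weyl (f z) m)"
proof -
  have "continuous_on (-{0}) (\<lambda>z. weyl z m)"
    by (intro continuous_at_imp_continuous_on) (auto intro: analytic_at_imp_isCont weyl_analytic)
  thus ?thesis by (rule continuous_on_compose2) (use assms in auto)
qed

lemma \<Delta>_continuous:
  assumes "\<And>a. a \<in> I \<Longrightarrow> t a \<noteq> 0 \<and> norm (t a) < 1"
  shows "continuous_on (sphere 0 1) (\<Delta> t n m)"
  unfolding \<Delta>_def
  by (intro continuous_intros continuous_on_rgamma continuous_on_weyl)
     (use assms in \<open>auto simp: norm_mult norm_divide\<close>)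

text \<open>In each pair one index goes up by r and the other down. In the difference of the two
  exponents the terms quadratic in n a and the products of n a and \<tau> a cancel, so the total
  depends only on the sums of \<tau> and n. This serves both for \<open>\<Delta>\<close> and for
  \<open>Gf\<close>.\<close>

lemma prod_pair_shift:
  assumes t1: "\<And>a. a \<in> I \<Longrightarrow> t1 a = - exp (\<alpha> + \<tau> a)" and t2: "\<And>a. a \<in> I \<Longrightarrow> t2 a = - exp (\<beta> + \<tau> a)"
  shows "(\<Prod>a\<in>I. rgamma r p q (t1 a) (n a + d1 + int r) * rgamma r p q (t2 a) (n a + d2 - int r)) =
    exp ((of_nat r - 1) * ((\<Sum>a\<in>I. \<tau> a) * (of_int d1 - of_int d2 + of_nat r) + of_int (\<Sum>a\<in>I. n a) * (\<alpha> - \<beta>)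
      + 6 * (\<alpha> * (of_int d1 + of_nat r / 2) - \<beta> * (of_int d2 - of_nat r / 2))
      + Ln p * (of_int d1 - of_int d2 + of_nat r) * (2 * of_int (\<Sum>a\<in>I. n a) + 6 * (of_int d1 + of_int d2 - 1)) / 2
      - Ln q * (of_int d1 - of_int d2 + of_nat r) * (2 * of_int (\<Sum>a\<in>I. n a) + 6 * (of_int d1 + of_int d2 + 1)) / 2))
    * (\<Prod>a\<in>I. rgamma r p q (t1 a) (n a + d1) * rgamma r p q (t2 a) (n a + d2))"
proof -
  define D where "D = (of_int d1 - of_int d2 + of_nat r :: complex)"
  define c where "c = \<alpha> * (of_int d1 + of_nat r / 2) - \<beta> * (of_int d2 - of_nat r / 2)
     + Ln p * D * (of_int d1 + of_int d2 - 1) / 2 - Ln q * D * (of_int d1 + of_int d2 + 1) / 2"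
  define X where "X = (\<lambda>a. (of_nat r - 1) * (\<tau> a * D + of_int (n a) * (\<alpha> - \<beta> + Ln p * D - Ln q * D) + c))"
  have "rgamma r p q (t1 a) (n a + d1 + int r) * rgamma r p q (t2 a) (n a + d2 - int r) =
     exp (X a) * (rgamma r p q (t1 a) (n a + d1) * rgamma r p q (t2 a) (n a + d2))" if "a \<in> I" for a
  proof -
    have "psi (\<alpha> + \<tau> a) (n a + d1) - psi (\<beta> + \<tau> a) (n a + d2 - int r) = X a"
      unfolding psi_def X_def c_def D_def by (simp add: field_simps power2_eq_square)
    thus ?thesis unfolding t1[OF that] t2[OF that] rgamma_pair_shift by simp
  qed
  hence "(\<Prod>a\<in>I. rgamma r p q (t1 a) (n a + d1 + int r) * rgamma r p q (t2 a) (n a + d2 - int r)) =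
    exp (\<Sum>a\<in>I. X a) * (\<Prod>a\<in>I. rgamma r p q (t1 a) (n a + d1) * rgamma r p q (t2 a) (n a + d2))"
    using I by (simp add: prod.distrib exp_sum)
  also have "(\<Sum>a\<in>I. X a) = (of_nat r - 1) * ((\<Sum>a\<in>I. \<tau> a) * D + of_int (\<Sum>a\<in>I. n a) * (\<alpha> - \<beta> + Ln p * D - Ln q * D) + 6 * c)"
    unfolding X_def sum_distrib_left[symmetric] sum.distrib sum_distrib_right[symmetric] using I by simp
  also have "\<dots> = (of_nat r - 1) * ((\<Sum>a\<in>I. \<tau> a) * D + of_int (\<Sum>a\<in>I. n a) * (\<alpha> - \<beta>)
      + 6 * (\<alpha> * (of_int d1 + of_nat r / 2) - \<beta> * (of_int d2 - of_nat r / 2))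
      + Ln p * D * (2 * of_int (\<Sum>a\<in>I. n a) + 6 * (of_int d1 + of_int d2 - 1)) / 2
      - Ln q * D * (2 * of_int (\<Sum>a\<in>I. n a) + 6 * (of_int d1 + of_int d2 + 1)) / 2)"
    unfolding c_def by (simp add: field_simps)
  finally show ?thesis by (simp only: D_def)
qed

text \<open>The index of \<open>weyl\<close> moves by 2 r, so its shift applies twice. By the
  balancing conditions the resulting factor is the inverse of the one from the six pairs of gamma
  functions.\<close>

lemma \<Delta>_periodic:
  assumes adm: "adm t n" and z: "z \<noteq> 0"
  shows "\<Delta> t n (m + int r) z = \<Delta> t n m z"
proof -
  have t: "\<And>a. a \<in> I \<Longrightarrow> t a \<noteq> 0" and tp: "(\<Prod>a\<in>I. t a) = p * q" and n: "(\<Sum>a\<in>I. n a) = - 3 * \<epsilon>"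
    using adm by (auto simp: adm_def)
  obtain \<tau> where \<tau>: "\<And>a. a \<in> I \<Longrightarrow> - t a = exp (\<tau> a)" and \<tau>_sum: "(\<Sum>a\<in>I. \<tau> a) = Ln p + Ln q"
    by (rule obtain_logs[of I t "Ln p + Ln q"]) (use I t tp p0 q0 in \<open>auto simp: exp_add\<close>)
  define \<zeta> where "\<zeta> = Ln z"
  have \<zeta>: "z = exp \<zeta>" using z by (simp add: \<zeta>_def)
  have t1: "t a * z = - exp (\<zeta> + \<tau> a)" and t2: "t a / z = - exp (- \<zeta> + \<tau> a)" if "a \<in> I" for a
    using \<tau>[OF that, symmetric] by (simp_all add: \<zeta> exp_add exp_diff)
  define e where "e = (of_int \<epsilon> :: complex)"
  define mm where "mm = (of_int m :: complex)"
  have z2: "z ^ 2 \<noteq> 0" using z by simp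
  have "weyl (z ^ 2) (2 * (m + int r) + \<epsilon>) = weyl (z ^ 2) ((2 * m + \<epsilon> + int r) + int r)"
    by (simp add: algebra_simps)
  also have "\<dots> = exp ((of_nat r - 1) * (Ln p + Ln q) * ((2 * mm + e + of_nat r) + of_nat r / 2))
      * (exp ((of_nat r - 1) * (Ln p + Ln q) * ((2 * mm + e) + of_nat r / 2)) * weyl (z ^ 2) (2 * m + \<epsilon>))"
    unfolding weyl_shift_r[OF z2] by (simp add: mm_def e_def)
  finally have W0: "weyl (z ^ 2) (2 * (m + int r) + \<epsilon>) = exp ((of_nat r - 1) * (Ln p + Ln q) * ((2 * mm + e + of_nat r) + of_nat r / 2))
      * (exp ((of_nat r - 1) * (Ln p + Ln q) * ((2 * mm + e) + of_nat r / 2)) * weyl (z ^ 2) (2 * m + \<epsilon>))" .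
  have W: "weyl (z ^ 2) (2 * (m + int r) + \<epsilon>) = exp ((of_nat r - 1) * (Ln p + Ln q) * (4 * mm + 2 * e + 2 * of_nat r)) * weyl (z ^ 2) (2 * m + \<epsilon>)"
  proof -
    have "exp a * (exp b * t) = exp (a + b) * t" for a b t :: complex by (simp add: exp_add)
    moreover have "(of_nat r - 1) * (Ln p + Ln q) * ((2 * mm + e + of_nat r) + of_nat r / 2)
       + (of_nat r - 1) * (Ln p + Ln q) * ((2 * mm + e) + of_nat r / 2)
       = (of_nat r - 1) * (Ln p + Ln q) * (4 * mm + 2 * e + 2 * of_nat r)" by (simp add: field_simps)
    ultimately show ?thesis using W0 by (simp only:)
  qed
  have G: "(\<Prod>a\<in>I. rgamma r p q (t a * z) (n a + (m + int r) + \<epsilon>) * rgamma r p q (t a / z) (n a - (m + int r)))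
     = (\<Prod>a\<in>I. rgamma r p q (t a * z) (n a + (m + \<epsilon>) + int r) * rgamma r p q (t a / z) (n a + (- m) - int r))"
    by (intro prod.cong) (simp_all add: algebra_simps)
  have S: "(of_nat r - 1) * ((Ln p + Ln q) * (of_int (m + \<epsilon>) - of_int (- m) + of_nat r) + of_int (- 3 * \<epsilon>) * (\<zeta> - - \<zeta>)
      + 6 * (\<zeta> * (of_int (m + \<epsilon>) + of_nat r / 2) - - \<zeta> * (of_int (- m) - of_nat r / 2))
      + Ln p * (of_int (m + \<epsilon>) - of_int (- m) + of_nat r) * (2 * of_int (- 3 * \<epsilon>) + 6 * (of_int (m + \<epsilon>) + of_int (- m) - 1)) / 2
      - Ln q * (of_int (m + \<epsilon>) - of_int (- m) + of_nat r) * (2 * of_int (- 3 * \<epsilon>) + 6 * (of_int (m + \<epsilon>) + of_int (- m) + 1)) / 2)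
     = - ((of_nat r - 1) * (Ln p + Ln q) * (4 * mm + 2 * e + 2 * of_nat r))"
    unfolding of_int_add of_int_minus of_int_mult e_def[symmetric] mm_def[symmetric] by (simp add: field_simps)
  have "\<Delta> t n (m + int r) z = exp (- ((of_nat r - 1) * (Ln p + Ln q) * (4 * mm + 2 * e + 2 * of_nat r)))
     * (\<Prod>a\<in>I. rgamma r p q (t a * z) (n a + (m + \<epsilon>)) * rgamma r p q (t a / z) (n a + (- m)))
     * (exp ((of_nat r - 1) * (Ln p + Ln q) * (4 * mm + 2 * e + 2 * of_nat r)) * weyl (z ^ 2) (2 * m + \<epsilon>))"
    unfolding \<Delta>_def W G
    using prod_pair_shift[where n = n and ?d1.0 = "m + \<epsilon>" and ?d2.0 = "- m" and ?t1.0 = "\<lambda>a. t a * z"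
      and ?t2.0 = "\<lambda>a. t a / z" and \<tau> = \<tau> and \<alpha> = \<zeta> and \<beta> = "- \<zeta>", OF t1 t2] unfolding \<tau>_sum n S by (simp only:)
  thus ?thesis by (simp add: \<Delta>_def exp_minus add.assoc)
qed

text \<open>The shift $(z, m) \mapsto (z/q, m - 1)$ exchanges the two products of six theta functions
  in the addition formula; up to a common factor they are $G_m(z)$ and $G_{m-1}(z/q)$.\<close>

definition Gf :: "(nat \<Rightarrow> complex) \<Rightarrow> (nat \<Rightarrow> int) \<Rightarrow> int \<Rightarrow> complex \<Rightarrow> complex" where
  "Gf s n m z = inverse z * rtheta r q (q * z ^ 2) (- (2 * m + \<epsilon>) - 1)
     * (\<Prod>a\<in>I. rgamma r p q (q * s a * z) (n a + m + \<epsilon> + 1) * rgamma r p q (s a / z) (n a - m))"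

lemma Gf_periodic:
  assumes s: "\<And>a. a \<in> I \<Longrightarrow> s a \<noteq> 0" and sp: "(\<Prod>a\<in>I. s a) = p" and n: "(\<Sum>a\<in>I. n a) = - 3 * \<epsilon> - 1"
    and z: "z \<noteq> 0"
  shows "Gf s n (m + int r) z = Gf s n m z"
proof -
  interpret sw: rarefied r q p by (rule swap)
  obtain \<tau> where \<tau>: "\<And>a. a \<in> I \<Longrightarrow> - s a = exp (\<tau> a)" and \<tau>_sum: "(\<Sum>a\<in>I. \<tau> a) = Ln p"
    by (rule obtain_logs[of I s "Ln p"]) (use I s sp p0 in auto)
  define \<zeta> where "\<zeta> = Ln z"
  have \<zeta>: "z = exp \<zeta>" using z by (simp add: \<zeta>_def)
  have t1: "q * s a * z = - exp (\<zeta> + Ln q + \<tau> a)" and t2: "s a / z = - exp (- \<zeta> + \<tau> a)" if "a \<in> I" for a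
    using \<tau>[OF that, symmetric] q0 by (simp_all add: \<zeta> exp_add exp_diff)
  define e where "e = (of_int \<epsilon> :: complex)"
  define mm where "mm = (of_int m :: complex)"
  \<comment> \<open>The summand pi i absorbs the minus sign. Over the two shifts by r it adds (r -
    1) 2 pi i to the exponent, which the exponential does not see.\<close>
  define u where "u = Ln q + 2 * \<zeta> + of_real pi * \<i>"
  have u: "- (q * z ^ 2) = exp u"
    using q0 exp_of_nat_mult[of 2 \<zeta>] by (simp add: u_def \<zeta> exp_add)
  define k where "k = - (2 * (m + int r) + \<epsilon>) - 1"
  have "rtheta r q (q * z ^ 2) (- (2 * m + \<epsilon>) - 1) = rtheta r q (q * z ^ 2) (k + int r + int r)"
  proof -
    have "- (2 * m + \<epsilon>) - 1 = k + int r + int r" by (simp add: k_def)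
    thus ?thesis by (simp only:)
  qed
  also have "\<dots> = exp ((of_nat r - 1) * (u + Ln q * (of_int (k + int r) + of_nat r / 2))) *
     (exp ((of_nat r - 1) * (u + Ln q * (of_int k + of_nat r / 2))) * rtheta r q (q * z ^ 2) k)"
    by (simp only: sw.rtheta_shift_r[OF u])
  also have "\<dots> = exp ((of_nat r - 1) * (4 * \<zeta> - 2 * (2 * mm + e + of_nat r) * Ln q) + of_int (int r - 1) * (2 * of_real pi * \<i>)) * rtheta r q (q * z ^ 2) k"
  proof -
    have "exp a * (exp b * t) = exp (a + b) * t" for a b t :: complex by (simp add: exp_add)
    moreover have "(of_nat r - 1) * (u + Ln q * (of_int (k + int r) + of_nat r / 2)) + (of_nat r - 1) * (u + Ln q * (of_int k + of_nat r / 2))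
      = (of_nat r - 1) * (4 * \<zeta> - 2 * (2 * mm + e + of_nat r) * Ln q) + of_int (int r - 1) * (2 * of_real pi * \<i>)"
      unfolding u_def k_def by (simp add: field_simps mm_def e_def)
    ultimately show ?thesis by (simp only:)
  qed
  finally have W: "rtheta r q (q * z ^ 2) (- (2 * m + \<epsilon>) - 1) =
     exp ((of_nat r - 1) * (4 * \<zeta> - 2 * (2 * mm + e + of_nat r) * Ln q)) * rtheta r q (q * z ^ 2) (- (2 * (m + int r) + \<epsilon>) - 1)"
    unfolding exp_add_2pi k_def .
  have G: "(\<Prod>a\<in>I. rgamma r p q (q * s a * z) (n a + (m + int r) + \<epsilon> + 1) * rgamma r p q (s a / z) (n a - (m + int r)))
     = (\<Prod>a\<in>I. rgamma r p q (q * s a * z) (n a + (m + \<epsilon> + 1) + int r) * rgamma r p q (s a / z) (n a + (- m) - int r))"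
    by (intro prod.cong) (simp_all add: algebra_simps)
  have S: "(of_nat r - 1) * (Ln p * (of_int (m + \<epsilon> + 1) - of_int (- m) + of_nat r) + of_int (- 3 * \<epsilon> - 1) * (\<zeta> + Ln q - - \<zeta>)
      + 6 * ((\<zeta> + Ln q) * (of_int (m + \<epsilon> + 1) + of_nat r / 2) - - \<zeta> * (of_int (- m) - of_nat r / 2))
      + Ln p * (of_int (m + \<epsilon> + 1) - of_int (- m) + of_nat r) * (2 * of_int (- 3 * \<epsilon> - 1) + 6 * (of_int (m + \<epsilon> + 1) + of_int (- m) - 1)) / 2
      - Ln q * (of_int (m + \<epsilon> + 1) - of_int (- m) + of_nat r) * (2 * of_int (- 3 * \<epsilon> - 1) + 6 * (of_int (m + \<epsilon> + 1) + of_int (- m) + 1)) / 2)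
     = (of_nat r - 1) * (4 * \<zeta> - 2 * (2 * mm + e + of_nat r) * Ln q)"
    unfolding of_int_add of_int_diff of_int_minus of_int_mult e_def[symmetric] mm_def[symmetric] by (simp add: field_simps)
  have "Gf s n (m + int r) z = inverse z * rtheta r q (q * z ^ 2) (- (2 * (m + int r) + \<epsilon>) - 1) *
     (exp ((of_nat r - 1) * (4 * \<zeta> - 2 * (2 * mm + e + of_nat r) * Ln q)) *
     (\<Prod>a\<in>I. rgamma r p q (q * s a * z) (n a + (m + \<epsilon> + 1)) * rgamma r p q (s a / z) (n a + (- m))))"
    unfolding Gf_def G
    using prod_pair_shift[where n = n and ?d1.0 = "m + \<epsilon> + 1" and ?d2.0 = "- m" and ?t1.0 = "\<lambda>a. q * s a * z"
      and ?t2.0 = "\<lambda>a. s a / z" and \<tau> = \<tau> and \<alpha> = "\<zeta> + Ln q" and \<beta> = "- \<zeta>", OF t1 t2]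
    unfolding \<tau>_sum n S by (simp only:)
  moreover have "(\<Prod>a\<in>I. rgamma r p q (q * s a * z) (n a + (m + \<epsilon> + 1)) * rgamma r p q (s a / z) (n a + (- m)))
     = (\<Prod>a\<in>I. rgamma r p q (q * s a * z) (n a + m + \<epsilon> + 1) * rgamma r p q (s a / z) (n a - m))"
    by (simp add: add.assoc)
  ultimately show ?thesis unfolding Gf_def W by (simp only: mult_ac)
qed

text \<open>Both sides are multiplied by the same factor \<open>exp Y\<close>. It follows that the
  integers matter only modulo r for the quotient, so that the functions in the maximum principle are
  finite in number.\<close>

lemma ratio_periodic:
  assumes adm: "adm t n" and ij: "i \<in> I" "j \<in> I" "i \<noteq> j"
  defines "n' \<equiv> n(i := n i + int r, j := n j - int r)"
  shows "J t n' * R t n = J t n * R t n'"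
proof -
  have t: "\<And>a. a \<in> I \<Longrightarrow> t a \<noteq> 0" and tp: "(\<Prod>a\<in>I. t a) = p * q" and n: "(\<Sum>a\<in>I. n a) = - 3 * \<epsilon>"
    using adm by (auto simp: adm_def)
  obtain \<tau> where \<tau>: "\<And>a. a \<in> I \<Longrightarrow> - t a = exp (\<tau> a)" and \<tau>_sum: "(\<Sum>a\<in>I. \<tau> a) = Ln p + Ln q"
    by (rule obtain_logs[of I t "Ln p + Ln q"]) (use I t tp p0 q0 in \<open>auto simp: exp_add\<close>)
  define e where "e = (of_int \<epsilon> :: complex)"
  define rr where "rr = (of_nat r :: complex)"
  define ni where "ni = (of_int (n i) :: complex)"
  define nj where "nj = (of_int (n j) :: complex)"
  define B where "B = ni - nj + rr"
  define A where "A = ni ^ 2 + ni * e - (nj - rr) ^ 2 - (nj - rr) * e"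
  \<comment> \<open>The exponent coming from the factors i and j of the integrand; its dependence on
    z and m cancels between i and j.\<close>
  define Y where "Y = (rr - 1) * (\<tau> i * (2 * ni + e + rr) - \<tau> j * (2 * nj + e - rr)
     + Ln p * (A + (rr - 1) * B) - Ln q * (A + (rr + 1) * B))"
  have n'i: "n' i = n i + int r" and n'j: "n' j = n j - int r" using ij by (auto simp: n'_def)
  have n'K: "n' a = n a" if "a \<in> I - {i, j}" for a using that by (auto simp: n'_def)
  have \<Delta>: "\<Delta> t n' m z = exp Y * \<Delta> t n m z" if "norm z = 1" for m z
  proof -
    have z: "z \<noteq> 0" using that by auto
    define \<zeta> where "\<zeta> = Ln z"
    have \<zeta>: "z = exp \<zeta>" using z by (simp add: \<zeta>_def)
    have t1: "t a * z = - exp (\<zeta> + \<tau> a)" and t2: "t a / z = - exp (- \<zeta> + \<tau> a)" if "a \<in> I" for a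
      using \<tau>[OF that, symmetric] by (simp_all add: \<zeta> exp_add exp_diff)
    define mm where "mm = (of_int m :: complex)"
    define g where "g = (\<lambda>n a. rgamma r p q (t a * z) (n a + m + \<epsilon>) * rgamma r p q (t a / z) (n a - m))"
    have gi: "g n' i = exp (psi (\<zeta> + \<tau> i) (n i + m + \<epsilon>) + psi (- \<zeta> + \<tau> i) (n i - m)) * g n i"
    proof -
      have "rgamma r p q (t i * z) (n' i + m + \<epsilon>) = exp (psi (\<zeta> + \<tau> i) (n i + m + \<epsilon>)) * rgamma r p q (t i * z) (n i + m + \<epsilon>)"
        using rgamma_shift_r[of "\<zeta> + \<tau> i" "n i + m + \<epsilon>"] unfolding t1[OF ij(1), symmetric] n'i by (simp add: add_ac)
      moreover have "rgamma r p q (t i / z) (n' i - m) = exp (psi (- \<zeta> + \<tau> i) (n i - m)) * rgamma r p q (t i / z) (n i - m)"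
        using rgamma_shift_r[of "- \<zeta> + \<tau> i" "n i - m"] unfolding t2[OF ij(1), symmetric] n'i by (simp add: algebra_simps)
      ultimately show ?thesis unfolding g_def exp_add by (simp only: mult_ac)
    qed
    have "g n j = exp (psi (\<zeta> + \<tau> j) (n j - int r + m + \<epsilon>) + psi (- \<zeta> + \<tau> j) (n j - int r - m)) * g n' j"
    proof -
      have "rgamma r p q (t j * z) (n j + m + \<epsilon>) = exp (psi (\<zeta> + \<tau> j) (n j - int r + m + \<epsilon>)) * rgamma r p q (t j * z) (n' j + m + \<epsilon>)"
        using rgamma_shift_r[of "\<zeta> + \<tau> j" "n j - int r + m + \<epsilon>"] unfolding t1[OF ij(2), symmetric] n'j by (simp add: algebra_simps)
      moreover have "rgamma r p q (t j / z) (n j - m) = exp (psi (- \<zeta> + \<tau> j) (n j - int r - m)) * rgamma r p q (t j / z) (n' j - m)"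
        using rgamma_shift_r[of "- \<zeta> + \<tau> j" "n j - int r - m"] unfolding t2[OF ij(2), symmetric] n'j by (simp add: algebra_simps)
      ultimately show ?thesis unfolding g_def exp_add by (simp only: mult_ac)
    qed
    moreover have "a = exp X * b \<Longrightarrow> b = exp (- X) * a" for a b X :: complex by (simp add: exp_minus)
    ultimately have gj: "g n' j = exp (- (psi (\<zeta> + \<tau> j) (n j - int r + m + \<epsilon>) + psi (- \<zeta> + \<tau> j) (n j - int r - m))) * g n j"
      by blast
    have gK: "(\<Prod>a\<in>I - {i, j}. g n' a) = (\<Prod>a\<in>I - {i, j}. g n a)"
      by (intro prod.cong) (auto simp: g_def n'K)
    have Y: "(psi (\<zeta> + \<tau> i) (n i + m + \<epsilon>) + psi (- \<zeta> + \<tau> i) (n i - m))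
       + - (psi (\<zeta> + \<tau> j) (n j - int r + m + \<epsilon>) + psi (- \<zeta> + \<tau> j) (n j - int r - m)) = Y"
      unfolding psi_def of_int_add of_int_diff of_int_of_nat_eq ni_def[symmetric] nj_def[symmetric] mm_def[symmetric]
        e_def[symmetric] rr_def[symmetric] Y_def A_def B_def using \<epsilon>
      by (auto simp: e_def field_simps power2_eq_square)
    have "(\<Prod>a\<in>I. g n' a) = exp Y * (\<Prod>a\<in>I. g n a)"
      unfolding prod_split2'[OF ij] gK gi gj Y[symmetric] by (simp only: exp_add mult_ac)
    thus ?thesis by (simp add: \<Delta>_def g_def)
  qed
  have "J t n' = exp Y * J t n"
    unfolding J_def sum_distrib_left avg_cmult[symmetric] by (intro sum.cong refl avg_cong \<Delta>)
  moreover have "R t n' = exp Y * R t n"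
  proof -
    define K where "K = I - {i, j}"
    have cK: "card K = 4" "finite K" using I ij by (auto simp: K_def card_Diff_subset)
    define h where "h = (\<lambda>n a b. rgamma r p q (t a * t b) (n a + n b + \<epsilon>))"
    have h1: "h n' i j = h n i j" by (simp add: h_def n'i n'j)
    have h2: "pair_prod K (h n') = pair_prod K (h n)"
      unfolding pair_prod_def h_def by (intro prod.cong) (auto simp: n'K K_def)
    define X where "X = (\<lambda>a. psi (\<tau> i + \<tau> a + of_real pi * \<i>) (n i + n a + \<epsilon>) - psi (\<tau> j + \<tau> a + of_real pi * \<i>) (n j - int r + n a + \<epsilon>))"
    have h3: "h n' i a * h n' j a = exp (X a) * (h n i a * h n j a)" if "a \<in> K" for a
    proof -
      have a: "a \<in> I" using that by (simp add: K_def)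
      have tt: "t b * t a = - exp (\<tau> b + \<tau> a + of_real pi * \<i>)" if "b \<in> I" for b
        using \<tau>[OF that, symmetric] \<tau>[OF a, symmetric] by (simp add: exp_add)
      have 1: "h n' i a = exp (psi (\<tau> i + \<tau> a + of_real pi * \<i>) (n i + n a + \<epsilon>)) * h n i a"
        using rgamma_shift_r[of "\<tau> i + \<tau> a + of_real pi * \<i>" "n i + n a + \<epsilon>"]
        by (simp only: h_def tt[OF ij(1)]) (simp add: n'i n'K[OF that[unfolded K_def]] algebra_simps)
      have "h n j a = exp (psi (\<tau> j + \<tau> a + of_real pi * \<i>) (n j - int r + n a + \<epsilon>)) * h n' j a"
        using rgamma_shift_r[of "\<tau> j + \<tau> a + of_real pi * \<i>" "n j - int r + n a + \<epsilon>"]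
        by (simp only: h_def tt[OF ij(2)]) (simp add: n'j n'K[OF that[unfolded K_def]] algebra_simps)
      hence 2: "h n' j a = exp (- psi (\<tau> j + \<tau> a + of_real pi * \<i>) (n j - int r + n a + \<epsilon>)) * h n j a"
        by (simp add: exp_minus)
      show ?thesis unfolding 1 2 X_def by (simp add: exp_diff exp_minus field_simps)
    qed
    define na where "na = (\<lambda>a. of_int (n a) :: complex)"
    have Xa: "X a = (rr - 1) * (\<tau> i * (ni + e + rr / 2) - \<tau> j * (nj + e - rr / 2) + na a * (\<tau> i - \<tau> j)
        + (\<tau> a + of_real pi * \<i>) * B + Ln p / 2 * (B * (ni + nj + 2 * na a + 2 * e - rr) + (rr - 1) * B)
        - Ln q / 2 * (B * (ni + nj + 2 * na a + 2 * e - rr) + (rr + 1) * B))" for a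
      unfolding X_def psi_def of_int_add of_int_diff of_int_of_nat_eq ni_def[symmetric] nj_def[symmetric] na_def
        e_def[symmetric] rr_def[symmetric] B_def by (simp add: field_simps power2_eq_square)
    have nK: "(\<Sum>a\<in>K. na a) = - 3 * e - ni - nj"
    proof -
      have "(\<Sum>a\<in>I. na a) = of_int (\<Sum>a\<in>I. n a)" by (simp add: na_def)
      also have "\<dots> = - 3 * e" by (simp add: n e_def)
      finally have "- 3 * e = ni + nj + (\<Sum>a\<in>K. na a)"
        unfolding sum_split2[OF ij] by (simp add: na_def ni_def nj_def K_def)
      thus ?thesis by (simp add: algebra_simps)
    qed
    have \<tau>K: "(\<Sum>a\<in>K. \<tau> a) = Ln p + Ln q - \<tau> i - \<tau> j"
      using \<tau>_sum unfolding sum_split2[OF ij] K_def[symmetric] by (simp add: algebra_simps)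
    have "(\<Sum>a\<in>K. X a) = (rr - 1) * (\<Sum>a\<in>K. (\<tau> i * (ni + e + rr / 2) - \<tau> j * (nj + e - rr / 2)
          + of_real pi * \<i> * B + Ln p / 2 * (B * (ni + nj + 2 * e - rr) + (rr - 1) * B)
        - Ln q / 2 * (B * (ni + nj + 2 * e - rr) + (rr + 1) * B))
        + \<tau> a * B + na a * (\<tau> i - \<tau> j + Ln p * B - Ln q * B))"
      unfolding Xa sum_distrib_left by (intro sum.cong) (simp_all add: field_simps)
    also have "\<dots> = (rr - 1) * (4 * (\<tau> i * (ni + e + rr / 2) - \<tau> j * (nj + e - rr / 2)
          + of_real pi * \<i> * B + Ln p / 2 * (B * (ni + nj + 2 * e - rr) + (rr - 1) * B)
        - Ln q / 2 * (B * (ni + nj + 2 * e - rr) + (rr + 1) * B))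
        + (Ln p + Ln q - \<tau> i - \<tau> j) * B + (- 3 * e - ni - nj) * (\<tau> i - \<tau> j + Ln p * B - Ln q * B))"
      unfolding sum.distrib sum_distrib_right[symmetric] \<tau>K nK using cK by simp
    \<comment> \<open>Both balancing conditions have entered through the sums over the other four
      indices. The logarithms of the products t i t a carry an extra pi i each, whence the multiple
      of 2 pi i.\<close>
    also have "\<dots> = Y + of_int (2 * (int r - 1) * (n i - n j + int r)) * (2 * of_real pi * \<i>)"
      unfolding Y_def A_def of_int_mult of_int_add of_int_diff of_int_of_nat_eq ni_def[symmetric] nj_def[symmetric] rr_def[symmetric]
        B_def using \<epsilon> by (auto simp: e_def field_simps power2_eq_square)
    finally have "exp (\<Sum>a\<in>K. X a) = exp Y" by (simp only: exp_add_2pi)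
    moreover have "(\<Prod>a\<in>K. h n' i a * h n' j a) = exp (\<Sum>a\<in>K. X a) * (\<Prod>a\<in>K. h n i a * h n j a)"
      using h3 cK by (simp add: exp_sum prod.distrib)
    ultimately have h4: "(\<Prod>a\<in>K. h n' i a * h n' j a) = exp Y * (\<Prod>a\<in>K. h n i a * h n j a)" by simp
    have RR: "R t m = h m i j * (\<Prod>a\<in>K. h m i a * h m j a) * pair_prod K (h m)" for m
      unfolding R_split2[OF ij] h_def K_def ..
    show ?thesis unfolding RR h1 h2 h4 by simp
  qed
  ultimately show ?thesis by simp
qed

section \<open>The difference equation, for parameters of product p\<close>

context
  fixes s :: "nat \<Rightarrow> complex" and n :: "nat \<Rightarrow> int"
  assumes s: "\<And>a. a \<in> I \<Longrightarrow> s a \<noteq> 0 \<and> norm (s a) < 1"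
    and sp: "(\<Prod>a\<in>I. s a) = p" and sn: "(\<Sum>a\<in>I. n a) = - 3 * \<epsilon> - 1"
begin

text \<open>The two bounds say that every s a / z and every q s a z lies in the unit disc. For
  \<rho> < 1 the annulus contains the circles of radius 1 and 1 / |q|, between which the contour is
  moved.\<close>

lemma Gf_holomorphic:
  assumes \<rho>: "\<rho> > 0" "\<And>a. a \<in> I \<Longrightarrow> norm (s a) \<le> \<rho>"
  shows "Gf s n m holomorphic_on {z. \<rho> < norm z \<and> norm z < 1 / (norm q * \<rho>)}"
proof -
  interpret sw: rarefied r q p by (rule swap)
  define A where "A = {z :: complex. \<rho> < norm z \<and> norm z < 1 / (norm q * \<rho>)}"
  have nz: "z \<noteq> 0" if "z \<in> A" for z using that \<rho> by (auto simp: A_def)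
  have comp: "(\<lambda>z. rgamma r p q (f z) k) holomorphic_on A"
    if "f holomorphic_on A" "\<And>z. z \<in> A \<Longrightarrow> f z \<noteq> 0 \<and> norm (f z) < 1" for f k
  proof -
    have "((\<lambda>w. rgamma r p q w k) \<circ> f) holomorphic_on A"
      by (rule holomorphic_on_compose_gen[OF that(1) rgamma_holomorphic[of "{z. z \<noteq> 0 \<and> norm z < 1}"]])
         (use that(2) in auto)
    thus ?thesis by (simp add: o_def)
  qed
  have rt: "(\<lambda>w. rtheta r q w k) holomorphic_on -{0}" for k
    by (rule analytic_imp_holomorphic, subst analytic_on_analytic_at) (auto intro: sw.rtheta_analytic)
  have "((\<lambda>w. rtheta r q w k) \<circ> (\<lambda>z. q * z ^ 2)) holomorphic_on A" for k
    by (rule holomorphic_on_compose_gen[OF _ rt]) (use nz q0 in \<open>auto intro!: holomorphic_intros\<close>)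
  hence th: "(\<lambda>z. rtheta r q (q * z ^ 2) k) holomorphic_on A" for k by (simp add: o_def)
  have 1: "q * s a * z \<noteq> 0 \<and> norm (q * s a * z) < 1" if "a \<in> I" "z \<in> A" for a z
  proof -
    have "norm z < 1 / (norm q * \<rho>)" using that by (simp add: A_def)
    moreover have "norm (s a) \<le> \<rho>" "norm (s a) > 0" using \<rho> s that by auto
    moreover have "norm q * \<rho> > 0" using q0 \<rho> by simp
    ultimately have "norm q * norm (s a) * norm z \<le> norm q * \<rho> * norm z" "norm q * \<rho> * norm z < 1"
      by (intro mult_right_mono mult_left_mono, simp_all) (simp add: field_simps)
    hence "norm q * norm (s a) * norm z < 1" by linarith
    thus ?thesis using q0 s[OF that(1)] nz[OF that(2)] by (simp add: norm_mult)
  qed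
  have 2: "s a / z \<noteq> 0 \<and> norm (s a / z) < 1" if "a \<in> I" "z \<in> A" for a z
    using s[OF that(1)] nz[OF that(2)] \<rho>(2)[OF that(1)] that by (auto simp: norm_divide A_def divide_simps)
  have "Gf s n m holomorphic_on A"
    unfolding Gf_def by (intro holomorphic_intros comp th) (use nz 1 2 in auto)
  thus ?thesis by (simp add: A_def)
qed

text \<open>Raising one parameter by q multiplies the integrand by two theta functions and leaves
  all other factors common to both integrands. The addition formula then gives two products of six
  theta functions, which are absorbed as shifts by q of the gamma functions.\<close>

lemma difference_pointwise:
  assumes ij: "i \<in> I" "j \<in> I" "i \<noteq> j"
  defines "x \<equiv> \<lambda>b. (\<Prod>a\<in>I - {i, j}. rtheta r p (s b * s a) (n b + n a + \<epsilon>))"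
    and "\<Delta>u \<equiv> \<lambda>b. \<Delta> (s(b := q * s b)) (n(b := n b + 1))"
  obtains C where "\<And>m z. norm z = 1 \<Longrightarrow>
     x i * \<Delta>u j m z - x j * \<Delta>u i m z = C * (Gf s n m z - Gf s n (m - 1) (1 / q * z))"
proof -
  obtain C where C: "\<And>m z. z \<noteq> 0 \<Longrightarrow>
    rtheta r p (z ^ 2) (2 * m + \<epsilon>) *
      (x i * (rtheta r p (s j * z) (n j + m + \<epsilon>) * rtheta r p (s j / z) (n j - m))
     - x j * (rtheta r p (s i * z) (n i + m + \<epsilon>) * rtheta r p (s i / z) (n i - m)))
    = C * (inverse z * (\<Prod>a\<in>I. rtheta r p (s a * z) (n a + m + \<epsilon>)) - z ^ 3 * (\<Prod>a\<in>I. rtheta r p (s a / z) (n a - m)))"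
    unfolding x_def using s sp sn by (elim rtheta_addition[OF ij, rotated 3]) auto
  show ?thesis
  proof (rule that[of C])
    fix m :: int and z :: complex assume z1: "norm z = 1"
    hence z: "z \<noteq> 0" by auto
    have sz: "s a * z \<noteq> 0" "norm (s a * z) < 1" "s a / z \<noteq> 0" "norm (s a / z) < 1" if "a \<in> I" for a
      using s[OF that] z z1 by (auto simp: norm_mult norm_divide)
    define g where "g = (\<lambda>a. rgamma r p q (s a * z) (n a + m + \<epsilon>) * rgamma r p q (s a / z) (n a - m))"
    have up: "\<Delta>u b m z = rtheta r p (s b * z) (n b + m + \<epsilon>) * rtheta r p (s b / z) (n b - m) * (\<Prod>a\<in>I. g a) * weyl (z ^ 2) (2 * m + \<epsilon>)"
      if b: "b \<in> I" for b
    proof -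
      have e1: "rgamma r p q (q * s b * z) (n b + 1 + m + \<epsilon>) = rtheta r p (s b * z) (n b + m + \<epsilon>) * rgamma r p q (s b * z) (n b + m + \<epsilon>)"
        using rgamma_shift_q[OF sz(1,2)[OF b], of "n b + m + \<epsilon>"] by (simp add: algebra_simps)
      have e2: "rgamma r p q (q * s b / z) (n b + 1 - m) = rtheta r p (s b / z) (n b - m) * rgamma r p q (s b / z) (n b - m)"
        using rgamma_shift_q[OF sz(3,4)[OF b], of "n b - m"] by (simp add: algebra_simps)
      have "(\<Prod>a\<in>I. g a) = g b * (\<Prod>a\<in>I - {b}. g a)" using I b by (simp add: prod.remove)
      moreover have "(\<Prod>a\<in>I - {b}. rgamma r p q ((s(b := q * s b)) a * z) ((n(b := n b + 1)) a + m + \<epsilon>) * rgamma r p q ((s(b := q * s b)) a / z) ((n(b := n b + 1)) a - m))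
         = (\<Prod>a\<in>I - {b}. g a)" by (intro prod.cong) (auto simp: g_def)
      ultimately show ?thesis unfolding \<Delta>u_def \<Delta>_def using I b e1 e2
        by (simp add: prod.remove[of I b] g_def mult_ac)
    qed
    have G1: "Gf s n m z = inverse z * rtheta r q (q * z ^ 2) (- (2 * m + \<epsilon>) - 1) * ((\<Prod>a\<in>I. rtheta r p (s a * z) (n a + m + \<epsilon>)) * (\<Prod>a\<in>I. g a))"
    proof -
      have "(\<Prod>a\<in>I. rgamma r p q (q * s a * z) (n a + m + \<epsilon> + 1) * rgamma r p q (s a / z) (n a - m))
         = (\<Prod>a\<in>I. rtheta r p (s a * z) (n a + m + \<epsilon>) * g a)"
      proof (rule prod.cong)
        fix a assume a: "a \<in> I"
        show "rgamma r p q (q * s a * z) (n a + m + \<epsilon> + 1) * rgamma r p q (s a / z) (n a - m) = rtheta r p (s a * z) (n a + m + \<epsilon>) * g a"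
          using rgamma_shift_q[OF sz(1,2)[OF a], of "n a + m + \<epsilon>"] by (simp add: g_def mult_ac)
      qed auto
      thus ?thesis by (simp add: Gf_def prod.distrib)
    qed
    \<comment> \<open>Division of z by q takes the q off \<open>q * s a * z\<close> and puts it on
      \<open>s a / z\<close>, so the other gamma function of each pair is the raised one. The theta
      function contributes z^4 / q and the factor 1/z becomes q / z, whence z^3.\<close>
    have G2: "Gf s n (m - 1) (1 / q * z) = z ^ 3 * rtheta r q (q * z ^ 2) (- (2 * m + \<epsilon>) - 1) * ((\<Prod>a\<in>I. rtheta r p (s a / z) (n a - m)) * (\<Prod>a\<in>I. g a))"
    proof -
      have f1: "(\<Prod>a\<in>I. rgamma r p q (q * s a * (1 / q * z)) (n a + (m - 1) + \<epsilon> + 1) * rgamma r p q (s a / (1 / q * z)) (n a - (m - 1)))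
         = (\<Prod>a\<in>I. rtheta r p (s a / z) (n a - m) * g a)"
      proof (rule prod.cong)
        fix a assume a: "a \<in> I"
        have "rgamma r p q (s a / (1 / q * z)) (n a - (m - 1)) = rtheta r p (s a / z) (n a - m) * rgamma r p q (s a / z) (n a - m)"
          using rgamma_shift_q[OF sz(3,4)[OF a], of "n a - m"] by (simp add: algebra_simps)
        moreover have "rgamma r p q (q * s a * (1 / q * z)) (n a + (m - 1) + \<epsilon> + 1) = rgamma r p q (s a * z) (n a + m + \<epsilon>)"
          using q0 by (simp add: algebra_simps)
        ultimately show "rgamma r p q (q * s a * (1 / q * z)) (n a + (m - 1) + \<epsilon> + 1) * rgamma r p q (s a / (1 / q * z)) (n a - (m - 1))
          = rtheta r p (s a / z) (n a - m) * g a" by (simp add: g_def mult_ac)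
      qed auto
      have f2: "rtheta r q (q * (1 / q * z) ^ 2) (- (2 * (m - 1) + \<epsilon>) - 1) = z ^ 4 / q * rtheta r q (q * z ^ 2) (- (2 * m + \<epsilon>) - 1)"
        using rtheta_q_shift2[OF z, of "2 * m + \<epsilon>"] by (simp add: algebra_simps)
      have f3: "inverse (1 / q * z) * (z ^ 4 / q) = z ^ 3"
        using z q0 by (simp add: field_simps eval_nat_numeral)
      show ?thesis unfolding Gf_def f1 f2 unfolding prod.distrib mult.assoc[symmetric] f3
        by (simp only: mult.assoc)
    qed
    define W where "W = rtheta r q (q * z ^ 2) (- (2 * m + \<epsilon>) - 1) * (\<Prod>a\<in>I. g a)"
    have w: "weyl (z ^ 2) (2 * m + \<epsilon>) = rtheta r p (z ^ 2) (2 * m + \<epsilon>) * rtheta r q (q * z ^ 2) (- (2 * m + \<epsilon>) - 1)"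
      by (simp add: weyl_def)
    have "x i * \<Delta>u j m z - x j * \<Delta>u i m z = W * (rtheta r p (z ^ 2) (2 * m + \<epsilon>) *
      (x i * (rtheta r p (s j * z) (n j + m + \<epsilon>) * rtheta r p (s j / z) (n j - m))
     - x j * (rtheta r p (s i * z) (n i + m + \<epsilon>) * rtheta r p (s i / z) (n i - m))))"
      unfolding up[OF ij(1)] up[OF ij(2)] w W_def by (simp add: algebra_simps)
    also have "\<dots> = W * (C * (inverse z * (\<Prod>a\<in>I. rtheta r p (s a * z) (n a + m + \<epsilon>)) - z ^ 3 * (\<Prod>a\<in>I. rtheta r p (s a / z) (n a - m))))"
      unfolding C[OF z] ..
    also have "\<dots> = C * (Gf s n m z - Gf s n (m - 1) (1 / q * z))"
      unfolding G1 G2 W_def by (simp add: algebra_simps)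
    finally show "x i * \<Delta>u j m z - x j * \<Delta>u i m z = C * (Gf s n m z - Gf s n (m - 1) (1 / q * z))" .
  qed
qed

text \<open>The coefficients x i and x j of the addition formula are also the factors by which the
  products with s i raised and with s j raised differ from a common part. So the vanishing of the
  summed difference says that the two quotients of J by R agree.\<close>

lemma J_R_exchange:
  assumes ij: "i \<in> I" "j \<in> I" "i \<noteq> j"
    and adm: "adm (s(j := q * s j)) (n(j := n j + 1))" "adm (s(i := q * s i)) (n(i := n i + 1))"
  shows "J (s(j := q * s j)) (n(j := n j + 1)) * R (s(i := q * s i)) (n(i := n i + 1))
       = J (s(i := q * s i)) (n(i := n i + 1)) * R (s(j := q * s j)) (n(j := n j + 1))"
proof -
  define x where "x = (\<lambda>b. (\<Prod>a\<in>I - {i, j}. rtheta r p (s b * s a) (n b + n a + \<epsilon>)))"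
  define su where "su = (\<lambda>b. s(b := q * s b))"
  define nu where "nu = (\<lambda>b. n(b := n b + 1))"
  obtain C where C: "\<And>m z. norm z = 1 \<Longrightarrow>
     x i * \<Delta> (su j) (nu j) m z - x j * \<Delta> (su i) (nu i) m z = C * (Gf s n m z - Gf s n (m - 1) (1 / q * z))"
    unfolding x_def su_def nu_def by (rule difference_pointwise[OF ij]) blast
  \<comment> \<open>The largest modulus of a parameter, so that one annulus serves all of
    them.\<close>
  define \<rho> where "\<rho> = Max ((\<lambda>a. norm (s a)) ` I)"
  have \<rho>_ge: "norm (s a) \<le> \<rho>" if "a \<in> I" for a using I that by (auto simp: \<rho>_def)
  have I0: "I \<noteq> {}" using ij by auto
  have "\<rho> \<in> (\<lambda>a. norm (s a)) ` I" unfolding \<rho>_def using I I0 by (intro Max_in) auto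
  hence \<rho>1: "0 < \<rho>" "\<rho> < 1" using s by auto
  define A where "A = {z :: complex. \<rho> < norm z \<and> norm z < 1 / (norm q * \<rho>)}"
  have holo: "Gf s n m holomorphic_on A" for m
    unfolding A_def by (rule Gf_holomorphic) (use \<rho>1 \<rho>_ge in auto)
  have A: "open A" "connected A"
  proof -
    have "A = {z. \<rho> < norm (z - 0) \<and> norm (z - 0) < 1 / (norm q * \<rho>)}" by (simp add: A_def)
    also have "connected \<dots>" by (rule connected_annulus) simp
    finally show "connected A" .
    have "A = {z. \<rho> < norm z} \<inter> {z. norm z < 1 / (norm q * \<rho>)}" by (auto simp: A_def)
    also have "open \<dots>" by (intro open_Int open_Collect_less continuous_intros)
    finally show "open A" .
  qed
  have qi: "1 < 1 / norm q" "1 / norm q < 1 / (norm q * \<rho>)"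
    using q0 q1 \<rho>1 by (auto simp: field_simps)
  have mem: "1 \<in> A" "1 / q \<in> A" using \<rho>1 qi by (auto simp: A_def norm_divide)
  have sphA: "z \<in> A" if "norm z = 1" for z using that mem(1) by (auto simp: A_def)
  have cont1: "continuous_on (sphere 0 1) (Gf s n m)" for m
    by (rule continuous_on_subset[OF holomorphic_on_imp_continuous_on[OF holo]]) (use sphA in auto)
  have cont2: "continuous_on (sphere 0 1) (\<lambda>z. Gf s n m (1 / q * z))" for m
    by (rule continuous_on_compose2[OF holomorphic_on_imp_continuous_on[OF holo[of m]]])
       (use mem(2) in \<open>auto simp: A_def norm_mult norm_divide intro!: continuous_intros\<close>)
  have shift: "avg (\<lambda>z. Gf s n m (1 / q * z)) = avg (Gf s n m)" for m
  proof -
    have "avg (\<lambda>z. Gf s n m (1 / q * z)) = avg (\<lambda>z. Gf s n m (1 * z))"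
      by (rule avg_dilation_const[OF A _ holo mem(2,1)]) (auto simp: A_def norm_mult)
    thus ?thesis by simp
  qed
  \<comment> \<open>The sum starts with G_0 - G_{-1}, so the end terms are those at r - 1 and -1,
    which differ by exactly one period.\<close>
  have tel: "(\<Sum>m<k. avg (Gf s n (int m)) - avg (Gf s n (int m - 1))) = avg (Gf s n (int k - 1)) - avg (Gf s n (- 1))" for k
    by (induction k) auto
  have c\<Delta>: "continuous_on (sphere 0 1) (\<Delta> (su b) (nu b) m)" if "b \<in> {i, j}" for b m
    by (rule \<Delta>_continuous) (use adm that in \<open>auto simp: adm_def su_def nu_def\<close>)
  have "x i * J (su j) (nu j) - x j * J (su i) (nu i) =
     (\<Sum>m<r. x i * avg (\<Delta> (su j) (nu j) (int m)) - x j * avg (\<Delta> (su i) (nu i) (int m)))"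
    by (simp add: J_def sum_distrib_left sum_subtractf)
  also have "\<dots> = (\<Sum>m<r. C * (avg (Gf s n (int m)) - avg (Gf s n (int m - 1))))"
  proof (rule sum.cong)
    fix m
    have "x i * avg (\<Delta> (su j) (nu j) (int m)) - x j * avg (\<Delta> (su i) (nu i) (int m))
       = avg (\<lambda>z. x i * \<Delta> (su j) (nu j) (int m) z - x j * \<Delta> (su i) (nu i) (int m) z)"
      by (subst avg_diff) (auto simp: avg_cmult intro!: continuous_intros c\<Delta>)
    also have "\<dots> = avg (\<lambda>z. C * (Gf s n (int m) z - Gf s n (int m - 1) (1 / q * z)))"
      by (intro avg_cong C)
    also have "\<dots> = C * (avg (Gf s n (int m)) - avg (\<lambda>z. Gf s n (int m - 1) (1 / q * z)))"
      unfolding avg_cmult by (subst avg_diff) (rule cont1 cont2 refl)+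
    finally show "x i * avg (\<Delta> (su j) (nu j) (int m)) - x j * avg (\<Delta> (su i) (nu i) (int m))
       = C * (avg (Gf s n (int m)) - avg (Gf s n (int m - 1)))" unfolding shift .
  qed auto
  also have "\<dots> = C * (avg (Gf s n (int r - 1)) - avg (Gf s n (- 1)))"
    unfolding sum_distrib_left[symmetric] tel ..
  also have "avg (Gf s n (int r - 1)) = avg (Gf s n (- 1))"
  proof (rule avg_cong)
    fix z :: complex assume "norm z = 1"
    hence "z \<noteq> 0" by auto
    from Gf_periodic[OF _ sp sn this, of "-1"] s show "Gf s n (int r - 1) z = Gf s n (- 1) z" by auto
  qed
  finally have eqJ: "x i * J (su j) (nu j) = x j * J (su i) (nu i)" by simp
  define K where "K = I - {i, j}"
  define h where "h = (\<lambda>a b. rgamma r p q (s a * s b) (n a + n b + \<epsilon>))"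
  define h' where "h' = (\<lambda>b a c. rgamma r p q (su b a * su b c) (nu b a + nu b c + \<epsilon>))"
  have RR: "R (su b) (nu b) = h' b i j * (\<Prod>a\<in>K. h' b i a * h' b j a) * pair_prod K (h' b)" for b
    unfolding R_split2[OF ij] h'_def K_def ..
  have hK: "pair_prod K (h' b) = pair_prod K h" if "b \<in> {i, j}" for b
    unfolding pair_prod_def h'_def h_def by (intro prod.cong) (use that in \<open>auto simp: K_def su_def nu_def\<close>)
  have hij: "h' i i j = h' j i j"
    using ij by (simp add: h'_def su_def nu_def algebra_simps)
  have step: "h' b b a = rtheta r p (s b * s a) (n b + n a + \<epsilon>) * h b a" if "b \<in> {i, j}" "a \<in> K" for b a
  proof -
    have ab: "a \<in> I" "b \<in> I" "a \<noteq> b" using that ij by (auto simp: K_def)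
    have "norm (s b) * norm (s a) < 1 * 1" using s ab by (intro mult_strict_mono') auto
    hence "s b * s a \<noteq> 0" "norm (s b * s a) < 1" using s ab by (auto simp: norm_mult)
    from rgamma_shift_q[OF this, of "n b + n a + \<epsilon>"] show ?thesis
      using ab by (simp add: h'_def h_def su_def nu_def algebra_simps)
  qed
  have hi: "h' i j a = h j a" and hj: "h' j i a = h i a" if "a \<in> K" for a
    using that ij by (auto simp: h'_def h_def su_def nu_def K_def)
  have xx: "x b = (\<Prod>a\<in>K. rtheta r p (s b * s a) (n b + n a + \<epsilon>))" for b by (simp add: x_def K_def)
  have Ri: "R (su i) (nu i) = h' j i j * (x i * (\<Prod>a\<in>K. h i a * h j a)) * pair_prod K h"
  proof -
    have "(\<Prod>a\<in>K. h' i i a * h' i j a) = (\<Prod>a\<in>K. rtheta r p (s i * s a) (n i + n a + \<epsilon>) * (h i a * h j a))"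
      by (intro prod.cong) (auto simp: step hi)
    thus ?thesis unfolding RR by (simp add: xx hK hij prod.distrib)
  qed
  have Rj: "R (su j) (nu j) = h' j i j * (x j * (\<Prod>a\<in>K. h i a * h j a)) * pair_prod K h"
  proof -
    have "(\<Prod>a\<in>K. h' j i a * h' j j a) = (\<Prod>a\<in>K. rtheta r p (s j * s a) (n j + n a + \<epsilon>) * (h i a * h j a))"
      by (intro prod.cong) (auto simp: step hj)
    thus ?thesis unfolding RR by (simp add: xx hK prod.distrib)
  qed
  have "J (su j) (nu j) * R (su i) (nu i) = (x i * J (su j) (nu j)) * (h' j i j * (\<Prod>a\<in>K. h i a * h j a) * pair_prod K h)"
    unfolding Ri by (simp add: mult_ac)
  also have "\<dots> = J (su i) (nu i) * R (su j) (nu j)" unfolding eqJ Rj by (simp add: mult_ac)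
  finally show ?thesis by (simp add: su_def nu_def)
qed

end

definition \<Phi> :: "(nat \<Rightarrow> complex) \<Rightarrow> (nat \<Rightarrow> int) \<Rightarrow> complex" where
  "\<Phi> t n = J t n / R t n"

text \<open>Dividing t j by q gives parameters s of product p. Raising s j restores t, raising s i
  gives the shifted parameters, and the bound on t j keeps s inside the unit disc.\<close>

theorem \<Phi>_shift:
  assumes adm: "adm t n" and ij: "i \<in> I" "j \<in> I" "i \<noteq> j" and tj: "norm (t j) < norm q"
  shows "\<Phi> (t(i := q * t i, j := t j / q)) (n(i := n i + 1, j := n j - 1)) = \<Phi> t n"
proof -
  define s where "s = t(j := t j / q)"
  define n1 where "n1 = n(j := n j - 1)"
  have t: "\<And>a. a \<in> I \<Longrightarrow> t a \<noteq> 0 \<and> norm (t a) < 1" using adm by (auto simp: adm_def)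
  have s: "s a \<noteq> 0 \<and> norm (s a) < 1" if "a \<in> I" for a
    using t[OF that] tj q0 by (auto simp: s_def norm_divide divide_simps)
  have eqs: "s(j := q * s j) = t" "n1(j := n1 j + 1) = n"
    "s(i := q * s i) = t(i := q * t i, j := t j / q)" "n1(i := n1 i + 1) = n(i := n i + 1, j := n j - 1)"
    using ij q0 by (auto simp: s_def n1_def)
  have prod_upd: "(\<Prod>a\<in>I. (s(b := q * s b)) a) = q * (\<Prod>a\<in>I. s a)" if "b \<in> I" for b
  proof -
    have "(\<Prod>a\<in>I. (s(b := q * s b)) a) = q * s b * (\<Prod>a\<in>I - {b}. (s(b := q * s b)) a)"
      using I that by (simp add: prod.remove)
    also have "(\<Prod>a\<in>I - {b}. (s(b := q * s b)) a) = (\<Prod>a\<in>I - {b}. s a)" by (intro prod.cong) auto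
    also have "q * s b * \<dots> = q * (\<Prod>a\<in>I. s a)" using I that by (simp add: prod.remove)
    finally show ?thesis .
  qed
  have sum_upd: "(\<Sum>a\<in>I. (n1(b := n1 b + 1)) a) = (\<Sum>a\<in>I. n1 a) + 1" if "b \<in> I" for b
  proof -
    have "(\<Sum>a\<in>I. (n1(b := n1 b + 1)) a) = n1 b + 1 + (\<Sum>a\<in>I - {b}. (n1(b := n1 b + 1)) a)"
      using I that by (simp add: sum.remove)
    also have "(\<Sum>a\<in>I - {b}. (n1(b := n1 b + 1)) a) = (\<Sum>a\<in>I - {b}. n1 a)" by (intro sum.cong) auto
    also have "n1 b + 1 + \<dots> = (\<Sum>a\<in>I. n1 a) + 1" using I that by (simp add: sum.remove)
    finally show ?thesis .
  qed
  have sp: "(\<Prod>a\<in>I. s a) = p"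
    using prod_upd[OF ij(2)] adm q0 unfolding eqs adm_def by simp
  have sn: "(\<Sum>a\<in>I. n1 a) = - 3 * \<epsilon> - 1"
    using sum_upd[OF ij(2)] adm unfolding eqs adm_def by simp
  have admj: "adm (s(j := q * s j)) (n1(j := n1 j + 1))" using adm by (simp only: eqs)
  have admi: "adm (s(i := q * s i)) (n1(i := n1 i + 1))"
  proof -
    have "norm q * norm (s i) < 1 * 1" using s ij q1 by (intro mult_strict_mono') auto
    thus ?thesis unfolding adm_def prod_upd[OF ij(1)] sum_upd[OF ij(1)] using s q0 sp sn
      by (auto simp: norm_mult mult.commute)
  qed
  have "J t n * R (t(i := q * t i, j := t j / q)) (n(i := n i + 1, j := n j - 1)) =
     J (t(i := q * t i, j := t j / q)) (n(i := n i + 1, j := n j - 1)) * R t n"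
    using J_R_exchange[OF s sp sn ij admj admi] unfolding eqs .
  moreover have "R t n \<noteq> 0" "R (t(i := q * t i, j := t j / q)) (n(i := n i + 1, j := n j - 1)) \<noteq> 0"
    using R_nonzero admi[unfolded eqs] adm by auto
  ultimately show ?thesis unfolding \<Phi>_def by (simp add: field_simps)
qed

end

section \<open>Independence of the parameters\<close>

text \<open>If the integrand depends on s only through s z and s / z, by functions of one variable,
  then its derivative in s is explicit and jointly continuous, and differentiation under the
  integral sign applies.\<close>

lemma avg_product_holomorphic:
  assumes A: "open A" "0 \<notin> A" and rot: "\<And>c z. c \<in> A \<Longrightarrow> norm z = 1 \<Longrightarrow> c * z \<in> A"
    and U: "U holomorphic_on A" and V: "V holomorphic_on A" and K: "continuous_on (sphere 0 1) K"
  shows "(\<lambda>s. avg (\<lambda>z. U (s * z) * V (s / z) * K z)) holomorphic_on A"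
proof -
  have rot': "c / z \<in> A" if "c \<in> A" "norm z = 1" for c z
    using rot[OF that(1), of "1 / z"] that by (simp add: norm_divide)
  have Ud: "(U has_field_derivative deriv U z) (at z)" and Vd: "(V has_field_derivative deriv V z) (at z)"
    if "z \<in> A" for z
    using holomorphic_derivI[OF U A(1) that] holomorphic_derivI[OF V A(1) that] by auto
  have c: "continuous_on A U" "continuous_on A V" "continuous_on A (deriv U)" "continuous_on A (deriv V)"
    using U V A(1) by (auto intro!: holomorphic_on_imp_continuous_on holomorphic_deriv)
  show ?thesis
  proof (rule avg_holomorphic[OF A(1), where F' = "\<lambda>s z. ((deriv U (s * z) * z) * V (s / z) + (deriv V (s / z) * (1 / z)) * U (s * z)) * K z"])
    fix s z :: complex assume s: "s \<in> A" and z: "norm z = 1"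
    have "((\<lambda>s. s * z) has_field_derivative z) (at s)" "((\<lambda>s. s / z) has_field_derivative 1 / z) (at s)"
      using z by (auto intro!: derivative_eq_intros)
    from DERIV_cmult_right[OF DERIV_mult[OF DERIV_chain2[OF Ud[OF rot[OF s z]] this(1)] DERIV_chain2[OF Vd[OF rot'[OF s z]] this(2)]], of "K z"]
    show "((\<lambda>s. U (s * z) * V (s / z) * K z) has_field_derivative ((deriv U (s * z) * z) * V (s / z) + (deriv V (s / z) * (1 / z)) * U (s * z)) * K z) (at s)" .
  next
    have nz: "snd y \<noteq> 0" if "y \<in> A \<times> sphere 0 1" for y :: "complex \<times> complex" using that by auto
    have 1: "continuous_on (A \<times> sphere 0 1) (\<lambda>y. f (fst y * snd y))" if "continuous_on A f" for f :: "complex \<Rightarrow> complex"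
      by (rule continuous_on_compose2[OF that]) (use rot in \<open>auto intro!: continuous_intros\<close>)
    have 2: "continuous_on (A \<times> sphere 0 1) (\<lambda>y. f (fst y / snd y))" if "continuous_on A f" for f :: "complex \<Rightarrow> complex"
      by (rule continuous_on_compose2[OF that]) (use rot' in \<open>auto intro!: continuous_intros\<close>)
    have 3: "continuous_on (A \<times> sphere 0 1) (\<lambda>y. K (snd y))"
      by (rule continuous_on_compose2[OF K]) (auto intro!: continuous_intros)
    have "continuous_on (A \<times> sphere 0 1) (\<lambda>y. ((deriv U (fst y * snd y) * snd y) * V (fst y / snd y) + (deriv V (fst y / snd y) * (1 / snd y)) * U (fst y * snd y)) * K (snd y))"
      by (intro continuous_intros 1 2 3 c) (use nz in auto)
    thus "continuous_on (A \<times> sphere 0 1) (\<lambda>(s, z). ((deriv U (s * z) * z) * V (s / z) + (deriv V (s / z) * (1 / z)) * U (s * z)) * K z)"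
      by (simp add: case_prod_beta)
  next
    fix s assume s: "s \<in> A"
    show "continuous_on (sphere 0 1) (\<lambda>z. U (s * z) * V (s / z) * K z)"
      by (intro continuous_intros K continuous_on_compose2[OF c(1)] continuous_on_compose2[OF c(2)])
         (use s rot rot' in auto)
  qed
qed

section \<open>Moving two parameters with their product fixed\<close>

context rarefied_params
begin

definition tw :: "(nat \<Rightarrow> complex) \<Rightarrow> nat \<Rightarrow> nat \<Rightarrow> complex \<Rightarrow> nat \<Rightarrow> complex" where
  "tw t i j s = t(i := t i * s, j := t j / s)"

definition nw :: "(nat \<Rightarrow> int) \<Rightarrow> nat \<Rightarrow> nat \<Rightarrow> int \<Rightarrow> nat \<Rightarrow> int" where
  "nw n i j k = n(i := n i + k, j := n j - k)"

text \<open>Precisely the condition that t i s and t j / s stay in the unit disc. The ratio of the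
  radii is 1 / |t i t j|, so the annulus is wider than the period if |t i t j| < |q|.\<close>

definition ann :: "(nat \<Rightarrow> complex) \<Rightarrow> nat \<Rightarrow> nat \<Rightarrow> complex set" where
  "ann t i j = {s. norm (t j) < norm s \<and> norm s < 1 / norm (t i)}"

lemma adm_tw:
  assumes adm: "adm t n" and ij: "i \<in> I" "j \<in> I" "i \<noteq> j" and s: "s \<in> ann t i j"
  shows "adm (tw t i j s) (nw n i j k)"
proof -
  have t: "\<And>a. a \<in> I \<Longrightarrow> t a \<noteq> 0 \<and> norm (t a) < 1" and tp: "(\<Prod>a\<in>I. t a) = p * q" and n: "(\<Sum>a\<in>I. n a) + 3 * \<epsilon> = 0"
    using adm by (auto simp: adm_def)
  have s0: "s \<noteq> 0" using s by (auto simp: ann_def)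
  have "norm (t i * s) < 1" using s t[OF ij(1)] by (auto simp: ann_def norm_mult field_simps)
  moreover have "norm (t j / s) < 1" using s s0 by (auto simp: ann_def norm_divide divide_less_eq)
  ultimately have 1: "\<forall>a\<in>I. tw t i j s a \<noteq> 0 \<and> norm (tw t i j s a) < 1"
    using t s0 by (auto simp: tw_def)
  have 2: "(\<Prod>a\<in>I - {i, j}. tw t i j s a) = (\<Prod>a\<in>I - {i, j}. t a)"
    by (intro prod.cong) (auto simp: tw_def)
  have 3: "(\<Sum>a\<in>I - {i, j}. nw n i j k a) = (\<Sum>a\<in>I - {i, j}. n a)"
    by (intro sum.cong) (auto simp: nw_def)
  have "(\<Prod>a\<in>I. tw t i j s a) = p * q"
    using tp s0 ij unfolding prod_split2'[OF ij] 2 by (simp add: tw_def)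
  moreover have "(\<Sum>a\<in>I. nw n i j k a) + 3 * \<epsilon> = 0"
    using n ij unfolding sum_split2[OF ij] 3 by (simp add: nw_def)
  ultimately show ?thesis using 1 by (simp add: adm_def)
qed

lemma ann_open: "open (ann t i j)"
proof -
  have "ann t i j = {s. norm (t j) < norm s} \<inter> {s. norm s < 1 / norm (t i)}" by (auto simp: ann_def)
  also have "open \<dots>" by (intro open_Int open_Collect_less continuous_intros)
  finally show ?thesis .
qed

lemma ann_connected: "connected (ann t i j)"
proof -
  have "ann t i j = {s. norm (t j) < norm (s - 0) \<and> norm (s - 0) < 1 / norm (t i)}" by (simp add: ann_def)
  also have "connected \<dots>" by (rule connected_annulus) simp
  finally show ?thesis .
qed

lemma rgamma_compose_holomorphic:
  assumes "f holomorphic_on A" "\<And>z. z \<in> A \<Longrightarrow> f z \<noteq> 0 \<and> norm (f z) < 1"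
  shows "(\<lambda>z. rgamma r p q (f z) k) holomorphic_on A"
proof -
  have "((\<lambda>w. rgamma r p q w k) \<circ> f) holomorphic_on A"
    by (rule holomorphic_on_compose_gen[OF assms(1) rgamma_holomorphic[of "{z. z \<noteq> 0 \<and> norm z < 1}"]])
       (use assms(2) in auto)
  thus ?thesis by (simp add: o_def)
qed

lemma \<Phi>_holomorphic:
  assumes adm: "adm t n" and ij: "i \<in> I" "j \<in> I" "i \<noteq> j"
  shows "(\<lambda>s. \<Phi> (tw t i j s) n) holomorphic_on ann t i j"
proof -
  have t: "\<And>a. a \<in> I \<Longrightarrow> t a \<noteq> 0 \<and> norm (t a) < 1" using adm by (auto simp: adm_def)
  define A where "A = ann t i j"
  have A0: "0 \<notin> A" by (auto simp: A_def ann_def)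
  have tis: "t i * s \<noteq> 0" "norm (t i * s) < 1" "t j / s \<noteq> 0" "norm (t j / s) < 1" if "s \<in> A" for s
  proof -
    have s0: "s \<noteq> 0" using that A0 by auto
    show "t i * s \<noteq> 0" "t j / s \<noteq> 0" using s0 t ij by auto
    show "norm (t i * s) < 1" using that t[OF ij(1)] by (auto simp: A_def ann_def norm_mult field_simps)
    show "norm (t j / s) < 1" using that s0 by (auto simp: A_def ann_def norm_divide divide_less_eq)
  qed
  have lt: "norm (x * y) < 1" if "norm x < 1" "norm y < 1" for x y :: complex
    using mult_strict_mono'[of "norm x" 1 "norm y" 1] that by (simp add: norm_mult)
  have adm': "adm (tw t i j s) n" if "s \<in> A" for s
    using adm_tw[OF adm ij that[unfolded A_def], of 0] by (simp add: nw_def)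
  have J_holo: "(\<lambda>s. J (tw t i j s) n) holomorphic_on A"
    unfolding J_def
  proof (rule holomorphic_on_sum)
    fix m :: nat
    \<comment> \<open>Both t i s z and t j / (s z) depend on s z alone; the other two moving
      arguments, collected in \<open>V\<close>, depend on s / z alone.\<close>
    define U where "U = (\<lambda>w. rgamma r p q (t i * w) (n i + int m + \<epsilon>) * rgamma r p q (t j / w) (n j - int m))"
    define V where "V = (\<lambda>w. rgamma r p q (t i * w) (n i - int m) * rgamma r p q (t j / w) (n j + int m + \<epsilon>))"
    define K where "K = (\<lambda>z. (\<Prod>a\<in>I - {i, j}. rgamma r p q (t a * z) (n a + int m + \<epsilon>) * rgamma r p q (t a / z) (n a - int m))
       * weyl (z ^ 2) (2 * int m + \<epsilon>))"
    have eq: "\<Delta> (tw t i j s) n (int m) z = U (s * z) * V (s / z) * K z" for s z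
    proof -
      have "(\<Prod>a\<in>I - {i, j}. rgamma r p q (tw t i j s a * z) (n a + int m + \<epsilon>) * rgamma r p q (tw t i j s a / z) (n a - int m))
        = (\<Prod>a\<in>I - {i, j}. rgamma r p q (t a * z) (n a + int m + \<epsilon>) * rgamma r p q (t a / z) (n a - int m))"
        by (intro prod.cong) (auto simp: tw_def)
      moreover have "tw t i j s i = t i * s" "tw t i j s j = t j / s" using ij by (auto simp: tw_def)
      ultimately show ?thesis unfolding \<Delta>_def prod_split2'[OF ij] U_def V_def K_def
        by (simp add: mult_ac)
    qed
    have "(\<lambda>s. avg (\<lambda>z. U (s * z) * V (s / z) * K z)) holomorphic_on A"
    proof (rule avg_product_holomorphic)
      show "open A" unfolding A_def by (rule ann_open)
      show "c * z \<in> A" if "c \<in> A" "norm z = 1" for c z using that by (auto simp: A_def ann_def norm_mult)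
      show "U holomorphic_on A" "V holomorphic_on A" unfolding U_def V_def
        by (intro holomorphic_intros rgamma_compose_holomorphic; use tis A0 in auto)+
      show "continuous_on (sphere 0 1) K" unfolding K_def
        by (intro continuous_intros continuous_on_rgamma continuous_on_weyl) (use t in \<open>auto simp: norm_mult norm_divide\<close>)
    qed (rule A0)
    thus "(\<lambda>s. avg (\<Delta> (tw t i j s) n (int m))) holomorphic_on A" by (simp add: eq[abs_def])
  qed
  have R_holo: "(\<lambda>s. R (tw t i j s) n) holomorphic_on A"
  proof -
    define K where "K = I - {i, j}"
    have "pair_prod K (\<lambda>a b. rgamma r p q (tw t i j s a * tw t i j s b) (n a + n b + \<epsilon>)) =
        pair_prod K (\<lambda>a b. rgamma r p q (t a * t b) (n a + n b + \<epsilon>))" for s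
      unfolding pair_prod_def by (intro prod.cong) (auto simp: tw_def K_def)
    moreover have "(\<Prod>a\<in>K. rgamma r p q (tw t i j s i * tw t i j s a) (n i + n a + \<epsilon>) * rgamma r p q (tw t i j s j * tw t i j s a) (n j + n a + \<epsilon>))
      = (\<Prod>a\<in>K. rgamma r p q (t i * s * t a) (n i + n a + \<epsilon>) * rgamma r p q (t j / s * t a) (n j + n a + \<epsilon>))" for s
      using ij by (intro prod.cong) (auto simp: tw_def K_def)
    moreover have "rgamma r p q (tw t i j s i * tw t i j s j) k = rgamma r p q (t i * t j) k" if "s \<in> A" for s k
    proof -
      have "s \<noteq> 0" using that A0 by auto
      thus ?thesis using ij by (simp add: tw_def)
    qed
    ultimately have eq: "R (tw t i j s) n = rgamma r p q (t i * t j) (n i + n j + \<epsilon>)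
      * (\<Prod>a\<in>K. rgamma r p q (t i * s * t a) (n i + n a + \<epsilon>) * rgamma r p q (t j / s * t a) (n j + n a + \<epsilon>))
      * pair_prod K (\<lambda>a b. rgamma r p q (t a * t b) (n a + n b + \<epsilon>))" if "s \<in> A" for s
      unfolding R_split2[OF ij] K_def[symmetric] using that by simp
    have "(\<lambda>s. rgamma r p q (t i * t j) (n i + n j + \<epsilon>)
      * (\<Prod>a\<in>K. rgamma r p q (t i * s * t a) (n i + n a + \<epsilon>) * rgamma r p q (t j / s * t a) (n j + n a + \<epsilon>))
      * pair_prod K (\<lambda>a b. rgamma r p q (t a * t b) (n a + n b + \<epsilon>))) holomorphic_on A"
    proof (intro holomorphic_intros rgamma_compose_holomorphic conjI)
      fix a s assume a: "a \<in> K" and s: "s \<in> A"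
      have ta: "t a \<noteq> 0" "norm (t a) < 1" using a t by (auto simp: K_def)
      show "t i * s * t a \<noteq> 0" "t j / s * t a \<noteq> 0" using tis[OF s] ta by auto
      show "norm (t i * s * t a) < 1" "norm (t j / s * t a) < 1" by (intro lt tis[OF s] ta(2))+
    qed (use A0 in auto)
    thus ?thesis using holomorphic_transform[of _ A "\<lambda>s. R (tw t i j s) n"] eq by (metis (mono_tags, lifting))
  qed
  show ?thesis unfolding \<Phi>_def A_def[symmetric]
    by (intro holomorphic_on_divide J_holo R_holo R_nonzero adm')
qed

lemma \<Phi>_tw_shift:
  assumes adm: "adm t n" and ij: "i \<in> I" "j \<in> I" "i \<noteq> j" and s: "s \<in> ann t i j" "q * s \<in> ann t i j"
  shows "\<Phi> (tw t i j (q * s)) (nw n i j (k + 1)) = \<Phi> (tw t i j s) (nw n i j k)"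
proof -
  have s0: "s \<noteq> 0" using s(1) by (auto simp: ann_def)
  have "norm (tw t i j s j) < norm q"
    using s(2) s0 ij by (auto simp: tw_def ann_def norm_divide norm_mult field_simps)
  from \<Phi>_shift[OF adm_tw[OF adm ij s(1), of k] ij this]
  have "\<Phi> ((tw t i j s)(i := q * tw t i j s i, j := tw t i j s j / q)) ((nw n i j k)(i := nw n i j k i + 1, j := nw n i j k j - 1))
     = \<Phi> (tw t i j s) (nw n i j k)" .
  moreover have "(tw t i j s)(i := q * tw t i j s i, j := tw t i j s j / q) = tw t i j (q * s)"
    using ij by (auto simp: tw_def field_simps)
  moreover have "(nw n i j k)(i := nw n i j k i + 1, j := nw n i j k j - 1) = nw n i j (k + 1)"
    using ij by (auto simp: nw_def)
  ultimately show ?thesis by simp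
qed

lemma \<Phi>_nw_periodic:
  assumes adm: "adm t n" and ij: "i \<in> I" "j \<in> I" "i \<noteq> j" and s: "s \<in> ann t i j"
  shows "\<Phi> (tw t i j s) (nw n i j (k + int r)) = \<Phi> (tw t i j s) (nw n i j k)"
proof -
  have eq: "(nw n i j k)(i := nw n i j k i + int r, j := nw n i j k j - int r) = nw n i j (k + int r)"
    using ij by (auto simp: nw_def)
  have "J (tw t i j s) (nw n i j (k + int r)) * R (tw t i j s) (nw n i j k) =
        J (tw t i j s) (nw n i j k) * R (tw t i j s) (nw n i j (k + int r))"
    using ratio_periodic[OF adm_tw[OF adm ij s, of k] ij] unfolding eq .
  moreover have "R (tw t i j s) (nw n i j (k + int r)) \<noteq> 0" "R (tw t i j s) (nw n i j k) \<noteq> 0"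
    using R_nonzero adm_tw[OF adm ij s] by auto
  ultimately show ?thesis by (simp add: \<Phi>_def field_simps)
qed

text \<open>On the annulus the functions $\Phi$ with index $k$ are permuted by the shift $s \mapsto qs$. As
  the annulus is wider than $1/|q|$, the maximum of their moduli over a closed
  fundamental annulus is a maximum over an open neighbourhood of it.\<close>

theorem \<Phi>_const:
  assumes adm: "adm t n" and ij: "i \<in> I" "j \<in> I" "i \<noteq> j" and lt: "norm (t i * t j) < norm q"
    and s: "s \<in> ann t i j"
  shows "\<Phi> (tw t i j s) (nw n i j k) = \<Phi> t n"
proof -
  define A where "A = ann t i j"
  define \<phi> where "\<phi> = (\<lambda>k s. \<Phi> (tw t i j s) (nw n i j k))"
  have t: "\<And>a. a \<in> I \<Longrightarrow> t a \<noteq> 0 \<and> norm (t a) < 1" using adm by (auto simp: adm_def)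
  define \<alpha> where "\<alpha> = norm (t j)"
  define \<beta> where "\<beta> = 1 / norm (t i)"
  have A_eq: "A = {s. \<alpha> < norm s \<and> norm s < \<beta>}" by (simp add: A_def ann_def \<alpha>_def \<beta>_def)
  have Q: "0 < norm q" "norm q < 1" using q0 q1 by auto
  have ab: "0 < \<alpha>" "\<alpha> < norm q * \<beta>" using t[OF ij(1)] t[OF ij(2)] lt
    by (auto simp: \<alpha>_def \<beta>_def norm_mult field_simps)
  have adm_nw: "adm t (nw n i j k)" for k
  proof -
    have "1 \<in> ann t i j" using t[OF ij(1)] t[OF ij(2)] by (auto simp: ann_def)
    from adm_tw[OF adm ij this, of k] show ?thesis by (simp add: tw_def)
  qed
  have holo: "\<phi> k holomorphic_on A" for k
    unfolding \<phi>_def A_def by (rule \<Phi>_holomorphic[OF adm_nw ij])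
  have shift: "\<phi> (k + 1) (q * s) = \<phi> k s" if "s \<in> A" "q * s \<in> A" for k s
    unfolding \<phi>_def by (rule \<Phi>_tw_shift[OF adm ij]) (use that in \<open>auto simp: A_def\<close>)
  have per: "\<phi> (k + int r) s = \<phi> k s" if "s \<in> A" for k s
    unfolding \<phi>_def by (rule \<Phi>_nw_periodic[OF adm ij]) (use that in \<open>auto simp: A_def\<close>)
  have per': "\<phi> k s = \<phi> (k mod int r) s" if s: "s \<in> A" for k s
  proof -
    have "\<phi> (l + m * int r) s = \<phi> l s" for l m
    proof (induction m rule: int_induct[where k = 0])
      case (step1 m)
      thus ?case using per[OF s, of "l + m * int r"] by (simp add: algebra_simps)
    next
      case (step2 m)
      thus ?case using per[OF s, of "l + (m - 1) * int r"] by (simp add: algebra_simps)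
    qed auto
    from this[of "k mod int r" "k div int r"] show ?thesis by simp
  qed
  have "\<alpha> / norm q < \<beta>" using ab Q by (simp add: field_simps)
  \<comment> \<open>With this c the closed fundamental annulus c |q| <= |s| <= c lies inside A; the
    choice is possible because A is wider than a period.\<close>
  then obtain c where c: "\<alpha> / norm q < c" "c < \<beta>" using dense by blast
  have c0: "c > 0" using c(1) ab Q by (meson divide_pos_pos less_trans)
  have cq: "\<alpha> < c * norm q" using c Q by (simp add: field_simps)
  have cq': "c * norm q < c" using c0 Q by simp
  define Kc where "Kc = {s :: complex. c * norm q \<le> norm s \<and> norm s \<le> c}"
  have KA: "Kc \<subseteq> A" using c cq by (auto simp: Kc_def A_eq)
  have Kcomp: "compact Kc"
  proof -
    have "Kc = cball 0 c - ball 0 (c * norm q)" by (auto simp: Kc_def)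
    also have "compact \<dots>" by (rule compact_diff) auto
    finally show ?thesis .
  qed
  have Kne: "of_real c \<in> Kc" using c0 cq' by (auto simp: Kc_def)
  have "\<exists>s\<in>Kc. \<forall>s'\<in>Kc. norm (\<phi> k s') \<le> norm (\<phi> k s)" for k
  proof (rule continuous_attains_sup[OF Kcomp])
    show "continuous_on Kc (\<lambda>s. norm (\<phi> k s))"
      by (intro continuous_intros continuous_on_subset[OF holomorphic_on_imp_continuous_on[OF holo] KA])
  qed (use Kne in auto)
  then obtain sk where sk: "\<And>k. sk k \<in> Kc" "\<And>k s'. s' \<in> Kc \<Longrightarrow> norm (\<phi> k s') \<le> norm (\<phi> k (sk k))"
    by metis
  define M where "M = Max ((\<lambda>k. norm (\<phi> k (sk k))) ` {0..<int r})"
  have fin: "finite ((\<lambda>k. norm (\<phi> k (sk k))) ` {0..<int r})" "(\<lambda>k. norm (\<phi> k (sk k))) ` {0..<int r} \<noteq> {}"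
    using r by auto
  have bound: "norm (\<phi> k s) \<le> M" if "s \<in> Kc" for k s
  proof -
    have "norm (\<phi> k s) = norm (\<phi> (k mod int r) s)" using per'[of s k] that KA by auto
    also have "\<dots> \<le> norm (\<phi> (k mod int r) (sk (k mod int r)))" by (rule sk(2)[OF that])
    also have "\<dots> \<le> M" unfolding M_def using fin r by (intro Max_ge) auto
    finally show ?thesis .
  qed
  obtain k0 where k0: "norm (\<phi> k0 (sk k0)) = M"
    using Max_in[OF fin] by (auto simp: M_def)
  \<comment> \<open>Wider than \<open>Kc\<close> by at most one period on either side: every point
    of U is in Kc or is carried into it by one multiplication or division by q.\<close>
  define U where "U = {s :: complex. max \<alpha> (c * norm q * norm q) < norm s \<and> norm s < min \<beta> (c / norm q)}"
  have U_open: "open U"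
  proof -
    have "U = {s. max \<alpha> (c * norm q * norm q) < norm s} \<inter> {s. norm s < min \<beta> (c / norm q)}" by (auto simp: U_def)
    also have "open \<dots>" by (intro open_Int open_Collect_less continuous_intros)
    finally show ?thesis .
  qed
  have UA: "U \<subseteq> A" by (auto simp: U_def A_eq)
  have KU: "Kc \<subseteq> U"
  proof
    fix s assume "s \<in> Kc"
    moreover have "c * norm q * norm q < c * norm q" using c0 Q by simp
    moreover have "c < c / norm q" using c0 Q by (simp add: field_simps)
    ultimately show "s \<in> U" using c cq by (auto simp: Kc_def U_def)
  qed
  have boundU: "norm (\<phi> k s) \<le> M" if s: "s \<in> U" for k s
  proof -
    have sA: "s \<in> A" using s UA by auto
    consider "s \<in> Kc" | "norm s > c" | "norm s < c * norm q" by (force simp: Kc_def)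
    thus ?thesis
    proof cases
      case 1
      thus ?thesis by (rule bound)
    next
      case 2
      have "q * s \<in> Kc" using 2 s Q by (auto simp: U_def Kc_def norm_mult field_simps)
      thus ?thesis using shift[OF sA, of k] bound[of "q * s" "k + 1"] KA by auto
    next
      case 3
      have "s / q \<in> Kc" using 3 s Q by (auto simp: U_def Kc_def norm_divide field_simps)
      thus ?thesis using shift[of "s / q" "k - 1"] sA bound[of "s / q" "k - 1"] KA q0 by auto
    qed
  qed
  have const_if: "\<phi> k constant_on A" if "s \<in> U" "norm (\<phi> k s) = M" for k s
    by (rule maximum_modulus_principle[OF holo _ _ U_open UA that(1)])
       (use boundU that in \<open>auto simp: A_def ann_open ann_connected\<close>)
  \<comment> \<open>Constancy passes from index k to k + 1: the shift carries the value v to one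
    point of the next function, which therefore attains the maximum modulus too and is the same
    constant.\<close>
  have step: "\<exists>v. norm v = M \<and> (\<forall>s\<in>A. \<phi> (k0 + int l) s = v) \<and> v = \<phi> k0 (sk k0)" for l
  proof (induction l)
    case 0
    have "\<phi> k0 constant_on A" using const_if[of "sk k0" k0] sk(1) KU k0 by auto
    then obtain v where v: "\<And>s. s \<in> A \<Longrightarrow> \<phi> k0 s = v" by (auto simp: constant_on_def)
    hence "v = \<phi> k0 (sk k0)" using sk(1)[of k0] KA by auto
    thus ?case using v k0 by auto
  next
    case (Suc l)
    then obtain v where v: "norm v = M" "\<And>s. s \<in> A \<Longrightarrow> \<phi> (k0 + int l) s = v" "v = \<phi> k0 (sk k0)" by blast
    have cA: "of_real c \<in> A" using Kne KA by auto
    have qc: "q * of_real c \<in> Kc" using c0 Q cq' by (auto simp: Kc_def norm_mult)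
    have "\<phi> (k0 + int l + 1) (q * of_real c) = v" using shift[OF cA, of "k0 + int l"] v(2)[OF cA] qc KA by auto
    hence e: "\<phi> (k0 + int (Suc l)) (q * of_real c) = v" by (simp add: add_ac)
    hence "\<phi> (k0 + int (Suc l)) constant_on A" using const_if[of "q * of_real c"] qc KU v(1) by auto
    then obtain w where w: "\<And>s. s \<in> A \<Longrightarrow> \<phi> (k0 + int (Suc l)) s = w" by (auto simp: constant_on_def)
    have "w = v" using w[of "q * of_real c"] qc KA e by auto
    thus ?case using w v by auto
  qed
  have all: "\<phi> k s = \<phi> k0 (sk k0)" if "s \<in> A" for k s
  proof -
    define l where "l = nat ((k - k0) mod int r)"
    have "(k0 + int l) mod int r = k mod int r" using r by (simp add: l_def mod_simps)
    hence "\<phi> k s = \<phi> (k0 + int l) s" using per'[OF that, of k] per'[OF that, of "k0 + int l"] by simp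
    also have "\<dots> = \<phi> k0 (sk k0)" using step[of l] that by auto
    finally show ?thesis .
  qed
  have "1 \<in> A" using t[OF ij(1)] t[OF ij(2)] by (auto simp: A_def ann_def)
  moreover have "\<phi> 0 1 = \<Phi> t n" by (simp add: \<phi>_def tw_def nw_def)
  ultimately have "\<phi> k s = \<Phi> t n" using all[of s k] all[of 1 0] s by (simp add: A_def)
  thus ?thesis by (simp add: \<phi>_def)
qed

text \<open>Analytic continuation: shrinking one parameter of a small subset at the expense
  of another one turns a small subset of size $k + 1$ into one of size $k$.\<close>

lemma \<Phi>_continuation_step:
  assumes hyp: "\<And>t n B. adm t n \<Longrightarrow> B \<subseteq> I \<Longrightarrow> card B = k \<Longrightarrow> norm (\<Prod>a\<in>B. t a) < norm q \<Longrightarrow> \<Phi> t n = w"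
    and k: "k \<ge> 1"
    and adm: "adm t n" and B: "B \<subseteq> I" "card B = Suc k" "norm (\<Prod>a\<in>B. t a) < norm q"
  shows "\<Phi> t n = w"
proof -
  have t: "\<And>a. a \<in> I \<Longrightarrow> t a \<noteq> 0 \<and> norm (t a) < 1" using adm by (auto simp: adm_def)
  have fB: "finite B" using B I finite_subset by blast
  obtain j where j: "j \<in> B" using B(2) by fastforce
  have "card (B - {j}) = k" using B(2) j fB by simp
  then obtain i where i: "i \<in> B" "i \<noteq> j" using k by (metis DiffE card.empty ex_in_conv not_one_le_zero singletonI)
  have ij: "i \<in> I" "j \<in> I" "i \<noteq> j" using i j B by auto
  define A where "A = ann t i j"
  define B' where "B' = B - {j}"
  have B': "B' \<subseteq> I" "card B' = k" "i \<in> B'" "finite B'" using B i j fB by (auto simp: B'_def)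
  define X where "X = (\<Prod>a\<in>B'. t a)"
  have X0: "X \<noteq> 0" unfolding X_def using t B' by (auto simp: prod_zero_iff)
  have PX: "(\<Prod>a\<in>B. t a) = t j * X" unfolding X_def B'_def using fB j by (simp add: prod.remove)
  \<comment> \<open>For these s the subset without j already has a product of modulus less than |q|,
    so the hypothesis for size k applies. The set is nonempty because the full subset is
    small.\<close>
  define A' :: "complex set" where "A' = {s. norm (t j) < norm s \<and> norm s < min (1 / norm (t i)) (norm q / norm X)}"
  have A'A: "A' \<subseteq> A" by (auto simp: A'_def A_def ann_def)
  have A'_open: "open A'"
  proof -
    have "A' = {s. norm (t j) < norm s} \<inter> {s. norm s < min (1 / norm (t i)) (norm q / norm X)}" by (auto simp: A'_def)
    also have "open \<dots>" by (intro open_Int open_Collect_less continuous_intros)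
    finally show ?thesis .
  qed
  have "norm (t j) < min (1 / norm (t i)) (norm q / norm X)"
  proof -
    have "norm (t j) * norm (t i) < 1 * 1" using t ij by (intro mult_strict_mono') auto
    moreover have "norm (t j) * norm X < norm q" using B(3) unfolding PX by (simp add: norm_mult)
    ultimately show ?thesis using t[OF ij(1)] X0 by (simp add: field_simps)
  qed
  then obtain c where c: "norm (t j) < c" "c < min (1 / norm (t i)) (norm q / norm X)" using dense by blast
  have cA': "of_real c \<in> A'" using c by (auto simp: A'_def abs_of_pos order.strict_trans1[OF norm_ge_zero])
  have val: "\<Phi> (tw t i j s) n = w" if s: "s \<in> A'" for s
  proof (rule hyp[OF _ B'(1,2)])
    show "adm (tw t i j s) n" using adm_tw[OF adm ij, of s 0] s A'A by (auto simp: nw_def A_def)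
    have "(\<Prod>a\<in>B'. tw t i j s a) = tw t i j s i * (\<Prod>a\<in>B' - {i}. tw t i j s a)"
      using B' by (simp add: prod.remove)
    also have "(\<Prod>a\<in>B' - {i}. tw t i j s a) = (\<Prod>a\<in>B' - {i}. t a)"
      by (intro prod.cong) (auto simp: tw_def B'_def)
    also have "tw t i j s i * \<dots> = s * X"
      unfolding X_def using B' ij by (simp add: prod.remove[of B' i] tw_def)
    finally show "norm (\<Prod>a\<in>B'. tw t i j s a) < norm q"
      using s X0 by (simp add: A'_def norm_mult field_simps)
  qed
  have "1 \<in> A" using t[OF ij(1)] t[OF ij(2)] by (auto simp: A_def ann_def)
  have "\<Phi> (tw t i j 1) n = w"
  proof (rule analytic_continuation_open[of A' A "\<lambda>s. \<Phi> (tw t i j s) n" "\<lambda>_. w"])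
    show "(\<lambda>s. \<Phi> (tw t i j s) n) holomorphic_on A" unfolding A_def by (rule \<Phi>_holomorphic[OF adm ij])
    show "A' \<noteq> {}" using cA' by auto
  qed (use A'_open A'A val \<open>1 \<in> A\<close> in \<open>auto simp: A_def ann_open ann_connected\<close>)
  thus ?thesis by (simp add: tw_def)
qed

text \<open>Some |t a| exceeds |p|: otherwise |p q| <= |p|^6 < |p|^2 <= |p q|, the last inequality
  by |p| <= |q|. So the other five parameters have a product of modulus less than |q|, and the
  continuation step descends from five to two.\<close>

theorem \<Phi>_eq_if_pairs:
  assumes hyp: "\<And>t n i j. adm t n \<Longrightarrow> i \<in> I \<Longrightarrow> j \<in> I \<Longrightarrow> i \<noteq> j \<Longrightarrow> norm (t i * t j) < norm q \<Longrightarrow> \<Phi> t n = w"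
    and pq: "norm p \<le> norm q" and adm: "adm t n"
  shows "\<Phi> t n = w"
proof -
  have t: "\<And>a. a \<in> I \<Longrightarrow> t a \<noteq> 0 \<and> norm (t a) < 1" and tp: "(\<Prod>a\<in>I. t a) = p * q"
    using adm by (auto simp: adm_def)
  have h2: "\<Phi> t n = w" if h: "adm t n" "B \<subseteq> I" "card B = 2" "norm (\<Prod>a\<in>B. t a) < norm q" for t n B
  proof -
    obtain i j where "B = {i, j}" "i \<noteq> j" using h(3) by (auto simp: card_2_iff)
    thus ?thesis using hyp[OF h(1), of i j] h by auto
  qed
  have hk: "2 \<le> k \<Longrightarrow> adm t n \<Longrightarrow> B \<subseteq> I \<Longrightarrow> card B = k \<Longrightarrow> norm (\<Prod>a\<in>B. t a) < norm q \<Longrightarrow> \<Phi> t n = w"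
    for k t n B
  proof (induction k arbitrary: t n B rule: dec_induct)
    case base
    thus ?case by (rule h2)
  next
    case (step k)
    show ?case by (rule \<Phi>_continuation_step[OF step.IH _ step.prems]) (use step.hyps in auto)
  qed
  have "\<exists>a\<in>I. norm p < norm (t a)"
  proof (rule ccontr)
    assume "\<not> ?thesis"
    hence le: "\<And>a. a \<in> I \<Longrightarrow> norm (t a) \<le> norm p" by force
    have "norm p * norm q = (\<Prod>a\<in>I. norm (t a))" using tp by (metis norm_mult prod_norm)
    also have "\<dots> \<le> (\<Prod>a\<in>I. norm p)" by (intro prod_mono) (use le in auto)
    also have "\<dots> = norm p ^ 6" using I by simp
    also have "\<dots> < norm p ^ 2" using p0 p1 by (intro power_strict_decreasing) auto
    also have "\<dots> \<le> norm p * norm q" using pq by (simp add: power2_eq_square mult_left_mono)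
    finally show False by simp
  qed
  then obtain a where a: "a \<in> I" "norm p < norm (t a)" by blast
  have "p * q = t a * (\<Prod>b\<in>I - {a}. t b)" using tp I a by (simp add: prod.remove)
  hence "norm p * norm q = norm (t a) * norm (\<Prod>b\<in>I - {a}. t b)" by (metis norm_mult)
  moreover have "norm p * norm q < norm (t a) * norm q" using a q0 by (intro mult_strict_right_mono) auto
  ultimately have "norm (\<Prod>b\<in>I - {a}. t b) < norm q" using t[OF a(1)] by (simp add: mult_less_cancel_left)
  moreover have "card (I - {a}) = 5" using I a by simp
  ultimately show ?thesis using hk[of 5 t n "I - {a}"] adm by auto
qed

end

section \<open>The limit of pinching poles\<close>

text \<open>The mean of z / (z - w) is the winding number of the circle about w. It is computed by
  passing to 1/z, which moves the pole outside, and shrinking the circle to the origin.\<close>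

lemma avg_kernel_outside:
  assumes "norm w < 1"
  shows "avg (\<lambda>z. 1 / (1 - w / z)) = 1"
proof -
  have "avg (\<lambda>z. 1 / (1 - w / (1 / z))) = avg (\<lambda>z. 1 / (1 - w / z))"
    by (rule avg_reciprocal) (use assms in \<open>auto intro!: continuous_intros\<close>)
  hence "avg (\<lambda>z. 1 / (1 - w / z)) = avg (\<lambda>z. 1 / (1 - w * z))" by simp
  also have "avg (\<lambda>z. 1 / (1 - w * z)) = 1"
  proof -
    define A where "A = (if w = 0 then UNIV else ball (0::complex) (1 / norm w))"
    have A: "open A" "connected A" "1 \<in> A" "0 \<in> A" using assms by (auto simp: A_def convex_connected)
    have "1 - w * z \<noteq> 0" if "z \<in> A" for z
    proof (cases "w = 0")
      case False
      hence "norm (w * z) < 1" using that by (simp add: A_def norm_mult field_simps)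
      thus ?thesis by (metis eq_iff_diff_eq_0 less_irrefl norm_one)
    qed auto
    hence "(\<lambda>z. 1 / (1 - w * z)) holomorphic_on A" by (intro holomorphic_intros) auto
    moreover have "c * z \<in> A" if "c \<in> A" "norm z = 1" for c z
      using that by (auto simp: A_def norm_mult split: if_splits)
    ultimately have "avg (\<lambda>z. 1 / (1 - w * (1 * z))) = avg (\<lambda>z. 1 / (1 - w * (0 * z)))"
      using avg_dilation_const[OF A(1,2) _ _ A(3,4), of "\<lambda>z. 1 / (1 - w * z)"] by blast
    thus ?thesis by (simp add: avg_const)
  qed
  finally show ?thesis .
qed

lemma avg_kernel_inside:
  assumes "norm w > 1"
  shows "avg (\<lambda>z. 1 / (1 - w / z)) = 0"
proof -
  have w0: "w \<noteq> 0" using assms by auto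
  have nz: False if "norm z = 1" "z * w = 1" for z
  proof -
    have "norm z * norm w = 1" using that(2) by (metis norm_mult norm_one)
    thus False using that assms by simp
  qed
  have "avg (\<lambda>z. 1 / (1 - w / z)) = avg (\<lambda>z. 1 - 1 / (1 - (1 / w) / (1 / z)))"
  proof (rule avg_cong)
    fix z :: complex assume z: "norm z = 1"
    hence "z \<noteq> 0" "z \<noteq> w" using assms by auto
    thus "1 / (1 - w / z) = 1 - 1 / (1 - (1 / w) / (1 / z))"
      using w0 by (simp add: divide_simps) (simp add: algebra_simps)
  qed
  also have "\<dots> = avg (\<lambda>z. 1 - 1 / (1 - (1 / w) / z))"
    by (rule avg_reciprocal) (use w0 in \<open>auto intro!: continuous_intros dest: nz simp: field_simps\<close>)
  also have "\<dots> = avg (\<lambda>_. 1) - avg (\<lambda>z. 1 / (1 - (1 / w) / z))"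
    by (rule avg_diff) (use w0 in \<open>auto intro!: continuous_intros dest: nz simp: field_simps\<close>)
  also have "avg (\<lambda>z. 1 / (1 - (1 / w) / z)) = 1"
    using assms w0 by (intro avg_kernel_outside) (simp add: norm_divide divide_less_eq)
  finally show ?thesis by (simp add: avg_const)
qed

text \<open>A residue theorem for two poles of order at most one. Subtracting multiples of the
  kernel z / (z - w) removes both, the remainder has the same mean on both circles, and each kernel
  drops from mean 1 to mean 0. The limits may be 0, so that regular points are covered.\<close>

lemma avg_pole_shift:
  fixes f :: "complex \<Rightarrow> complex"
  assumes ab: "0 < a" "a < \<rho>" "\<rho> < norm z1" "\<rho> < norm z2" "norm z1 < 1" "norm z2 < 1" "1 < b" "z1 \<noteq> z2"
    and f: "f holomorphic_on {z. a < norm z \<and> norm z < b} - {z1, z2}"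
    and l1: "((\<lambda>z. (1 - z1 / z) * f z) \<longlongrightarrow> c1) (at z1)" and l2: "((\<lambda>z. (1 - z2 / z) * f z) \<longlongrightarrow> c2) (at z2)"
  shows "avg f = avg (\<lambda>z. f (of_real \<rho> * z)) + c1 + c2"
proof -
  define A where "A = {z :: complex. a < norm z \<and> norm z < b}"
  have A: "open A" "connected A"
  proof -
    have "A = {z. a < norm (z - 0) \<and> norm (z - 0) < b}" by (simp add: A_def)
    also have "connected \<dots>" by (rule connected_annulus) simp
    finally show "connected A" .
    have "A = {z. a < norm z} \<inter> {z. norm z < b}" by (auto simp: A_def)
    also have "open \<dots>" by (intro open_Int open_Collect_less continuous_intros)
    finally show "open A" .
  qed
  have zA: "z1 \<in> A" "z2 \<in> A" "1 \<in> A" "of_real \<rho> \<in> A" using ab by (auto simp: A_def)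
  have z0: "z1 \<noteq> 0" "z2 \<noteq> 0" using ab by auto
  have A0: "z \<noteq> 0" if "z \<in> A" for z using that ab by (auto simp: A_def)
  define k where "k = (\<lambda>w z. 1 / (1 - w / z) :: complex)"
  define g where "g = (\<lambda>z. f z - c1 * k z1 z - c2 * k z2 z)"
  have k_nz: "1 - w / z \<noteq> 0" if "z \<noteq> w" "z \<noteq> 0" for w z :: complex using that by (simp add: field_simps)
  have g_holo: "g holomorphic_on A - {z1} - {z2}"
  proof -
    have "f holomorphic_on A - {z1} - {z2}" by (rule holomorphic_on_subset[OF f]) (auto simp: A_def)
    thus ?thesis unfolding g_def k_def by (intro holomorphic_intros) (use A0 k_nz in auto)
  qed
  have key: "((\<lambda>z. (z - w) * g z) \<longlongrightarrow> 0) (at w)"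
    if l: "((\<lambda>z. (1 - w / z) * f z) \<longlongrightarrow> c) (at w)" and w: "w \<noteq> 0" "w' \<noteq> w"
      and g: "\<And>z. g z = f z - c * k w z - c' * k w' z" for w w' c c'
  proof -
    have "((\<lambda>z. z * ((1 - w / z) * f z - c) - (z - w) * (c' * k w' z)) \<longlongrightarrow> w * (c - c) - (w - w) * (c' * (1 / (1 - w' / w)))) (at w)"
      unfolding k_def by (intro tendsto_intros l) (use w k_nz[of w w'] in auto)
    moreover have "eventually (\<lambda>z. z * ((1 - w / z) * f z - c) - (z - w) * (c' * k w' z) = (z - w) * g z) (at w)"
    proof -
      have "eventually (\<lambda>z. z \<noteq> 0) (at w)" using w tendsto_imp_eventually_ne[OF tendsto_ident_at] by blast
      moreover have "eventually (\<lambda>z. z \<noteq> w) (at w)" by (simp add: eventually_at_filter)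
      ultimately show ?thesis
      proof eventually_elim
        case (elim z)
        have "z * (1 - w / z) = z - w" "(z - w) * k w z = z" using elim by (simp_all add: k_def field_simps)
        moreover have "z * ((1 - w / z) * f z - c) - (z - w) * (c' * k w' z) = z * (1 - w / z) * f z - c * z - (z - w) * (c' * k w' z)"
          by (simp add: algebra_simps)
        moreover have "(z - w) * g z = (z - w) * f z - c * ((z - w) * k w z) - (z - w) * (c' * k w' z)"
          unfolding g by (simp add: algebra_simps)
        ultimately show ?case by simp
      qed
    qed
    ultimately show ?thesis by (simp add: tendsto_cong)
  qed
  have lim1: "((\<lambda>z. (z - z1) * g z) \<longlongrightarrow> 0) (at z1)"
    by (rule key[OF l1 z0(1)]) (use ab in \<open>auto simp: g_def\<close>)
  have lim2: "((\<lambda>z. (z - z2) * g z) \<longlongrightarrow> 0) (at z2)"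
    by (rule key[OF l2 z0(2)]) (use ab in \<open>auto simp: g_def\<close>)
  have op1: "open (A - {z1})" using A(1) by (simp add: open_delete)
  obtain g1 where g1: "g1 holomorphic_on A - {z1}" "\<And>z. z \<in> A - {z1} - {z2} \<Longrightarrow> g1 z = g z"
    using holomorphic_on_extend_lim[OF g_holo] lim2 op1 zA ab(8) by (auto simp: interior_open)
  have "((\<lambda>z. (z - z1) * g1 z) \<longlongrightarrow> 0) (at z1)"
  proof (rule Lim_transform_within_open[OF lim1])
    show "open (A - {z2})" using A(1) by (simp add: open_delete)
  qed (use zA ab(8) g1(2) in auto)
  then obtain g2 where g2: "g2 holomorphic_on A" "\<And>z. z \<in> A - {z1} \<Longrightarrow> g2 z = g1 z"
    using holomorphic_on_extend_lim[OF g1(1)] A(1) zA by (auto simp: interior_open)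
  have g2_eq: "g2 z = g z" if "z \<in> A" "z \<noteq> z1" "z \<noteq> z2" for z using g1 g2 that by auto
  have shift: "avg (\<lambda>z. g2 (1 * z)) = avg (\<lambda>z. g2 (of_real \<rho> * z))"
    by (rule avg_dilation_const[OF A _ g2(1) zA(3,4)]) (auto simp: A_def norm_mult)
  have sph: "z \<in> A" "z \<noteq> z1" "z \<noteq> z2" if "norm z = 1" for z using that ab by (auto simp: A_def)
  have sph\<rho>: "of_real \<rho> * z \<in> A" "of_real \<rho> * z \<noteq> z1" "of_real \<rho> * z \<noteq> z2" if "norm z = 1" for z
    using that ab by (auto simp: A_def norm_mult)
  have fc: "continuous_on (A - {z1, z2}) f" using f holomorphic_on_imp_continuous_on by (auto simp: A_def)
  have kc: "continuous_on (A - {z1, z2}) (k z1)" "continuous_on (A - {z1, z2}) (k z2)"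
    unfolding k_def using A0 k_nz by (auto intro!: continuous_intros)
  have "avg g = avg f - c1 - c2"
  proof -
    have c: "continuous_on (sphere 0 1) h" if "continuous_on (A - {z1, z2}) h" for h :: "complex \<Rightarrow> complex"
      by (rule continuous_on_subset[OF that]) (use sph(1) ab in auto)
    have "avg g = avg (\<lambda>z. f z - c1 * k z1 z) - avg (\<lambda>z. c2 * k z2 z)"
      unfolding g_def by (intro avg_diff continuous_intros c fc kc)
    also have "avg (\<lambda>z. f z - c1 * k z1 z) = avg f - avg (\<lambda>z. c1 * k z1 z)"
      by (intro avg_diff continuous_intros c fc kc)
    finally show ?thesis unfolding avg_cmult using ab by (simp add: k_def avg_kernel_outside)
  qed
  moreover have "avg (\<lambda>z. g (of_real \<rho> * z)) = avg (\<lambda>z. f (of_real \<rho> * z))"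
  proof -
    have c: "continuous_on (sphere 0 1) (\<lambda>z. h (of_real \<rho> * z))" if "continuous_on (A - {z1, z2}) h" for h :: "complex \<Rightarrow> complex"
    proof (rule continuous_on_compose2[OF that])
      show "(\<lambda>z. complex_of_real \<rho> * z) ` sphere 0 1 \<subseteq> A - {z1, z2}"
      proof
        fix y assume "y \<in> (\<lambda>z. complex_of_real \<rho> * z) ` sphere 0 1"
        then obtain z where "norm z = 1" "y = of_real \<rho> * z" by auto
        thus "y \<in> A - {z1, z2}" using sph\<rho>[of z] by blast
      qed
    qed (intro continuous_intros)
    have k0: "avg (\<lambda>z. k w (of_real \<rho> * z)) = 0" if "\<rho> < norm w" for w
    proof -
      have "avg (\<lambda>z. k w (of_real \<rho> * z)) = avg (\<lambda>z. 1 / (1 - (w / of_real \<rho>) / z))"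
        unfolding k_def by (simp add: divide_divide_eq_left)
      also have "\<dots> = 0" using that ab by (intro avg_kernel_inside) (simp add: norm_divide)
      finally show ?thesis .
    qed
    have "avg (\<lambda>z. g (of_real \<rho> * z)) = avg (\<lambda>z. f (of_real \<rho> * z) - c1 * k z1 (of_real \<rho> * z)) - avg (\<lambda>z. c2 * k z2 (of_real \<rho> * z))"
      unfolding g_def by (intro avg_diff continuous_intros c fc kc)
    also have "avg (\<lambda>z. f (of_real \<rho> * z) - c1 * k z1 (of_real \<rho> * z)) = avg (\<lambda>z. f (of_real \<rho> * z)) - avg (\<lambda>z. c1 * k z1 (of_real \<rho> * z))"
      by (intro avg_diff continuous_intros c fc kc)
    finally show ?thesis unfolding avg_cmult using k0 ab by simp
  qed
  moreover have "avg g = avg (\<lambda>z. g2 (1 * z))" using g2_eq sph by (intro avg_cong) auto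
  moreover have "avg (\<lambda>z. g (of_real \<rho> * z)) = avg (\<lambda>z. g2 (of_real \<rho> * z))"
    using g2_eq sph\<rho> by (intro avg_cong) auto
  ultimately show ?thesis using shift by (simp add: algebra_simps)
qed

section \<open>Residue at 1 and regularity across the unit circle\<close>

context rarefied
begin

text \<open>Only the factor 1 - w of the denominator vanishes at 1. The recursions in both nomes
  cancel all the double products in the value of the cofactor \<open>F\<close> at 1.\<close>

lemma rgamma_0_residue:
  "((\<lambda>w. (1 - w) * rgamma r p q w 0) \<longlongrightarrow> 1 / (qpoch_inf (p ^ r) (p ^ r) * qpoch_inf (q ^ r) (q ^ r))) (at 1)"
proof -
  define P where "P = p ^ r"
  define S where "S = q ^ r"
  define Q where "Q = p * q"
  have n: "norm P < 1" "norm S < 1" "norm Q < 1" using P1 S1 Q1 by (auto simp: P_def S_def Q_def)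
  define F where "F = (\<lambda>w. dpoch P Q (Q * P / w) * dpoch S Q (Q / w) / (qpoch_inf (w * Q) Q * dpoch P Q (w * P) * dpoch S Q (w * S)))"
  have lt: "norm (x * y) < 1" if "norm x < 1" "norm y < 1" for x y :: complex
    using mult_strict_mono'[of "norm x" 1 "norm y" 1] that by (simp add: norm_mult)
  have dc: "isCont (dpoch P Q) z" "isCont (dpoch S Q) z" "isCont (\<lambda>w. qpoch_inf w Q) z" for z
    using holomorphic_on_imp_continuous_on[OF dpoch_holomorphic[OF n(1,3), of UNIV]]
      holomorphic_on_imp_continuous_on[OF dpoch_holomorphic[OF n(2,3), of UNIV]]
      holomorphic_on_imp_continuous_on[OF qpoch_inf_holomorphic[OF n(3), of UNIV]]
    by (auto simp: continuous_on_eq_continuous_at)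
  have nz: "qpoch_inf Q Q \<noteq> 0" "dpoch P Q P \<noteq> 0" "dpoch S Q S \<noteq> 0" "dpoch P Q (P * Q) \<noteq> 0" "dpoch S Q (S * Q) \<noteq> 0"
    by (rule qpoch_inf_nonzero dpoch_nonzero; use n lt in blast)+
  have "F \<midarrow>1\<rightarrow> F 1"
    unfolding F_def by (intro tendsto_intros isCont_tendsto_compose[OF dc(1)] isCont_tendsto_compose[OF dc(2)] isCont_tendsto_compose[OF dc(3)])
       (use nz in auto)
  moreover have "F 1 = 1 / (qpoch_inf P P * qpoch_inf S S)"
  proof -
    have "dpoch P Q P = qpoch_inf P P * dpoch P Q (P * Q)" "dpoch S Q S = qpoch_inf S S * dpoch S Q (S * Q)"
      using n by (auto intro!: dpoch_rec2)
    moreover have "dpoch S Q Q = qpoch_inf Q Q * dpoch S Q (Q * S)" using n by (intro dpoch_rec1)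
    ultimately show ?thesis using nz by (simp add: F_def mult.commute)
  qed
  moreover have "eventually (\<lambda>w. F w = (1 - w) * rgamma r p q w 0) (at 1)"
    using eventually_rgamma_eq[OF one_neq_zero, of 0] eventually_nz_at[OF one_neq_zero]
      eventually_rg_den_nonzero[of 0 1]
  proof eventually_elim
    case (elim w)
    have num: "rg_den r p q (p * q / w) (int r - 0) = dpoch P Q (Q * P / w) * dpoch S Q (Q / w)"
      by (simp add: rg_den_def P_def Q_def S_def)
    have "dpoch P Q w = (1 - w) * qpoch_inf (w * Q) Q * dpoch P Q (w * P)"
      using dpoch_rec1[OF n(1,3), of w] qpoch_inf_rec[OF n(3), of w] by simp
    hence den: "rg_den r p q w 0 = (1 - w) * (qpoch_inf (w * Q) Q * dpoch P Q (w * P) * dpoch S Q (w * S))"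
      by (simp add: rg_den_def P_def Q_def S_def mult_ac)
    have "1 - w \<noteq> 0" using den elim by auto
    thus ?case using elim(1) unfolding rg_quot_def num den F_def by (simp add: rg_pref_def)
  qed
  ultimately show ?thesis unfolding P_def S_def by (simp add: tendsto_cong)
qed

text \<open>The point -1 is its own inverse and lies where \<open>rgamma\<close> is analytic for
  every index. It is the limit of z^2 at the pinching poles, which tend to \<plusminus>i.\<close>

lemma weyl_minus_1: "rgamma r p q (- 1) m * rgamma r p q (- 1) (- m) * weyl (- 1) m = 1"
proof -
  have an: "isCont (\<lambda>w. rgamma r p q w k) (- 1)" for k
    by (intro analytic_at_imp_isCont rgamma_analytic) (use one_less_radius in auto)
  have "isCont (\<lambda>w. rgamma r p q w m * rgamma r p q (1 / w) (- m) * weyl w m) (- 1)"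
  proof (intro continuous_intros an analytic_at_imp_isCont[OF weyl_analytic])
    show "isCont (\<lambda>w. rgamma r p q (1 / w) (- m)) (- 1)"
      by (rule isCont_o2[of _ "\<lambda>w. 1 / w"]) (auto intro!: continuous_intros an)
  qed auto
  from eventually_at_eq_imp_eq[OF this continuous_const eventually_weyl[of "-1" m]] show ?thesis by simp
qed

text \<open>A disc larger than the unit disc, so that parameters may reach the circle. The point 1
  is removed because \<open>rgamma\<close> can have a pole there when r divides the index.\<close>

definition analytic_region :: "complex set" where
  "analytic_region = {w. w \<noteq> 0 \<and> norm w < 1 / max (norm p) (norm q) \<and> w \<noteq> 1}"

lemma continuous_on_rgamma_region:
  assumes "continuous_on A f" "\<And>z. z \<in> A \<Longrightarrow> f z \<in> analytic_region"
  shows "continuous_on A (\<lambda>z. rgamma r p q (f z) k)"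
proof -
  have "continuous_on analytic_region (\<lambda>z. rgamma r p q z k)"
    by (intro continuous_at_imp_continuous_on)
       (auto simp: analytic_region_def intro!: analytic_at_imp_isCont rgamma_analytic)
  thus ?thesis by (rule continuous_on_compose2) (use assms in auto)
qed

lemma rgamma_holomorphic_region:
  assumes "f holomorphic_on A" "\<And>z. z \<in> A \<Longrightarrow> f z \<in> analytic_region"
  shows "(\<lambda>z. rgamma r p q (f z) k) holomorphic_on A"
proof -
  have "(\<lambda>z. rgamma r p q z k) holomorphic_on analytic_region"
    by (rule analytic_imp_holomorphic, subst analytic_on_analytic_at)
       (auto simp: analytic_region_def intro!: rgamma_analytic)
  from holomorphic_on_compose_gen[OF assms(1) this, of] assms(2) show ?thesis
    by (auto simp: o_def image_subset_iff)
qed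

lemma tendsto_rgamma_region:
  assumes "(f \<longlongrightarrow> w) F" "w \<in> analytic_region"
  shows "((\<lambda>x. rgamma r p q (f x) k) \<longlongrightarrow> rgamma r p q w k) F"
  by (rule isCont_tendsto_compose[OF _ assms(1)])
     (use assms(2) in \<open>auto simp: analytic_region_def intro!: analytic_at_imp_isCont rgamma_analytic\<close>)

lemma disc_in_region: "w \<noteq> 0 \<Longrightarrow> norm w < 1 \<Longrightarrow> w \<in> analytic_region"
  using one_less_radius by (auto simp: analytic_region_def)

lemma minus_1_in_region: "- 1 \<in> analytic_region"
  using one_less_radius by (auto simp: analytic_region_def)

lemma tendsto_weyl:
  assumes "(f \<longlongrightarrow> w) F" "w \<noteq> 0"
  shows "((\<lambda>x. weyl (f x) k) \<longlongrightarrow> weyl w k) F"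
  by (rule isCont_tendsto_compose[OF _ assms(1)]) (intro analytic_at_imp_isCont weyl_analytic assms)

lemma weyl_holomorphic:
  assumes "f holomorphic_on A" "\<And>z. z \<in> A \<Longrightarrow> f z \<noteq> 0"
  shows "(\<lambda>z. weyl (f z) k) holomorphic_on A"
proof -
  have "(\<lambda>z. weyl z k) holomorphic_on -{0}"
    by (rule analytic_imp_holomorphic, subst analytic_on_analytic_at) (auto intro!: weyl_analytic)
  hence "((\<lambda>z. weyl z k) \<circ> f) holomorphic_on A"
    by (rule holomorphic_on_compose_gen[OF assms(1)]) (use assms(2) in auto)
  thus ?thesis by (simp add: o_def)
qed

text \<open>The residue constant of \<open>rgamma\<close> at 1 for index 0; the product of
  \<open>kappa r p q\<close>, 2 pi i and 2 \<open>c_res\<close> is 1.\<close>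

definition c_res :: complex where
  "c_res = 1 / (qpoch_inf (p ^ r) (p ^ r) * qpoch_inf (q ^ r) (q ^ r))"

lemma c_res_nonzero: "c_res \<noteq> 0"
  using P1 S1 by (auto simp: c_res_def qpoch_inf_nonzero)

text \<open>Strictly between - r and r only the index 0 is divisible by r, so for the other indices
  there is no pole at 1. This selects the values of m that contribute to the pinch.\<close>

lemma rgamma_residue:
  assumes "(f \<longlongrightarrow> 1) F" "eventually (\<lambda>x. f x \<noteq> 1) F" "- int r < k" "k < int r"
  shows "((\<lambda>x. (1 - f x) * rgamma r p q (f x) k) \<longlongrightarrow> (if k = 0 then c_res else 0)) F"
proof -
  have "((\<lambda>w. (1 - w) * rgamma r p q w k) \<longlongrightarrow> (if k = 0 then c_res else 0)) (at 1)"
  proof (cases "k = 0")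
    case True
    thus ?thesis using rgamma_0_residue by (simp add: c_res_def)
  next
    case False
    hence "\<not> int r dvd k" using assms(3,4) dvd_imp_le_int[of k "int r"] by auto
    hence "isCont (\<lambda>w. rgamma r p q w k) 1"
      using one_less_radius by (intro analytic_at_imp_isCont rgamma_analytic) auto
    hence "((\<lambda>w. (1 - w) * rgamma r p q w k) \<longlongrightarrow> (1 - 1) * rgamma r p q 1 k) (at 1)"
      by (intro tendsto_intros) (simp add: isCont_def)
    thus ?thesis using False by simp
  qed
  moreover have "filterlim f (at 1) F" using assms(1,2) by (simp add: filterlim_at)
  ultimately show ?thesis by (rule filterlim_compose)
qed

end

context rarefied_params
begin

text \<open>The six pairs from four parameters form three complementary couples; in each the
  products multiply to p q and the indices sum to 0, so the reflection formula cancels them.\<close>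

lemma pair_prod_reflect:
  assumes K: "card K = 4" and t: "\<And>a. a \<in> K \<Longrightarrow> t a \<noteq> 0 \<and> norm (t a) < 1"
    and tp: "(\<Prod>a\<in>K. t a) = p * q" and n: "(\<Sum>a\<in>K. n a) = - 2 * \<epsilon>"
  shows "pair_prod K (\<lambda>a b. rgamma r p q (t a * t b) (n a + n b + \<epsilon>)) = 1"
proof -
  define g where "g = (\<lambda>a b. rgamma r p q (t a * t b) (n a + n b + \<epsilon>))"
  have sym: "g a b = g b a" for a b by (simp add: g_def mult.commute add_ac)
  obtain a b c d where Ke: "K = {a, b, c, d}" and dist: "a \<noteq> b" "a \<noteq> c" "a \<noteq> d" "b \<noteq> c" "b \<noteq> d" "c \<noteq> d"
    using K by (auto simp: card_Suc_eq numeral_eq_Suc)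
  have key: "g a b * g c d = 1" if "t a * t b * (t c * t d) = p * q" "n a + n b + n c + n d = - 2 * \<epsilon>"
    "a \<in> K" "b \<in> K" "c \<in> K" "d \<in> K" for a b c d
  proof -
    have nz: "t a * t b \<noteq> 0" using t that by auto
    have l: "norm (t x * t y) < 1" if "x \<in> K" "y \<in> K" for x y
      using mult_strict_mono'[of "norm (t x)" 1 "norm (t y)" 1] t that by (simp add: norm_mult)
    have "norm (p * q) = norm (t a * t b) * norm (t c * t d)" unfolding that(1)[symmetric] by (simp add: norm_mult)
    also have "\<dots> < norm (t a * t b) * 1" using l[OF that(5,6)] nz by (intro mult_strict_left_mono) auto
    finally have "norm (p * q) < norm (t a * t b)" by simp
    from rgamma_reflect[OF this l[OF that(3,4)], of "n a + n b + \<epsilon>"]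
    have "rgamma r p q (t a * t b) (n a + n b + \<epsilon>) * rgamma r p q (p * q / (t a * t b)) (- (n a + n b + \<epsilon>)) = 1" .
    moreover have "p * q / (t a * t b) = t c * t d" unfolding that(1)[symmetric] using nz by simp
    moreover have "- (n a + n b + \<epsilon>) = n c + n d + \<epsilon>" using that(2) by simp
    ultimately show ?thesis unfolding g_def by (simp only:)
  qed
  have tt: "t a * t b * t c * t d = p * q" using tp dist by (simp add: Ke mult.assoc)
  have nn: "n a + n b + n c + n d = - 2 * \<epsilon>" using n dist by (simp add: Ke add.assoc)
  have "g a b * g c d = 1" "g a c * g b d = 1" "g a d * g b c = 1"
    by (rule key; use tt nn in \<open>simp add: Ke algebra_simps\<close>)+
  moreover have "pair_prod K g = (g a b * (g a c * g a d)) * ((g b c * g b d) * (g c d * 1))"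
    unfolding Ke using dist sym by (simp add: pair_prod_insert) (simp add: pair_prod_def)
  hence "pair_prod K g = (g a b * g c d) * (g a c * g b d) * (g a d * g b c)" by (simp add: mult_ac)
  ultimately show ?thesis unfolding g_def[symmetric] by simp
qed

text \<open>As $t_i t_l = x^2 \to 1$, the poles at $t_i$ and $t_l$ inside the circle meet those at
  $1/t_l$ and $1/t_i$ outside. The values $\mp\mathrm{i} x$ keep the pinch away from the points
  $z = \pm 1$, where \<^const>\<open>weyl\<close> vanishes.\<close>

lemma \<Phi>_pinch:
  fixes t :: "nat \<Rightarrow> complex"
  assumes ijl: "i \<in> I" "l \<in> I" "j \<in> I" "i \<noteq> l" "i \<noteq> j" "l \<noteq> j"
    and t: "\<And>a. a \<in> I - {i, l, j} \<Longrightarrow> t a \<noteq> 0 \<and> norm (t a) < 1"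
    and c: "c \<noteq> 0" "norm c < 1" and tp: "c * (\<Prod>a\<in>I - {i, l, j}. t a) = p * q"
    and ni: "n i = - \<epsilon>" and nl: "n l = 0" and n: "(\<Sum>a\<in>I. n a) + 3 * \<epsilon> = 0"
  defines "T \<equiv> \<lambda>x::real. t(i := - \<i> * of_real x, l := \<i> * of_real x, j := c / of_real x ^ 2)"
  shows "((\<lambda>x. \<Phi> (T x) n) \<longlongrightarrow> 2 * c_res) (at_left 1)"
proof -
  define K where "K = I - {i, l}"
  \<comment> \<open>The limits of the four parameters that are not pinched; they have product p
    q.\<close>
  define \<tau> where "\<tau> = t(j := c)"
  have K: "finite K" "card K = 4" "j \<in> K" using I ijl by (auto simp: K_def card_Diff_subset)
  have IK: "I - {i, l, j} = K - {j}" by (auto simp: K_def)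
  have \<tau>: "\<tau> a \<noteq> 0 \<and> norm (\<tau> a) < 1" if "a \<in> K" for a
    using t[of a] c that by (auto simp: \<tau>_def K_def)
  have \<tau>p: "(\<Prod>a\<in>K. \<tau> a) = p * q"
  proof -
    have "(\<Prod>a\<in>K. \<tau> a) = \<tau> j * (\<Prod>a\<in>K - {j}. \<tau> a)" using K by (simp add: prod.remove)
    also have "(\<Prod>a\<in>K - {j}. \<tau> a) = (\<Prod>a\<in>K - {j}. t a)" by (intro prod.cong) (auto simp: \<tau>_def)
    finally show ?thesis using tp by (simp add: \<tau>_def IK)
  qed
  have nK: "(\<Sum>a\<in>K. n a) = - 2 * \<epsilon>"
    using n sum_split2[OF ijl(1,2,4), of n] ni nl by (simp add: K_def)
  have Ti: "T x i = - \<i> * of_real x" and Tl: "T x l = \<i> * of_real x" and Tj: "T x j = c / of_real x ^ 2" for x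
    using ijl by (auto simp: T_def)
  have i_mult: "- \<i> * y * (\<i> * y) = y ^ 2" "\<i> * y * (- \<i> * y) = y ^ 2" "\<i> * y * (\<i> * y) = - (y ^ 2)" "- \<i> * y * (- \<i> * y) = - (y ^ 2)" for y
    by (simp_all add: complex_eq_iff power2_eq_square)
  have i_div: "y \<noteq> 0 \<Longrightarrow> - \<i> * y / (\<i> * y) = - 1" "y \<noteq> 0 \<Longrightarrow> \<i> * y / (- \<i> * y) = - 1" for y
    by simp_all
  have TT: "T x i * T x l = of_real x ^ 2" "T x l * T x i = of_real x ^ 2" "T x l * T x l = - (of_real x ^ 2)" "T x i * T x i = - (of_real x ^ 2)"
    "T x l ^ 2 = - (of_real x ^ 2)" "T x i ^ 2 = - (of_real x ^ 2)" for x
    unfolding Ti Tl by (rule i_mult | simp add: power_mult_distrib)+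
  have TT': "T x i / T x l = - 1" "T x l / T x i = - 1" if "x \<noteq> 0" for x
    unfolding Ti Tl using that by (intro i_div; simp)+
  have TK: "T x a = t a" "\<tau> a = t a" if "a \<in> K" "a \<noteq> j" for x a using that by (auto simp: T_def \<tau>_def K_def)
  have of_real_lim: "((\<lambda>x. complex_of_real x) \<longlongrightarrow> 1) (at_left 1)"
    using tendsto_of_real[OF tendsto_ident_at, of 1 "{..<1}"] by simp
  have TK_lim: "((\<lambda>x. T x a) \<longlongrightarrow> \<tau> a) (at_left 1)" if "a \<in> K" for a
  proof (cases "a = j")
    case True
    have "((\<lambda>x. c / of_real x ^ 2) \<longlongrightarrow> c / 1 ^ 2) (at_left 1)"
      by (intro tendsto_intros of_real_lim) auto
    thus ?thesis using True by (simp add: Tj \<tau>_def)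
  qed (use that in \<open>simp add: TK\<close>)
  have xx_lim: "((\<lambda>x. of_real x ^ 2 :: complex) \<longlongrightarrow> 1) (at_left 1)"
    using tendsto_power[OF of_real_lim, of 2] by simp
  have x1: "eventually (\<lambda>x. x < 1 \<and> x > (0::real)) (at_left 1)"
    using eventually_at_left_real[of 0 1] by (auto elim: eventually_mono)
  have xx_ne: "eventually (\<lambda>x. of_real x ^ 2 \<noteq> (1::complex)) (at_left 1)"
    using x1
  proof eventually_elim
    case (elim x)
    hence "x ^ 2 < 1" by (simp add: power_less_one_iff)
    thus ?case by (metis less_irrefl of_real_1 of_real_eq_iff of_real_power)
  qed
  have main_lim: "((\<lambda>x. (1 - of_real x ^ 2) * rgamma r p q (of_real x ^ 2) 0) \<longlongrightarrow> c_res) (at_left 1)"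
    using rgamma_residue[OF xx_lim xx_ne, of 0] r by simp
  \<comment> \<open>The factor that the residues and the product side share in the limit. It is
    nonzero, so it drops out of the quotient.\<close>
  define X where "X = (\<Prod>a\<in>K. rgamma r p q (- \<i> * \<tau> a) (n a) * rgamma r p q (\<i> * \<tau> a) (n a + \<epsilon>))"
  have reg: "- \<i> * \<tau> a \<in> analytic_region" "\<i> * \<tau> a \<in> analytic_region" if "a \<in> K" for a
    using \<tau>[OF that] by (auto intro!: disc_in_region simp: norm_mult)
  have X_nz: "X \<noteq> 0"
  proof -
    have lt: "norm (p * q) < norm (\<tau> a)" if a: "a \<in> K" for a
    proof -
      have "card (K - {a}) = 3" using K a by simp
      hence "K - {a} \<noteq> {}" by (metis card.empty zero_neq_numeral)
      hence "norm (\<Prod>b\<in>K - {a}. \<tau> b) < 1" using K \<tau> by (intro norm_prod_less_1) auto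
      moreover have "p * q = \<tau> a * (\<Prod>b\<in>K - {a}. \<tau> b)" using prod.remove[OF K(1) a, of \<tau>] \<tau>p by simp
      hence "norm (p * q) = norm (\<tau> a) * norm (\<Prod>b\<in>K - {a}. \<tau> b)" by (metis norm_mult)
      ultimately show ?thesis using \<tau>[OF a] by (simp add: mult_less_cancel_left1)
    qed
    have "rgamma r p q (- \<i> * \<tau> a) k \<noteq> 0" "rgamma r p q (\<i> * \<tau> a) k \<noteq> 0" if "a \<in> K" for a k
      by (rule rgamma_nonzero; use lt[OF that] \<tau>[OF that] in \<open>simp add: norm_mult\<close>)+
    thus ?thesis using K by (simp add: X_def prod_zero_iff)
  qed
  have R_lim: "((\<lambda>x. (1 - of_real x ^ 2) * R (T x) n) \<longlongrightarrow> c_res * X) (at_left 1)"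
  proof -
    have reg2: "\<tau> a * \<tau> b \<in> analytic_region" if "a \<in> K" "b \<in> K" for a b
      using \<tau>[OF that(1)] \<tau>[OF that(2)] mult_strict_mono'[of "norm (\<tau> a)" 1 "norm (\<tau> b)" 1]
      by (intro disc_in_region) (auto simp: norm_mult)
    have "((\<lambda>x. pair_prod K (\<lambda>a b. rgamma r p q (T x a * T x b) (n a + n b + \<epsilon>))) \<longlongrightarrow>
       pair_prod K (\<lambda>a b. rgamma r p q (\<tau> a * \<tau> b) (n a + n b + \<epsilon>))) (at_left 1)"
      unfolding pair_prod_def by (intro tendsto_prod tendsto_rgamma_region tendsto_mult TK_lim reg2) auto
    hence 1: "((\<lambda>x. pair_prod K (\<lambda>a b. rgamma r p q (T x a * T x b) (n a + n b + \<epsilon>))) \<longlongrightarrow> 1) (at_left 1)"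
      by (simp only: pair_prod_reflect[OF K(2) \<tau> \<tau>p nK])
    have 2: "((\<lambda>x. \<Prod>a\<in>K. rgamma r p q (- \<i> * of_real x * T x a) (n a) * rgamma r p q (\<i> * of_real x * T x a) (n a + \<epsilon>)) \<longlongrightarrow>
       (\<Prod>a\<in>K. rgamma r p q (- \<i> * 1 * \<tau> a) (n a) * rgamma r p q (\<i> * 1 * \<tau> a) (n a + \<epsilon>))) (at_left 1)"
      by (intro tendsto_intros tendsto_rgamma_region TK_lim of_real_lim) (use reg in auto)
    have "((\<lambda>x. ((1 - of_real x ^ 2) * rgamma r p q (of_real x ^ 2) 0) *
       (\<Prod>a\<in>K. rgamma r p q (- \<i> * of_real x * T x a) (n a) * rgamma r p q (\<i> * of_real x * T x a) (n a + \<epsilon>)) *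
       pair_prod K (\<lambda>a b. rgamma r p q (T x a * T x b) (n a + n b + \<epsilon>))) \<longlongrightarrow> c_res * X * 1) (at_left 1)"
      by (rule tendsto_mult[OF tendsto_mult[OF main_lim] 1]) (use 2 in \<open>simp add: X_def\<close>)
    moreover have "R (T x) n = rgamma r p q (of_real x ^ 2) 0 *
       (\<Prod>a\<in>K. rgamma r p q (- \<i> * of_real x * T x a) (n a) * rgamma r p q (\<i> * of_real x * T x a) (n a + \<epsilon>)) *
       pair_prod K (\<lambda>a b. rgamma r p q (T x a * T x b) (n a + n b + \<epsilon>))" for x
    proof -
      show ?thesis unfolding R_split2[OF ijl(1,2,4)] K_def[symmetric] TT(1) by (simp add: Ti Tl ni nl)
    qed
    ultimately show ?thesis by (simp add: mult.assoc)
  qed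
  \<comment> \<open>The radii satisfy \<eta> < \<rho>1 < \<rho> < 1: \<rho>1 bounds the unpinched
    parameters and is the inner radius of the annulus, and \<rho> is the radius of the circle to
    which the contour shrinks.\<close>
  define \<eta> where "\<eta> = Max ({norm p, norm q} \<union> (\<lambda>a. norm (\<tau> a)) ` K)"
  have \<eta>_ge: "norm p \<le> \<eta>" "norm q \<le> \<eta>" "\<And>a. a \<in> K \<Longrightarrow> norm (\<tau> a) \<le> \<eta>"
    unfolding \<eta>_def by (rule Max_ge; use K in simp)+
  have "\<eta> < 1" unfolding \<eta>_def using K p1 q1 \<tau> by (subst Max_less_iff) auto
  have "\<eta> > 0" using \<eta>_ge(1) p0 by (meson less_le_trans zero_less_norm_iff)
  obtain \<rho>1 where \<rho>1: "\<eta> < \<rho>1" "\<rho>1 < 1" using dense[OF \<open>\<eta> < 1\<close>] by blast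
  obtain \<rho> where \<rho>: "\<rho>1 < \<rho>" "\<rho> < 1" using dense[OF \<rho>1(2)] by blast
  have c\<eta>: "norm c \<le> \<eta>" using \<eta>_ge(3)[OF K(3)] by (simp add: \<tau>_def)
  have "sqrt (norm c / \<rho>1) < 1" using c\<eta> \<rho>1 \<open>\<eta> > 0\<close> by simp
  hence "max \<rho> (sqrt (norm c / \<rho>1)) < 1" using \<rho> by simp
  \<comment> \<open>From x0 on the pinching parameters lie outside the circle of radius \<rho>, and
    |c| / x^2 < \<rho>1 for the parameter j, which grows as x decreases.\<close>
  then obtain x0 where x0: "\<rho> < x0" "sqrt (norm c / \<rho>1) < x0" "x0 < 1" using dense by (metis max_less_iff_conj)
  have pos: "0 < \<rho>1" "0 < \<rho>" "0 < x0" using \<open>\<eta> > 0\<close> \<rho>1 \<rho> x0 by linarith+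
  have TKn: "T x a \<noteq> 0 \<and> norm (T x a) < \<rho>1" if "a \<in> K" "x0 \<le> x" for a x
  proof (cases "a = j")
    case True
    have "norm c / \<rho>1 = sqrt (norm c / \<rho>1) ^ 2" using pos by simp
    also have "\<dots> < x0 ^ 2" using x0 pos by (intro power_strict_mono) auto
    also have "x0 ^ 2 \<le> x ^ 2" using that pos by (intro power_mono) auto
    finally have "norm c < \<rho>1 * x ^ 2" using pos by (simp add: field_simps)
    moreover have "x \<noteq> 0" using that pos by auto
    ultimately show ?thesis using True c by (simp add: Tj norm_divide norm_power field_simps)
  next
    case False
    thus ?thesis using TK[OF that(1) False] \<tau>[OF that(1)] \<eta>_ge(3)[OF that(1)] \<rho>1 by auto
  qed
  have rad: "1 / \<rho>1 < 1 / max (norm p) (norm q)"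
  proof -
    have "0 < max (norm p) (norm q)" using p0 by (intro less_le_trans[OF _ max.cobounded1]) auto
    moreover have "max (norm p) (norm q) < \<rho>1" using \<eta>_ge \<rho>1 by auto
    ultimately show ?thesis by (intro divide_strict_left_mono) (auto intro: mult_pos_pos)
  qed
  have Tn: "T x i \<noteq> 0" "T x l \<noteq> 0" "norm (T x i) = x" "norm (T x l) = x" if "x0 \<le> x" for x
    using that pos by (auto simp: Ti Tl norm_mult)
  \<comment> \<open>On the circle of radius \<rho> the integrand stays continuous up to and
    including x = 1, since the pinch happens away from it. Compactness of [x0, 1] times the circle
    gives a uniform bound.\<close>
  have bnd: "\<exists>B. \<forall>x\<in>{x0..1}. norm (avg (\<lambda>z. \<Delta> (T x) n m (of_real \<rho> * z))) \<le> B" for m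
  proof -
    let ?D = "{x0..1} \<times> sphere (0::complex) 1"
    have T_cont: "continuous_on ?D (\<lambda>y. T (fst y) a)" for a
    proof -
      have "continuous_on ?D (\<lambda>y. - \<i> * of_real (fst y))" "continuous_on ?D (\<lambda>y. \<i> * of_real (fst y))"
        "continuous_on ?D (\<lambda>y. c / of_real (fst y) ^ 2)"
        using pos by (auto intro!: continuous_intros)
      thus ?thesis by (cases "a = j"; cases "a = l"; cases "a = i") (simp_all add: T_def)
    qed
    have in1: "T x a * (of_real \<rho> * z) \<in> analytic_region" "T x a / (of_real \<rho> * z) \<in> analytic_region"
      if "a \<in> I" "x0 \<le> x" "x \<le> 1" "norm z = 1" for a x z
    proof -
      have z0: "z \<noteq> 0" using that by auto
      have Ta: "T x a \<noteq> 0" "norm (T x a) \<le> 1" using that Tn[OF that(2)] TKn[of a x] \<rho>1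
        by (cases "a = i"; cases "a = l"; force simp: K_def)+
      have "norm (T x a) * \<rho> \<le> 1 * \<rho>" using Ta pos by (intro mult_right_mono) auto
      hence "norm (T x a) * \<rho> < 1" using \<rho> by simp
      thus "T x a * (of_real \<rho> * z) \<in> analytic_region"
        using Ta z0 pos that by (intro disc_in_region) (auto simp: norm_mult)
      show "T x a / (of_real \<rho> * z) \<in> analytic_region"
      proof (cases "a \<in> K")
        case True
        thus ?thesis using TKn[OF True that(2)] \<rho> pos z0 that
          by (intro disc_in_region) (auto simp: norm_divide norm_mult divide_less_eq)
      next
        case False
        hence na: "norm (T x a) = x" using that Tn[OF that(2)] by (auto simp: K_def)
        have nn: "norm (T x a / (of_real \<rho> * z)) = x / \<rho>" using na that pos by (simp add: norm_divide norm_mult)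
        have "x / \<rho> > 1" using that x0 pos by (simp add: field_simps)
        hence "T x a / (of_real \<rho> * z) \<noteq> 1" using nn by auto
        moreover have "x / \<rho> < 1 / \<rho>1" using that pos \<rho> by (simp add: frac_less2)
        ultimately show ?thesis using nn rad Ta z0 pos by (auto simp: analytic_region_def)
      qed
    qed
    have "continuous_on ?D (\<lambda>y. \<Delta> (T (fst y)) n m (of_real \<rho> * snd y))"
      unfolding \<Delta>_def
      by (intro continuous_intros continuous_on_rgamma_region continuous_on_weyl T_cont)
         (use in1 pos in auto)
    moreover have "compact ?D" by (intro compact_Times) auto
    ultimately have "bounded ((\<lambda>y. \<Delta> (T (fst y)) n m (of_real \<rho> * snd y)) ` ?D)"
      by (intro compact_imp_bounded compact_continuous_image)
    then obtain B where "\<forall>w\<in>(\<lambda>y. \<Delta> (T (fst y)) n m (of_real \<rho> * snd y)) ` ?D. norm w \<le> B"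
      unfolding bounded_iff by blast
    hence B: "\<And>y. y \<in> ?D \<Longrightarrow> norm (\<Delta> (T (fst y)) n m (of_real \<rho> * snd y)) \<le> B" by auto
    have "norm (avg (\<lambda>z. \<Delta> (T x) n m (of_real \<rho> * z))) \<le> B" if x: "x \<in> {x0..1}" for x
    proof (rule avg_norm_le)
      show "continuous_on (sphere 0 1) (\<lambda>z. \<Delta> (T x) n m (of_real \<rho> * z))"
        unfolding \<Delta>_def
        by (intro continuous_intros continuous_on_rgamma_region continuous_on_weyl) (use in1 pos x in auto)
      show "norm (\<Delta> (T x) n m (of_real \<rho> * z)) \<le> B" if "norm z = 1" for z
        using B[of "(x, z)"] that x by simp
    qed
    thus ?thesis by blast
  qed
  have small: "((\<lambda>x. (1 - of_real x ^ 2) * avg (\<lambda>z. \<Delta> (T x) n m (of_real \<rho> * z))) \<longlongrightarrow> 0) (at_left 1)" for m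
  proof -
    obtain B where B: "\<And>x. x \<in> {x0..1} \<Longrightarrow> norm (avg (\<lambda>z. \<Delta> (T x) n m (of_real \<rho> * z))) \<le> B"
      using bnd by blast
    have "((\<lambda>x. B * norm (1 - of_real x ^ 2 :: complex)) \<longlongrightarrow> B * norm (1 - 1 :: complex)) (at_left 1)"
      by (intro tendsto_intros xx_lim)
    hence "((\<lambda>x. B * norm (1 - of_real x ^ 2 :: complex)) \<longlongrightarrow> 0) (at_left 1)" by simp
    moreover have "eventually (\<lambda>x. norm ((1 - of_real x ^ 2) * avg (\<lambda>z. \<Delta> (T x) n m (of_real \<rho> * z))) \<le> B * norm (1 - of_real x ^ 2 :: complex)) (at_left 1)"
      using eventually_at_left_real[OF x0(3)]
    proof eventually_elim
      case (elim x)
      thus ?case using mult_left_mono[OF B[of x], of "norm (1 - of_real x ^ 2 :: complex)"] by (simp add: norm_mult mult.commute)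
    qed
    ultimately show ?thesis by (rule Lim_null_comparison[rotated])
  qed
  \<comment> \<open>The value of m in 0..r - 1 for which the index n i - m = - \<epsilon> - m is
    divisible by r: the only one with a pole at T x i.\<close>
  define m1 where "m1 = (if \<epsilon> = 0 then 0 else r - 1)"
  define GL where "GL = (\<lambda>x z. rgamma r p q (T x i * z) (n i + \<epsilon>) * rgamma r p q (T x i / z) (n i) * rgamma r p q (T x l * z) (n l + \<epsilon>)
      * (\<Prod>a\<in>K. rgamma r p q (T x a * z) (n a + \<epsilon>) * rgamma r p q (T x a / z) (n a)) * weyl (z ^ 2) \<epsilon>)"
  define GI where "GI = (\<lambda>x z. rgamma r p q (T x l * z) (n l) * rgamma r p q (T x l / z) (n l + \<epsilon>) * rgamma r p q (T x i * z) (n i)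
      * (\<Prod>a\<in>K. rgamma r p q (T x a * z) (n a) * rgamma r p q (T x a / z) (n a + \<epsilon>)) * weyl (z ^ 2) (- \<epsilon>))"
  have \<Delta>L: "\<Delta> (T x) n 0 z = rgamma r p q (T x l / z) 0 * GL x z" for x z
    unfolding \<Delta>_def prod_split2'[OF ijl(1,2,4)] GL_def K_def by (simp add: nl mult_ac)
  have \<Delta>I: "\<Delta> (T x) n (- \<epsilon>) z = rgamma r p q (T x i / z) 0 * GI x z" for x z
    unfolding \<Delta>_def prod_split2'[OF ijl(1,2,4)] GI_def K_def by (simp add: ni nl mult_ac)
  \<comment> \<open>For \<epsilon> = 1 the index at m = r - 1 is - r; periodicity replaces m by -1,
    where the index is exactly 0 and the residue is known.\<close>
  have \<Delta>I': "\<Delta> (T x) n (int m1) z = \<Delta> (T x) n (- \<epsilon>) z" if x: "x0 \<le> x" "x < 1" and z: "z \<noteq> 0" for x z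
  proof (cases "\<epsilon> = 0")
    case False
    hence e1: "\<epsilon> = 1" using \<epsilon> by auto
    have "adm (T x) n"
    proof -
      have "(\<Prod>a\<in>I. T x a) = T x i * T x l * (T x j * (\<Prod>a\<in>K - {j}. T x a))"
        unfolding prod_split2'[OF ijl(1,2,4)] K_def[symmetric] using K by (simp add: prod.remove)
      also have "(\<Prod>a\<in>K - {j}. T x a) = (\<Prod>a\<in>K - {j}. t a)" by (intro prod.cong) (auto simp: TK)
      also have "T x i * T x l * (T x j * (\<Prod>a\<in>K - {j}. t a)) = c * (\<Prod>a\<in>K - {j}. t a)"
        using x pos by (simp add: TT(1) Tj)
      finally have "(\<Prod>a\<in>I. T x a) = p * q" using tp by (simp add: IK)
      moreover have "T x a \<noteq> 0 \<and> norm (T x a) < 1" if "a \<in> I" for a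
        using that Tn[OF x(1)] TKn[of a x] x \<rho>1 by (cases "a = i"; cases "a = l"; force simp: K_def)
      ultimately show ?thesis using n by (simp add: adm_def)
    qed
    from \<Delta>_periodic[OF this z, of "- 1"] show ?thesis using e1 r by (simp add: m1_def of_nat_diff)
  qed (simp add: m1_def)
  have J_eq: "J (T x) n = (\<Sum>m<r. avg (\<lambda>z. \<Delta> (T x) n (int m) (of_real \<rho> * z))) + c_res * GL x (T x l) + c_res * GI x (T x i)"
    if x: "x0 < x" "x < 1" for x
  proof -
    have x0': "x0 \<le> x" using x by simp
    note Tx = Tn[OF x0']
    have inK: "T x a \<noteq> 0" "norm (T x a) < \<rho>1" if "a \<in> K" for a using TKn[OF that x0'] by auto
    have regs: "T x a * z \<in> analytic_region" "a \<in> K \<Longrightarrow> T x a / z \<in> analytic_region" "z \<noteq> T x a \<Longrightarrow> T x a / z \<in> analytic_region"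
      if a: "a \<in> I" and z: "\<rho>1 < norm z" "norm z < 1 / x" for a z
    proof -
      have z0: "z \<noteq> 0" using z pos by auto
      have Ta: "T x a \<noteq> 0" "norm (T x a) \<le> x"
        using a Tx inK[of a] x x0 \<rho> by (cases "a = i"; cases "a = l"; force simp: K_def)+
      have "norm (T x a) * norm z \<le> x * norm z" using Ta by (intro mult_right_mono) auto
      also have "\<dots> < 1" using z x pos by (simp add: field_simps)
      finally show "T x a * z \<in> analytic_region" using Ta z0 by (intro disc_in_region) (auto simp: norm_mult)
      show "T x a / z \<in> analytic_region" if "a \<in> K"
        using inK[OF that] z z0 by (intro disc_in_region) (auto simp: norm_divide divide_less_eq)
      show "T x a / z \<in> analytic_region" if "z \<noteq> T x a"
      proof -
        have "norm (T x a) / norm z \<le> 1 / norm z" using Ta(2) x by (intro divide_right_mono) auto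
        also have "\<dots> < 1 / \<rho>1" using z pos by (intro divide_strict_left_mono mult_pos_pos) linarith+
        finally have "norm (T x a) / norm z < 1 / \<rho>1" .
        hence "norm (T x a / z) < 1 / max (norm p) (norm q)" using rad by (simp add: norm_divide)
        moreover have "T x a / z \<noteq> 1" using that z0 by (simp add: field_simps)
        ultimately show ?thesis using Ta z0 by (simp add: analytic_region_def)
      qed
    qed
    have TlTi: "T x l \<noteq> T x i" using x pos x0 by (simp add: Ti Tl)
    have annT: "\<rho>1 < norm (T x l)" "norm (T x l) < 1 / x" "\<rho>1 < norm (T x i)" "norm (T x i) < 1 / x"
    proof -
      have "x * x < 1" using x pos x0 mult_strict_mono'[of x 1 x 1] by auto
      thus "norm (T x l) < 1 / x" "norm (T x i) < 1 / x" using Tx x pos x0 by (auto simp: field_simps)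
      show "\<rho>1 < norm (T x l)" "\<rho>1 < norm (T x i)" using Tx x x0 \<rho> by auto
    qed
    \<comment> \<open>The pole at T x l needs index - m = 0 and the one at T x i needs m = m1. In
      all other cases the index lies strictly between - r and r and is not 0.\<close>
    have shift: "avg (\<Delta> (T x) n (int m)) = avg (\<lambda>z. \<Delta> (T x) n (int m) (of_real \<rho> * z))
       + (if m = 0 then c_res * GL x (T x l) else 0) + (if m = m1 then c_res * GI x (T x i) else 0)" if m: "m < r" for m
    proof (rule avg_pole_shift[where a = \<rho>1 and b = "1 / x" and ?z1.0 = "T x l" and ?z2.0 = "T x i"])
      have zreg: "\<rho>1 < norm z \<Longrightarrow> norm z < 1 / x \<Longrightarrow> z \<noteq> 0" for z :: complex using pos by auto
      show "\<Delta> (T x) n (int m) holomorphic_on {z. \<rho>1 < norm z \<and> norm z < 1 / x} - {T x l, T x i}"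
        unfolding \<Delta>_def
      proof (intro holomorphic_intros rgamma_holomorphic_region weyl_holomorphic)
        fix a z assume a: "a \<in> I" and z: "z \<in> {z. \<rho>1 < norm z \<and> norm z < 1 / x} - {T x l, T x i}"
        show "T x a * z \<in> analytic_region" using regs(1)[OF a] z by auto
        show "T x a / z \<in> analytic_region"
        proof (cases "a \<in> K")
          case True
          thus ?thesis using regs(2)[OF a] z by auto
        next
          case False
          hence "z \<noteq> T x a" using a z by (auto simp: K_def)
          thus ?thesis using regs(3)[OF a] z by auto
        qed
      qed (use zreg in auto)
      have lim_div: "((\<lambda>z. w / z) \<longlongrightarrow> 1) (at w)" "eventually (\<lambda>z. w / z \<noteq> 1) (at w)" if "w \<noteq> 0" for w :: complex
      proof -
        have "((\<lambda>z. w / z) \<longlongrightarrow> w / w) (at w)" using that by (intro tendsto_intros) auto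
        thus "((\<lambda>z. w / z) \<longlongrightarrow> 1) (at w)" using that by simp
        have "eventually (\<lambda>z. z \<noteq> w) (at w)" by (simp add: eventually_at_filter)
        thus "eventually (\<lambda>z. w / z \<noteq> 1) (at w)"
          using eventually_nz_at[OF that] by eventually_elim auto
      qed
      have rest_lim: "((\<lambda>z. rgamma r p q (T x a * z) k) \<longlongrightarrow> rgamma r p q (T x a * T x b) k) (at (T x b))"
        "a \<noteq> b \<Longrightarrow> ((\<lambda>z. rgamma r p q (T x a / z) k) \<longlongrightarrow> rgamma r p q (T x a / T x b) k) (at (T x b))"
        if "a \<in> I" "b \<in> {i, l}" for a b k
      proof -
        have b: "\<rho>1 < norm (T x b)" "norm (T x b) < 1 / x" "T x b \<noteq> 0" using that(2) annT Tx by auto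
        show "((\<lambda>z. rgamma r p q (T x a * z) k) \<longlongrightarrow> rgamma r p q (T x a * T x b) k) (at (T x b))"
          by (intro tendsto_rgamma_region tendsto_intros regs(1) that(1) b)
        assume "a \<noteq> b"
        hence "T x a / T x b \<in> analytic_region"
          using regs(2,3)[OF that(1) b(1,2)] that TlTi by (cases "a \<in> K") (auto simp: K_def)
        thus "((\<lambda>z. rgamma r p q (T x a / z) k) \<longlongrightarrow> rgamma r p q (T x a / T x b) k) (at (T x b))"
          using b by (intro tendsto_rgamma_region tendsto_intros) auto
      qed
      have KI: "a \<in> I" "a \<noteq> i" "a \<noteq> l" if "a \<in> K" for a using that by (auto simp: K_def)
      have GL_lim: "(GL x \<longlongrightarrow> GL x (T x l)) (at (T x l))" unfolding GL_def
        by (intro tendsto_mult tendsto_prod rest_lim tendsto_weyl tendsto_power tendsto_ident_at)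
           (use ijl KI Tx in auto)
      have GI_lim: "(GI x \<longlongrightarrow> GI x (T x i)) (at (T x i))" unfolding GI_def
        by (intro tendsto_mult tendsto_prod rest_lim tendsto_weyl tendsto_power tendsto_ident_at)
           (use ijl KI Tx in auto)
      show "((\<lambda>z. (1 - T x l / z) * \<Delta> (T x) n (int m) z) \<longlongrightarrow> (if m = 0 then c_res * GL x (T x l) else 0)) (at (T x l))"
      proof (cases "m = 0")
        case True
        have "((\<lambda>z. ((1 - T x l / z) * rgamma r p q (T x l / z) 0) * GL x z) \<longlongrightarrow> c_res * GL x (T x l)) (at (T x l))"
          using rgamma_residue[OF lim_div[OF Tx(2)], of 0] r GL_lim by (intro tendsto_mult) auto
        thus ?thesis using True by (simp add: \<Delta>L mult.assoc)
      next
        case False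
        define g where "g = (\<lambda>z. rgamma r p q (T x i * z) (n i + int m + \<epsilon>) * rgamma r p q (T x i / z) (n i - int m) * rgamma r p q (T x l * z) (n l + int m + \<epsilon>)
          * (\<Prod>a\<in>K. rgamma r p q (T x a * z) (n a + int m + \<epsilon>) * rgamma r p q (T x a / z) (n a - int m)) * weyl (z ^ 2) (2 * int m + \<epsilon>))"
        have "(g \<longlongrightarrow> g (T x l)) (at (T x l))" unfolding g_def
          by (intro tendsto_mult tendsto_prod rest_lim tendsto_weyl tendsto_power tendsto_ident_at)
             (use ijl KI Tx in auto)
        hence "((\<lambda>z. ((1 - T x l / z) * rgamma r p q (T x l / z) (- int m)) * g z) \<longlongrightarrow> 0 * g (T x l)) (at (T x l))"
          using rgamma_residue[OF lim_div[OF Tx(2)], of "- int m"] r m False by (intro tendsto_mult) auto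
        moreover have "\<Delta> (T x) n (int m) z = rgamma r p q (T x l / z) (- int m) * g z" for z
          unfolding \<Delta>_def prod_split2'[OF ijl(1,2,4)] g_def K_def by (simp add: nl mult_ac)
        ultimately show ?thesis using False by (simp add: mult.assoc)
      qed
      show "((\<lambda>z. (1 - T x i / z) * \<Delta> (T x) n (int m) z) \<longlongrightarrow> (if m = m1 then c_res * GI x (T x i) else 0)) (at (T x i))"
      proof (cases "m = m1")
        case True
        have "((\<lambda>z. ((1 - T x i / z) * rgamma r p q (T x i / z) 0) * GI x z) \<longlongrightarrow> c_res * GI x (T x i)) (at (T x i))"
          using rgamma_residue[OF lim_div[OF Tx(1)], of 0] r GI_lim by (intro tendsto_mult) auto
        moreover have "eventually (\<lambda>z. ((1 - T x i / z) * rgamma r p q (T x i / z) 0) * GI x z = (1 - T x i / z) * \<Delta> (T x) n (int m) z) (at (T x i))"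
          using eventually_nz_at[OF Tx(1)] by eventually_elim (use True x \<Delta>I' \<Delta>I in \<open>simp add: mult.assoc\<close>)
        ultimately show ?thesis using True by (simp add: tendsto_cong)
      next
        case False
        define k where "k = n i - int m"
        have k: "- int r < k" "k < int r" "k \<noteq> 0"
          using m False \<epsilon> r by (auto simp: k_def ni m1_def)
        define g where "g = (\<lambda>z. rgamma r p q (T x l * z) (n l + int m + \<epsilon>) * rgamma r p q (T x l / z) (n l - int m) * rgamma r p q (T x i * z) (n i + int m + \<epsilon>)
          * (\<Prod>a\<in>K. rgamma r p q (T x a * z) (n a + int m + \<epsilon>) * rgamma r p q (T x a / z) (n a - int m)) * weyl (z ^ 2) (2 * int m + \<epsilon>))"
        have "(g \<longlongrightarrow> g (T x i)) (at (T x i))" unfolding g_def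
          by (intro tendsto_mult tendsto_prod rest_lim tendsto_weyl tendsto_power tendsto_ident_at)
             (use ijl KI Tx in auto)
        hence "((\<lambda>z. ((1 - T x i / z) * rgamma r p q (T x i / z) k) * g z) \<longlongrightarrow> 0 * g (T x i)) (at (T x i))"
          using rgamma_residue[OF lim_div[OF Tx(1)], of k] k by (intro tendsto_mult) auto
        moreover have "\<Delta> (T x) n (int m) z = rgamma r p q (T x i / z) k * g z" for z
          unfolding \<Delta>_def prod_split2'[OF ijl(1,2,4)] g_def K_def k_def by (simp add: mult_ac)
        ultimately show ?thesis using False by (simp add: mult.assoc)
      qed
      show "1 < 1 / x" using x pos x0 by simp
    qed (use pos \<rho> x x0 Tx TlTi in auto)
    have m1r: "m1 < r" using r by (simp add: m1_def)
    show ?thesis unfolding J_def using r m1r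
      by (simp add: shift sum.distrib sum.delta)
  qed
  \<comment> \<open>At z = T x l the gamma function of T x i z diverges like c_res / (1 - x^2). The
    two gamma functions near -1 cancel against \<open>weyl\<close> by \<open>weyl_minus_1\<close>,
    and what is left is X.\<close>
  have GL_lim: "((\<lambda>x. (1 - of_real x ^ 2) * GL x (T x l)) \<longlongrightarrow> c_res * X) (at_left 1)"
  proof -
    have "((\<lambda>x. ((1 - of_real x ^ 2) * rgamma r p q (of_real x ^ 2) 0) * rgamma r p q (- 1) (- \<epsilon>) * rgamma r p q (- (of_real x ^ 2)) \<epsilon>
      * (\<Prod>a\<in>K. rgamma r p q (T x a * (\<i> * of_real x)) (n a + \<epsilon>) * rgamma r p q (T x a / (\<i> * of_real x)) (n a)) * weyl (- (of_real x ^ 2)) \<epsilon>)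
      \<longlongrightarrow> c_res * rgamma r p q (- 1) (- \<epsilon>) * rgamma r p q (- 1) \<epsilon>
      * (\<Prod>a\<in>K. rgamma r p q (\<tau> a * (\<i> * 1)) (n a + \<epsilon>) * rgamma r p q (\<tau> a / (\<i> * 1)) (n a)) * weyl (- 1) \<epsilon>) (at_left 1)"
      by (intro tendsto_intros main_lim tendsto_rgamma_region tendsto_weyl TK_lim of_real_lim xx_lim minus_1_in_region)
         (use reg in \<open>auto simp: mult.commute divide_i\<close>)
    also have "c_res * rgamma r p q (- 1) (- \<epsilon>) * rgamma r p q (- 1) \<epsilon>
      * (\<Prod>a\<in>K. rgamma r p q (\<tau> a * (\<i> * 1)) (n a + \<epsilon>) * rgamma r p q (\<tau> a / (\<i> * 1)) (n a)) * weyl (- 1) \<epsilon>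
      = c_res * (rgamma r p q (- 1) \<epsilon> * rgamma r p q (- 1) (- \<epsilon>) * weyl (- 1) \<epsilon>) * X"
      by (simp add: X_def mult_ac divide_i)
    also have "\<dots> = c_res * X" by (simp only: weyl_minus_1 mult_1_right)
    finally have "((\<lambda>x. ((1 - of_real x ^ 2) * rgamma r p q (of_real x ^ 2) 0) * rgamma r p q (- 1) (- \<epsilon>) * rgamma r p q (- (of_real x ^ 2)) \<epsilon>
      * (\<Prod>a\<in>K. rgamma r p q (T x a * (\<i> * of_real x)) (n a + \<epsilon>) * rgamma r p q (T x a / (\<i> * of_real x)) (n a)) * weyl (- (of_real x ^ 2)) \<epsilon>)
      \<longlongrightarrow> c_res * X) (at_left 1)" .
    moreover have "eventually (\<lambda>x. ((1 - of_real x ^ 2) * rgamma r p q (of_real x ^ 2) 0) * rgamma r p q (- 1) (- \<epsilon>) * rgamma r p q (- (of_real x ^ 2)) \<epsilon>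
      * (\<Prod>a\<in>K. rgamma r p q (T x a * (\<i> * of_real x)) (n a + \<epsilon>) * rgamma r p q (T x a / (\<i> * of_real x)) (n a)) * weyl (- (of_real x ^ 2)) \<epsilon>
      = (1 - of_real x ^ 2) * GL x (T x l)) (at_left 1)"
      using x1
    proof eventually_elim
      case (elim x)
      have "T x i * T x l = of_real x ^ 2" "T x i / T x l = - 1" "T x l * T x l = - (of_real x ^ 2)" "T x l ^ 2 = - (of_real x ^ 2)"
        using elim TT[of x] TT'[of x] by simp_all
      thus ?case unfolding GL_def by (simp only: ni nl Tl[symmetric]) (simp add: mult_ac)
    qed
    ultimately show ?thesis by (simp add: tendsto_cong)
  qed
  have GI_lim: "((\<lambda>x. (1 - of_real x ^ 2) * GI x (T x i)) \<longlongrightarrow> c_res * X) (at_left 1)"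
  proof -
    have "((\<lambda>x. ((1 - of_real x ^ 2) * rgamma r p q (of_real x ^ 2) 0) * rgamma r p q (- 1) \<epsilon> * rgamma r p q (- (of_real x ^ 2)) (- \<epsilon>)
      * (\<Prod>a\<in>K. rgamma r p q (T x a * (- \<i> * of_real x)) (n a) * rgamma r p q (T x a / (- \<i> * of_real x)) (n a + \<epsilon>)) * weyl (- (of_real x ^ 2)) (- \<epsilon>))
      \<longlongrightarrow> c_res * rgamma r p q (- 1) \<epsilon> * rgamma r p q (- 1) (- \<epsilon>)
      * (\<Prod>a\<in>K. rgamma r p q (\<tau> a * (- \<i> * 1)) (n a) * rgamma r p q (\<tau> a / (- \<i> * 1)) (n a + \<epsilon>)) * weyl (- 1) (- \<epsilon>)) (at_left 1)"
      by (intro tendsto_intros main_lim tendsto_rgamma_region tendsto_weyl TK_lim of_real_lim xx_lim minus_1_in_region)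
         (use reg in \<open>auto simp: mult.commute divide_i\<close>)
    also have "c_res * rgamma r p q (- 1) \<epsilon> * rgamma r p q (- 1) (- \<epsilon>)
      * (\<Prod>a\<in>K. rgamma r p q (\<tau> a * (- \<i> * 1)) (n a) * rgamma r p q (\<tau> a / (- \<i> * 1)) (n a + \<epsilon>)) * weyl (- 1) (- \<epsilon>)
      = c_res * (rgamma r p q (- 1) (- \<epsilon>) * rgamma r p q (- 1) (- (- \<epsilon>)) * weyl (- 1) (- \<epsilon>)) * X"
      by (simp add: X_def mult_ac divide_i)
    also have "\<dots> = c_res * X" by (simp only: weyl_minus_1 mult_1_right)
    finally have "((\<lambda>x. ((1 - of_real x ^ 2) * rgamma r p q (of_real x ^ 2) 0) * rgamma r p q (- 1) \<epsilon> * rgamma r p q (- (of_real x ^ 2)) (- \<epsilon>)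
      * (\<Prod>a\<in>K. rgamma r p q (T x a * (- \<i> * of_real x)) (n a) * rgamma r p q (T x a / (- \<i> * of_real x)) (n a + \<epsilon>)) * weyl (- (of_real x ^ 2)) (- \<epsilon>))
      \<longlongrightarrow> c_res * X) (at_left 1)" .
    moreover have "eventually (\<lambda>x. ((1 - of_real x ^ 2) * rgamma r p q (of_real x ^ 2) 0) * rgamma r p q (- 1) \<epsilon> * rgamma r p q (- (of_real x ^ 2)) (- \<epsilon>)
      * (\<Prod>a\<in>K. rgamma r p q (T x a * (- \<i> * of_real x)) (n a) * rgamma r p q (T x a / (- \<i> * of_real x)) (n a + \<epsilon>)) * weyl (- (of_real x ^ 2)) (- \<epsilon>)
      = (1 - of_real x ^ 2) * GI x (T x i)) (at_left 1)"
      using x1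
    proof eventually_elim
      case (elim x)
      have "T x l * T x i = of_real x ^ 2" "T x l / T x i = - 1" "T x i * T x i = - (of_real x ^ 2)" "T x i ^ 2 = - (of_real x ^ 2)"
        using elim TT[of x] TT'[of x] by simp_all
      thus ?case unfolding GI_def by (simp only: ni nl Ti[symmetric]) (simp add: mult_ac)
    qed
    ultimately show ?thesis by (rule Lim_transform_eventually)
  qed
  have "((\<lambda>x. (\<Sum>m<r. (1 - of_real x ^ 2) * avg (\<lambda>z. \<Delta> (T x) n (int m) (of_real \<rho> * z)))
      + c_res * ((1 - of_real x ^ 2) * GL x (T x l)) + c_res * ((1 - of_real x ^ 2) * GI x (T x i)))
     \<longlongrightarrow> (\<Sum>m<r. 0) + c_res * (c_res * X) + c_res * (c_res * X)) (at_left 1)"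
    by (intro tendsto_intros small GL_lim GI_lim)
  moreover have "eventually (\<lambda>x. (\<Sum>m<r. (1 - of_real x ^ 2) * avg (\<lambda>z. \<Delta> (T x) n (int m) (of_real \<rho> * z)))
      + c_res * ((1 - of_real x ^ 2) * GL x (T x l)) + c_res * ((1 - of_real x ^ 2) * GI x (T x i)) = (1 - of_real x ^ 2) * J (T x) n) (at_left 1)"
    using eventually_at_left_real[OF x0(3)]
    by eventually_elim (simp add: J_eq sum_distrib_left distrib_left mult_ac)
  ultimately have J_lim: "((\<lambda>x. (1 - of_real x ^ 2) * J (T x) n) \<longlongrightarrow> 2 * c_res * (c_res * X)) (at_left 1)"
    by (simp add: tendsto_cong mult_ac)
  \<comment> \<open>Numerator and denominator diverge at the same rate. The two residues contribute
    equally, whence the factor 2.\<close>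
  have "((\<lambda>x. ((1 - of_real x ^ 2) * J (T x) n) / ((1 - of_real x ^ 2) * R (T x) n)) \<longlongrightarrow> (2 * c_res * (c_res * X)) / (c_res * X)) (at_left 1)"
    by (intro tendsto_divide J_lim R_lim) (use c_res_nonzero X_nz in auto)
  moreover have "eventually (\<lambda>x. ((1 - of_real x ^ 2) * J (T x) n) / ((1 - of_real x ^ 2) * R (T x) n) = \<Phi> (T x) n) (at_left 1)"
    using xx_ne by eventually_elim (simp add: \<Phi>_def)
  ultimately show ?thesis using c_res_nonzero X_nz by (simp add: tendsto_cong)
qed

end

section \<open>The rarefied elliptic beta integral\<close>

context rarefied_params
begin

text \<open>Two applications of \<open>\<Phi>_const\<close> lead from t to the pinching family: on
  (i, j) to bring t i to - i x, then on (l, j) to bring t l to i x. As the integer k there is free,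
  n i and n l become - \<epsilon> and 0 at the same time. So the quotient does not change along the
  family and equals its limit.\<close>

lemma \<Phi>_eq_of_pair:
  assumes adm: "adm t n" and ij: "i \<in> I" "j \<in> I" "i \<noteq> j" and lt: "norm (t i * t j) < norm q"
  shows "\<Phi> t n = 2 * c_res"
proof -
  have t: "\<And>a. a \<in> I \<Longrightarrow> t a \<noteq> 0 \<and> norm (t a) < 1" and tp: "(\<Prod>a\<in>I. t a) = p * q"
    and n: "(\<Sum>a\<in>I. n a) + 3 * \<epsilon> = 0" using adm by (auto simp: adm_def)
  have "card (I - {i, j}) = 4" using I ij by (auto simp: card_Diff_subset)
  hence "I - {i, j} \<noteq> {}" by (metis card.empty zero_neq_numeral)
  then obtain l where l: "l \<in> I" "l \<noteq> i" "l \<noteq> j" by blast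
  define c where "c = t i * t j * t l"
  define n' where "n' = n(i := - \<epsilon>, l := 0, j := n j + (n i + \<epsilon>) + n l)"
  define T where "T = (\<lambda>x::real. t(i := - \<i> * of_real x, l := \<i> * of_real x, j := c / of_real x ^ 2))"
  have lt1: "norm (t i * t j) < 1" using lt q1 by simp
  have "((\<lambda>x. \<Phi> (T x) n') \<longlongrightarrow> 2 * c_res) (at_left 1)"
    unfolding T_def
  proof (rule \<Phi>_pinch)
    show "c \<noteq> 0" using t ij l by (simp add: c_def)
    show "norm c < 1" using mult_strict_mono'[of "norm (t i * t j)" 1 "norm (t l)" 1] lt1 t[OF l(1)]
      by (simp add: c_def norm_mult)
    have "(\<Prod>a\<in>I - {i, j}. t a) = t l * (\<Prod>a\<in>I - {i, j} - {l}. t a)" using I l by (simp add: prod.remove)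
    moreover have "I - {i, j} - {l} = I - {i, l, j}" by auto
    ultimately show "c * (\<Prod>a\<in>I - {i, l, j}. t a) = p * q"
      using tp unfolding prod_split2'[OF ij] c_def by (simp add: mult.assoc)
    have "(\<Sum>a\<in>I - {i, j}. n' a) = n' l + (\<Sum>a\<in>I - {i, j} - {l}. n' a)" using I l by (simp add: sum.remove)
    also have "(\<Sum>a\<in>I - {i, j} - {l}. n' a) = (\<Sum>a\<in>I - {i, j} - {l}. n a)"
      by (intro sum.cong) (auto simp: n'_def)
    finally have "(\<Sum>a\<in>I - {i, j}. n' a) = (\<Sum>a\<in>I - {i, j}. n a) - n l"
      using I l ij by (simp add: sum.remove[of "I - {i, j}" l] n'_def)
    thus "(\<Sum>a\<in>I. n' a) + 3 * \<epsilon> = 0"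
      using n ij l unfolding sum_split2[OF ij] by (simp add: n'_def)
  qed (use ij l t in \<open>auto simp: n'_def\<close>)
  moreover have "eventually (\<lambda>x. \<Phi> (T x) n' = \<Phi> t n) (at_left 1)"
  proof -
    \<comment> \<open>The bound x > |t i t j| puts the first twist into its annulus. The bound x >
      |t l| keeps the product of the parameters l and j below |q| after that twist, as the second
      application demands.\<close>
    have "max (norm (t l)) (norm (t i * t j)) < 1" using t[OF l(1)] lt1 by simp
    from eventually_at_left_real[OF this] show ?thesis
    proof eventually_elim
      case (elim x)
      hence x: "norm (t l) < x" "norm (t i * t j) < x" "x < 1" by auto
      have x0: "x > 0" using x(1) norm_ge_zero[of "t l"] by linarith
      have nz: "t i \<noteq> 0" "t j \<noteq> 0" "t l \<noteq> 0" using t ij l by auto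
      define s1 where "s1 = - \<i> * of_real x / t i"
      have s1n: "norm s1 = x / norm (t i)" using x0 by (simp add: s1_def norm_divide norm_mult)
      have s1: "s1 \<in> ann t i j" unfolding ann_def mem_Collect_eq s1n
        using x nz x0 by (auto simp: norm_mult field_simps)
      define t1 where "t1 = tw t i j s1"
      define n1 where "n1 = nw n i j (- \<epsilon> - n i)"
      have e1: "\<Phi> t1 n1 = \<Phi> t n" unfolding t1_def n1_def by (rule \<Phi>_const[OF adm ij lt s1])
      have adm1: "adm t1 n1" unfolding t1_def n1_def by (rule adm_tw[OF adm ij s1])
      have t1l: "t1 l = t l" and t1j: "t1 j = t i * t j / (- \<i> * of_real x)"
        using l ij nz x0 by (auto simp: t1_def tw_def s1_def field_simps)
      have nt1j: "norm (t1 j) = norm (t i * t j) / x" unfolding t1j using x0 by (simp add: norm_divide norm_mult)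
      have "norm (t l) / x < 1" using x x0 by simp
      hence "norm (t i * t j) * (norm (t l) / x) \<le> norm (t i * t j) * 1" by (intro mult_left_mono) auto
      moreover have "norm (t1 l * t1 j) = norm (t i * t j) * (norm (t l) / x)"
        by (simp only: t1l norm_mult[of "t l" "t1 j"] nt1j times_divide_eq_left times_divide_eq_right mult.commute)
      ultimately have lt2: "norm (t1 l * t1 j) < norm q" using lt by linarith
      define s2 where "s2 = \<i> * of_real x / t l"
      have s2n: "norm s2 = x / norm (t l)" using x0 by (simp add: s2_def norm_divide norm_mult)
      have xx: "norm (t i * t j) * norm (t l) < x * x" using x x0 by (intro mult_strict_mono') auto
      have s2: "s2 \<in> ann t1 l j" unfolding ann_def mem_Collect_eq s2n nt1j t1l
        using x nz x0 xx by (auto simp: field_simps)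
      have e2: "\<Phi> (tw t1 l j s2) (nw n1 l j (- n1 l)) = \<Phi> t1 n1"
        by (rule \<Phi>_const[OF adm1 l(1) ij(2) l(3) lt2 s2])
      have "tw t1 l j s2 = T x"
      proof
        fix a
        have i: "t i * s1 = - \<i> * of_real x" "t l * s2 = \<i> * of_real x" using nz by (simp_all add: s1_def s2_def)
        have "t j / s1 / s2 = c / of_real x ^ 2"
          using nz x0 by (simp add: s1_def s2_def c_def field_simps power2_eq_square)
        thus "tw t1 l j s2 a = T x a"
          using i l ij by (auto simp: tw_def t1_def T_def)
      qed
      moreover have "nw n1 l j (- n1 l) = n'"
        using l ij by (auto simp: nw_def n1_def n'_def)
      ultimately show ?case using e1 e2 by simp
    qed
  qed
  hence "((\<lambda>x. \<Phi> (T x) n') \<longlongrightarrow> \<Phi> t n) (at_left 1)" by (rule tendsto_eventually)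
  ultimately show ?thesis by (intro tendsto_unique[of "at_left (1::real)"]) auto
qed

theorem J_eq_R:
  assumes "norm p \<le> norm q" "adm t n"
  shows "J t n = 2 * c_res * R t n"
proof -
  have "\<Phi> t n = 2 * c_res"
    by (rule \<Phi>_eq_if_pairs[OF \<Phi>_eq_of_pair assms])
  thus ?thesis using R_nonzero[OF assms(2)] by (simp add: \<Phi>_def field_simps)
qed

end

context rarefied
begin

text \<open>Where both gamma functions are regular the identity near w passes to w by continuity. At
  w = 1 with r dividing m, \<open>weyl\<close> vanishes, and a gamma function has the default value
  0 at its pole, so 1 / 0 = 0 agrees.\<close>

lemma weyl_eq_inverse:
  assumes w: "norm w = 1"
  shows "weyl w m = 1 / (rgamma r p q w m * rgamma r p q (1 / w) (- m))"
proof (cases "w = 1 \<and> int r dvd m")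
  case False
  have w0: "w \<noteq> 0" using w by auto
  have "1 / w \<noteq> 1 \<or> \<not> int r dvd - m" using False w0 by auto
  hence c: "isCont (\<lambda>w. rgamma r p q w m) w" "isCont (\<lambda>w. rgamma r p q w (- m)) (1 / w)"
    using False w w0 one_less_radius by (auto intro!: analytic_at_imp_isCont rgamma_analytic simp: norm_divide)
  have "isCont (\<lambda>w. 1 / w) w" using w0 by (intro continuous_intros) auto
  hence c': "isCont (\<lambda>w. rgamma r p q (1 / w) (- m)) w"
    using isCont_o2[where f = "\<lambda>w. 1 / w" and g = "\<lambda>w. rgamma r p q w (- m)"] c(2) by blast
  have "isCont (\<lambda>w. rgamma r p q w m * rgamma r p q (1 / w) (- m) * weyl w m) w"
    using w0 by (intro continuous_intros c(1) c' analytic_at_imp_isCont[OF weyl_analytic]) auto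
  from eventually_at_eq_imp_eq[OF this continuous_const eventually_weyl[OF w0]]
  have "rgamma r p q w m * rgamma r p q (1 / w) (- m) * weyl w m = 1" .
  moreover from this have "rgamma r p q w m * rgamma r p q (1 / w) (- m) \<noteq> 0" by auto
  ultimately show ?thesis by (simp add: field_simps)
next
  case True
  then obtain k where k: "m = int r * k" by (auto elim: dvdE)
  have "p powi m = (p ^ r) powi k" unfolding k power_int_mult by simp
  hence "th (p ^ r) (1 * p powi m) = 0" using p0 by (subst th_eq_0_iff[OF P1 P0]) auto
  hence weyl0: "weyl 1 m = 0" by (simp add: weyl_def rtheta_def)
  \<comment> \<open>Two nonzero values would be genuine limits; then the product with
    \<open>weyl\<close>, which is 1 near the point, would tend to 0.\<close>
  have "rgamma r p q 1 m * rgamma r p q 1 (- m) = 0"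
  proof (rule ccontr)
    assume "rgamma r p q 1 m * rgamma r p q 1 (- m) \<noteq> 0"
    hence "rgamma r p q 1 m \<noteq> 0" "rgamma r p q 1 (- m) \<noteq> 0" by auto
    then obtain a b where ab: "(\<lambda>w. rgamma_expr r p q w m) \<midarrow>1\<rightarrow> a" "(\<lambda>w. rgamma_expr r p q w (- m)) \<midarrow>1\<rightarrow> b"
      unfolding rgamma_def remove_sings_def by (auto split: if_splits)
    have lim: "(\<lambda>w. rgamma r p q w k) \<midarrow>1\<rightarrow> x" if "(\<lambda>w. rgamma_expr r p q w k) \<midarrow>1\<rightarrow> x" for k x
    proof -
      have "eventually (\<lambda>w. rgamma r p q w k = rgamma_expr r p q w k) (at 1)"
        using eventually_rgamma_eq[OF one_neq_zero, of k] eventually_rgamma_expr_eq[OF one_neq_zero, of k]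
        by eventually_elim simp
      thus ?thesis using that by (simp add: tendsto_cong)
    qed
    have inv: "filterlim (\<lambda>w::complex. 1 / w) (at 1) (at 1)"
      unfolding filterlim_at
    proof
      have "((\<lambda>w::complex. 1 / w) \<longlongrightarrow> 1 / 1) (at 1)" by (intro tendsto_intros) auto
      thus "((\<lambda>w::complex. 1 / w) \<longlongrightarrow> 1) (at 1)" by simp
      have "eventually (\<lambda>w::complex. w \<noteq> 1) (at 1)" by (simp add: eventually_at_filter)
      thus "eventually (\<lambda>w::complex. 1 / w \<in> UNIV \<and> 1 / w \<noteq> 1) (at 1)"
        by eventually_elim auto
    qed
    have "(\<lambda>w. rgamma r p q w m * rgamma r p q (1 / w) (- m) * weyl w m) \<midarrow>1\<rightarrow> a * b * weyl 1 m"
      by (intro tendsto_mult lim ab filterlim_compose[OF lim[OF ab(2)] inv] tendsto_weyl tendsto_ident_at) auto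
    hence "(\<lambda>w. rgamma r p q w m * rgamma r p q (1 / w) (- m) * weyl w m) \<midarrow>1\<rightarrow> 0" by (simp add: weyl0)
    moreover have "(\<lambda>w. rgamma r p q w m * rgamma r p q (1 / w) (- m) * weyl w m) \<midarrow>1\<rightarrow> 1"
      by (rule tendsto_eventually) (rule eventually_weyl, simp)
    ultimately show False using LIM_unique by fastforce
  qed
  thus ?thesis using True weyl0 by simp
qed

end

section \<open>From averages to contour integrals, and the case |p| > |q|\<close>

lemma kappa_swap: "kappa r q p = kappa r p q"
  by (simp add: kappa_def mult.commute)

lemma beta_integral_avg:
  fixes r :: nat and p q :: complex and t :: "nat \<Rightarrow> complex" and n :: "nat \<Rightarrow> int" and \<epsilon> :: int
  assumes "r > 0" and "p \<noteq> 0" and "q \<noteq> 0" and t: "\<And>a. a \<in> {1..6} \<Longrightarrow> t a \<noteq> 0"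
    and "norm p < 1" and "norm q < 1" and t1: "\<And>a. a \<in> {1..6} \<Longrightarrow> norm (t a) < 1"
    and tp: "(\<Prod>a=1..6. t a) = p * q" and n: "(\<Sum>a=1..6. n a) + 3 * \<epsilon> = 0" and \<epsilon>: "\<epsilon> \<in> {0, 1}"
    and pq: "norm p \<le> norm q"
  shows "continuous_on (sphere 0 1) (beta_integrand r p q t n \<epsilon> m)"
    and "kappa r p q * (\<Sum>m<r. 2 * of_real pi * \<i> * avg (beta_integrand r p q t n \<epsilon> (int m)))
      = (\<Prod>a\<in>{1..6}. \<Prod>b\<in>{a<..6}. rgamma r p q (t a * t b) (n a + n b + \<epsilon>))"
proof -
  interpret rarefied_params r p q "{1..6}" \<epsilon>
    using assms by unfold_locales auto
  have adm: "adm t n" unfolding adm_def using t t1 tp n by blast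
  have eq: "beta_integrand r p q t n \<epsilon> m z = \<Delta> t n m z" if "norm z = 1" for m z
  proof -
    have "weyl (z ^ 2) (2 * m + \<epsilon>) = 1 / (rgamma r p q (z ^ 2) (2 * m + \<epsilon>) * rgamma r p q (1 / z ^ 2) (- (2 * m + \<epsilon>)))"
      using that by (intro weyl_eq_inverse) (simp add: norm_power)
    moreover have "1 / z ^ 2 = inverse z ^ 2" by (simp add: power_inverse divide_inverse)
    ultimately show ?thesis unfolding beta_integrand_def \<Delta>_def by (simp add: divide_inverse)
  qed
  show "continuous_on (sphere 0 1) (beta_integrand r p q t n \<epsilon> m)"
    using \<Delta>_continuous[of t n m] t t1 eq by (subst continuous_on_cong[OF refl, of _ _ "\<Delta> t n m"]) auto
  have "(\<Sum>m<r. 2 * of_real pi * \<i> * avg (beta_integrand r p q t n \<epsilon> (int m))) = 2 * of_real pi * \<i> * J t n"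
    unfolding J_def sum_distrib_left by (intro sum.cong refl arg_cong2[where f = "(*)"] avg_cong eq)
  also have "\<dots> = 2 * of_real pi * \<i> * (2 * c_res * R t n)" using J_eq_R[OF pq adm] by simp
  \<comment> \<open>The q-Pochhammer symbols of \<open>kappa\<close> cancel against those of
    \<open>c_res\<close>, and 4 pi i against 2 pi i times 2.\<close>
  also have "kappa r p q * \<dots> = R t n"
    using c_res_nonzero unfolding kappa_def c_res_def by (simp add: field_simps)
  also have "R t n = (\<Prod>a\<in>{1..6}. \<Prod>b\<in>{a<..6}. rgamma r p q (t a * t b) (n a + n b + \<epsilon>))"
    unfolding R_def pair_prod_def by (intro prod.cong refl) auto
  finally show "kappa r p q * (\<Sum>m<r. 2 * of_real pi * \<i> * avg (beta_integrand r p q t n \<epsilon> (int m)))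
      = (\<Prod>a\<in>{1..6}. \<Prod>b\<in>{a<..6}. rgamma r p q (t a * t b) (n a + n b + \<epsilon>))" .
qed

text \<open>Exchanging p and q negates every index. With - n a - \<epsilon> in place of n a, the
  indices n a + m + \<epsilon> and n a - m trade places up to sign, so z must be replaced by
  1/z.\<close>

lemma beta_integrand_swap:
  assumes "rarefied r p q" and t: "\<And>a. a \<in> {1..6} \<Longrightarrow> t a \<noteq> 0" and z: "z \<noteq> 0"
  shows "beta_integrand r p q t n \<epsilon> m z = beta_integrand r q p t (\<lambda>a. - n a - \<epsilon>) \<epsilon> m (1 / z)"
proof -
  interpret rarefied r p q by fact
  have sw: "rgamma r q p w k = rgamma r p q w (- k)" if "w \<noteq> 0" for w k
    using rgamma_swap[OF that, of "- k"] by simp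
  have "rgamma r q p (t a * (1 / z)) (- n a - \<epsilon> + m + \<epsilon>) * rgamma r q p (t a * inverse (1 / z)) (- n a - \<epsilon> - m)
     = rgamma r p q (t a * z) (n a + m + \<epsilon>) * rgamma r p q (t a * inverse z) (n a - m)" if "a \<in> {1..6}" for a
    using t[OF that] z by (simp add: sw divide_inverse algebra_simps)
  hence "(\<Prod>a=1..6. rgamma r q p (t a * (1 / z)) (- n a - \<epsilon> + m + \<epsilon>) * rgamma r q p (t a * inverse (1 / z)) (- n a - \<epsilon> - m))
     = (\<Prod>a=1..6. rgamma r p q (t a * z) (n a + m + \<epsilon>) * rgamma r p q (t a * inverse z) (n a - m))"
    by (intro prod.cong) auto
  moreover have "rgamma r q p ((1 / z) ^ 2) (2 * m + \<epsilon>) * rgamma r q p (inverse (1 / z) ^ 2) (- 2 * m - \<epsilon>)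
     = rgamma r p q (z ^ 2) (2 * m + \<epsilon>) * rgamma r p q (inverse z ^ 2) (- 2 * m - \<epsilon>)"
  proof -
    define k where "k = 2 * m + \<epsilon>"
    have k: "- 2 * m - \<epsilon> = - k" by (simp add: k_def)
    show ?thesis unfolding k k_def[symmetric] using z by (simp add: sw divide_inverse mult.commute)
  qed
  ultimately show ?thesis unfolding beta_integrand_def by simp
qed

theorem theorem2:
  fixes r :: nat and p q :: complex
    and t :: "nat \<Rightarrow> complex" and n :: "nat \<Rightarrow> int" and \<epsilon> :: int
  assumes "r > 0"
    and "p \<noteq> 0" and "q \<noteq> 0" and "\<And>a. a \<in> {1..6} \<Longrightarrow> t a \<noteq> 0"
    and "norm p < 1" and "norm q < 1" and "\<And>a. a \<in> {1..6} \<Longrightarrow> norm (t a) < 1"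
    and "(\<Prod>a=1..6. t a) = p * q"
    and "(\<Sum>a=1..6. n a) + 3 * \<epsilon> = 0"
    and "\<epsilon> \<in> {0, 1}"
  shows "(\<forall>m<r. (\<lambda>z. beta_integrand r p q t n \<epsilon> (int m) z / z)
                  contour_integrable_on circlepath 0 1)
    \<and> kappa r p q * (\<Sum>m<r. contour_integral (circlepath 0 1)
                        (\<lambda>z. beta_integrand r p q t n \<epsilon> (int m) z / z))
      = (\<Prod>a\<in>{1..6}. \<Prod>b\<in>{a<..6}. rgamma r p q (t a * t b) (n a + n b + \<epsilon>))"
proof -
  have "(\<forall>m. continuous_on (sphere 0 1) (beta_integrand r p q t n \<epsilon> m)) \<and>
    kappa r p q * (\<Sum>m<r. 2 * of_real pi * \<i> * avg (beta_integrand r p q t n \<epsilon> (int m)))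
      = (\<Prod>a\<in>{1..6}. \<Prod>b\<in>{a<..6}. rgamma r p q (t a * t b) (n a + n b + \<epsilon>))"
  proof (cases "norm p \<le> norm q")
    case True
    from beta_integral_avg[OF assms True] show ?thesis by blast
  next
    case False
    interpret rarefied r p q using assms by unfold_locales
    define n' where "n' = (\<lambda>a. - n a - \<epsilon>)"
    have "(\<Sum>a=1..6. n' a) + 3 * \<epsilon> = 0"
      using assms(9) by (simp add: n'_def sum_subtractf sum_negf)
    moreover have "(\<Prod>a=1..6. t a) = q * p" using assms(8) by (simp add: mult.commute)
    ultimately have B: "continuous_on (sphere 0 1) (beta_integrand r q p t n' \<epsilon> m)"
      "kappa r q p * (\<Sum>m<r. 2 * of_real pi * \<i> * avg (beta_integrand r q p t n' \<epsilon> (int m)))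
      = (\<Prod>a\<in>{1..6}. \<Prod>b\<in>{a<..6}. rgamma r q p (t a * t b) (n' a + n' b + \<epsilon>))" for m
      using beta_integral_avg[of r q p t n' \<epsilon>] assms False by auto
    have eq: "beta_integrand r p q t n \<epsilon> m z = beta_integrand r q p t n' \<epsilon> m (1 / z)" if "norm z = 1" for m z
      unfolding n'_def by (rule beta_integrand_swap) (use assms that in \<open>auto intro: rarefied_axioms\<close>)
    have "continuous_on (sphere 0 1) (\<lambda>z. beta_integrand r q p t n' \<epsilon> m (1 / z))" for m
      by (rule continuous_on_compose2[OF B(1)]) (auto intro!: continuous_intros simp: norm_divide)
    hence "continuous_on (sphere 0 1) (beta_integrand r p q t n \<epsilon> m)" for m
      using eq by (subst continuous_on_cong[OF refl, of _ _ "\<lambda>z. beta_integrand r q p t n' \<epsilon> m (1 / z)"]) auto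
    moreover have "avg (beta_integrand r p q t n \<epsilon> m) = avg (beta_integrand r q p t n' \<epsilon> m)" for m
    proof -
      have "avg (beta_integrand r p q t n \<epsilon> m) = avg (\<lambda>z. beta_integrand r q p t n' \<epsilon> m (1 / z))"
        by (rule avg_cong) (rule eq)
      thus ?thesis using avg_reciprocal[OF B(1)] by simp
    qed
    moreover have "rgamma r q p (t a * t b) (n' a + n' b + \<epsilon>) = rgamma r p q (t a * t b) (n a + n b + \<epsilon>)"
      if "a \<in> {1..6}" "b \<in> {a<..6}" for a b
      using rgamma_swap[of "t a * t b" "n a + n b + \<epsilon>"] assms(4)[of a] assms(4)[of b] that
      by (simp add: n'_def algebra_simps)
    hence "(\<Prod>a\<in>{1..6}. \<Prod>b\<in>{a<..6}. rgamma r q p (t a * t b) (n' a + n' b + \<epsilon>)) =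
      (\<Prod>a\<in>{1..6}. \<Prod>b\<in>{a<..6}. rgamma r p q (t a * t b) (n a + n b + \<epsilon>))"
      by (intro prod.cong refl) auto
    ultimately show ?thesis using B(2) by (simp add: kappa_swap[of r q p])
  qed
  thus ?thesis using avg_contour_integral by simp
qed

end
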